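(* If reachability on factored graphs is fixed parameter tractable, then there is a constant $C$ such that ${\bf NL}\subseteq {\bf DTIME}(n^C)$.
   Context: All graphs are directed. For directed graphs $G,H$: the Cartesian product $G\,\square\,H$ has vertex set $V(G)\times V(H)$ and an edge $((v_1,u_1),(v_2,u_2))$ iff either $v_1=v_2$ and $(u_1,u_2)\in E(H)$, or $u_1=u_2$ and $(v_1,v_2)\in E(G)$; the tensor product $G\times H$ has vertex set $V(G)\times V(H)$ and an edge iff $(v_1,v_2)\in E(G)$ and $(u_1,u_2)\in E(H)$; the union $G\cup H$ has vertex set $V(G)\cup V(H)$ and edge set $E(G)\cup E(H)$. Vertices of products are flattened tuples, so products are associative. A factored graph $G=f(G_1,\dots,G_m)$ is given by a formula $f$ built from explicitly given input graphs using these operations and parentheses; it has complexity $(n,k)$ if $f$ uses $k-1$ operations and each input graph has at most $n$ vertices. The reachability problem: given a factored graph $G$ and vertices $s,t$, decide whether there is a directed path from $s$ to $t$ in $G$. Reachability is fixed parameter tractable if it can be solved on factored graphs of complexity $(n,k)$ in time $O(g(k)n^C)$ for some function $g$ and absolute constant $C$ independent of $k$. ${\bf NL}$ is the class of languages decidable by nondeterministic Turing machines in logarithmic space. *)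

theory Defs
  imports
    "HOL-Library.Landau_Symbols"
    "Graph_Theory.Pair_Digraph"
begin

section \<open>Turing machines\<close>

text \<open>
  Machines have a read-only input tape, on which the input is enclosed by two end markers, and
  a fixed number of one-way infinite read/write work tapes, initially blank. Letters and states are
  natural numbers; since a machine has finitely many rules, only finitely many of them matter.
  Nondeterminism is the presence of several applicable rules.
\<close>

datatype symbol = Blank | Left_End | Right_End | Letter nat

datatype move = Go_Left | Stay | Go_Right

record rule =
  from_state :: nat
  input_read :: symbol
  work_read :: "symbol list"
  to_state :: nat
  input_move :: move
  work_action :: "(symbol \<times> move) list"

record tm =
  tapes :: nat
  start_state :: nat
  accept_state :: nat
  rules :: "rule set"

definition wf_tm :: "tm \<Rightarrow> bool" where
  "wf_tm M \<longleftrightarrow> finite (rules M) \<and>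
     (\<forall>r \<in> rules M.
        length (work_read r) = tapes M \<and> length (work_action r) = tapes M \<and>
        from_state r \<noteq> accept_state M \<and>
        (input_read r = Left_End \<longrightarrow> input_move r \<noteq> Go_Left) \<and>
        (input_read r = Right_End \<longrightarrow> input_move r \<noteq> Go_Right))"

definition deterministic :: "tm \<Rightarrow> bool" where
  "deterministic M \<longleftrightarrow>
     (\<forall>r \<in> rules M. \<forall>r' \<in> rules M.
        from_state r = from_state r' \<and> input_read r = input_read r' \<and> work_read r = work_read r'
        \<longrightarrow> r = r')"

text \<open>A work tape is given by its head position and its contents.\<close>

type_synonym tape = "nat \<times> (nat \<Rightarrow> symbol)"

record config =
  state :: nat
  input_pos :: nat
  work :: "tape list"

definition input_symbol :: "nat list \<Rightarrow> nat \<Rightarrow> symbol" where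
  "input_symbol w p =
     (if p = 0 then Left_End
      else if p \<le> length w then Letter (w ! (p - 1)) else Right_End)"

text \<open>A head on the leftmost cell of a work tape that is told to go left stays where it is.\<close>

fun shift :: "move \<Rightarrow> nat \<Rightarrow> nat" where
  "shift Go_Left p = p - 1"
| "shift Stay p = p"
| "shift Go_Right p = p + 1"

fun act :: "symbol \<times> move \<Rightarrow> tape \<Rightarrow> tape" where
  "act (a, d) (p, t) = (shift d p, t(p := a))"

definition init :: "tm \<Rightarrow> config" where
  "init M = \<lparr>state = start_state M, input_pos = 0, work = replicate (tapes M) (0, \<lambda>_. Blank)\<rparr>"

definition step :: "tm \<Rightarrow> nat list \<Rightarrow> config \<Rightarrow> config \<Rightarrow> bool" where
  "step M w c c' \<longleftrightarrow>
     (\<exists>r \<in> rules M.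
        from_state r = state c \<and>
        input_read r = input_symbol w (input_pos c) \<and>
        work_read r = map (\<lambda>(p, t). t p) (work c) \<and>
        c' = \<lparr>state = to_state r, input_pos = shift (input_move r) (input_pos c),
              work = map2 act (work_action r) (work c)\<rparr>)"

definition accepts :: "tm \<Rightarrow> nat list \<Rightarrow> bool" where
  "accepts M w \<longleftrightarrow> (\<exists>c. (step M w)\<^sup>*\<^sup>* (init M) c \<and> state c = accept_state M)"

definition halts_within :: "tm \<Rightarrow> nat list \<Rightarrow> nat \<Rightarrow> bool" where
  "halts_within M w T \<longleftrightarrow> (\<forall>c m. (step M w ^^ m) (init M) c \<longrightarrow> m \<le> T)"

text \<open>On every work tape, only the first \<open>S\<close> cells are ever visited.\<close>

definition space_within :: "tm \<Rightarrow> nat list \<Rightarrow> nat \<Rightarrow> bool" where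
  "space_within M w S \<longleftrightarrow>
     (\<forall>c. (step M w)\<^sup>*\<^sup>* (init M) c \<longrightarrow> (\<forall>(p, t) \<in> set (work c). p < S))"


section \<open>Complexity classes\<close>

text \<open>A language is a set of words over some finite alphabet \<open>\<Sigma>\<close>.\<close>

definition DTIME :: "(nat \<Rightarrow> real) \<Rightarrow> nat list set set" where
  "DTIME f = {L. \<exists>\<Sigma> M T. finite \<Sigma> \<and> L \<subseteq> lists \<Sigma> \<and> wf_tm M \<and> deterministic M \<and>
     (\<lambda>n. real (T n)) \<in> O(f) \<and>
     (\<forall>w \<in> lists \<Sigma>. halts_within M w (T (length w)) \<and> (accepts M w \<longleftrightarrow> w \<in> L))}"

text \<open>As usual for deciders, all computation branches halt and all of them obey the space bound.\<close>

definition NL :: "nat list set set" where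
  "NL = {L. \<exists>\<Sigma> M S. finite \<Sigma> \<and> L \<subseteq> lists \<Sigma> \<and> wf_tm M \<and>
     (\<lambda>n. real (S n)) \<in> O(\<lambda>n. ln (real n)) \<and>
     (\<forall>w \<in> lists \<Sigma>. (\<exists>T. halts_within M w T) \<and> space_within M w (S (length w)) \<and>
        (accepts M w \<longleftrightarrow> w \<in> L))}"


section \<open>Factored graphs\<close>

text \<open>
  A vertex of a product is a flattened tuple, represented as a list of vertices of input graphs.
\<close>

type_synonym 'a tuple_graph = "'a list pair_pre_digraph"

definition cartesian_product :: "'a tuple_graph \<Rightarrow> 'a tuple_graph \<Rightarrow> 'a tuple_graph" where
  "cartesian_product G H =
     \<lparr>pverts = {v @ u | v u. v \<in> pverts G \<and> u \<in> pverts H},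
      parcs = {(v\<^sub>1 @ u\<^sub>1, v\<^sub>2 @ u\<^sub>2) | v\<^sub>1 u\<^sub>1 v\<^sub>2 u\<^sub>2.
        v\<^sub>1 \<in> pverts G \<and> v\<^sub>2 \<in> pverts G \<and> u\<^sub>1 \<in> pverts H \<and> u\<^sub>2 \<in> pverts H \<and>
        (v\<^sub>1 = v\<^sub>2 \<and> (u\<^sub>1, u\<^sub>2) \<in> parcs H \<or> u\<^sub>1 = u\<^sub>2 \<and> (v\<^sub>1, v\<^sub>2) \<in> parcs G)}\<rparr>"

definition tensor_product :: "'a tuple_graph \<Rightarrow> 'a tuple_graph \<Rightarrow> 'a tuple_graph" where
  "tensor_product G H =
     \<lparr>pverts = {v @ u | v u. v \<in> pverts G \<and> u \<in> pverts H},
      parcs = {(v\<^sub>1 @ u\<^sub>1, v\<^sub>2 @ u\<^sub>2) | v\<^sub>1 u\<^sub>1 v\<^sub>2 u\<^sub>2.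
        (v\<^sub>1, v\<^sub>2) \<in> parcs G \<and> (u\<^sub>1, u\<^sub>2) \<in> parcs H}\<rparr>"

definition graph_union :: "'a tuple_graph \<Rightarrow> 'a tuple_graph \<Rightarrow> 'a tuple_graph" where
  "graph_union G H = \<lparr>pverts = pverts G \<union> pverts H, parcs = parcs G \<union> parcs H\<rparr>"

text \<open>An explicitly given graph consists of a list of vertices and a list of edges.\<close>

type_synonym explicit_graph = "nat list \<times> (nat \<times> nat) list"

text \<open>
  A formula together with its input graphs, which stand at the leaves; \<open>k - 1\<close> operations thus go
  with \<open>k\<close> occurrences of input graphs.
\<close>

datatype factored_graph =
  Input explicit_graph
| Cartesian factored_graph factored_graph
| Tensor factored_graph factored_graph
| Graph_Union factored_graph factored_graph

definition input_graph :: "explicit_graph \<Rightarrow> nat tuple_graph" where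
  "input_graph G = \<lparr>pverts = {[v] | v. v \<in> set (fst G)},
                    parcs = {([u], [v]) | u v. (u, v) \<in> set (snd G)}\<rparr>"

fun graph_of :: "factored_graph \<Rightarrow> nat tuple_graph" where
  "graph_of (Input G) = input_graph G"
| "graph_of (Cartesian F F') = cartesian_product (graph_of F) (graph_of F')"
| "graph_of (Tensor F F') = tensor_product (graph_of F) (graph_of F')"
| "graph_of (Graph_Union F F') = graph_union (graph_of F) (graph_of F')"

fun operations :: "factored_graph \<Rightarrow> nat" where
  "operations (Input G) = 0"
| "operations (Cartesian F F') = Suc (operations F + operations F')"
| "operations (Tensor F F') = Suc (operations F + operations F')"
| "operations (Graph_Union F F') = Suc (operations F + operations F')"

fun inputs :: "factored_graph \<Rightarrow> explicit_graph set" where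
  "inputs (Input G) = {G}"
| "inputs (Cartesian F F') = inputs F \<union> inputs F'"
| "inputs (Tensor F F') = inputs F \<union> inputs F'"
| "inputs (Graph_Union F F') = inputs F \<union> inputs F'"

definition wf_explicit :: "explicit_graph \<Rightarrow> bool" where
  "wf_explicit G \<longleftrightarrow> distinct (fst G) \<and> distinct (snd G) \<and> set (snd G) \<subseteq> set (fst G) \<times> set (fst G)"

text \<open>
  Input graphs may share vertices. Up to renaming, the vertices of all the input graphs together
  are \<open>0, \<dots>, N - 1\<close>. Fixing such names keeps the size of the encoding below bounded in terms of
  the complexity \<open>(n, k)\<close>; arbitrary numbers as names could be arbitrarily long.
\<close>

definition wf_factored :: "factored_graph \<Rightarrow> bool" where
  "wf_factored F \<longleftrightarrow> (\<forall>G \<in> inputs F. wf_explicit G) \<and>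
     (\<exists>N. (\<Union>G \<in> inputs F. set (fst G)) = {..<N})"

definition has_complexity :: "factored_graph \<Rightarrow> nat \<Rightarrow> nat \<Rightarrow> bool" where
  "has_complexity F n k \<longleftrightarrow> k = operations F + 1 \<and> (\<forall>G \<in> inputs F. card (set (fst G)) \<le> n)"


section \<open>Reachability on factored graphs\<close>

text \<open>
  Instances are encoded over the letters \<open>0, \<dots>, 7\<close>: vertex names in binary, most significant digit
  first, closed by \<open>2\<close>; lists closed by \<open>3\<close>; formulas in prefix notation, with \<open>4\<close> marking an input
  graph and \<open>5\<close>, \<open>6\<close>, \<open>7\<close> standing for the three operations.
\<close>

fun binary :: "nat \<Rightarrow> nat list" where
  "binary m = (if m < 2 then [m] else binary (m div 2) @ [m mod 2])"

declare binary.simps [simp del]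

definition encode_list :: "nat list \<Rightarrow> nat list" where
  "encode_list vs = concat (map (\<lambda>v. binary v @ [2]) vs) @ [3]"

fun encode_factored :: "factored_graph \<Rightarrow> nat list" where
  "encode_factored (Input (vs, es)) =
     4 # encode_list vs @ encode_list (concat (map (\<lambda>(u, v). [u, v]) es))"
| "encode_factored (Cartesian F F') = 5 # encode_factored F @ encode_factored F'"
| "encode_factored (Tensor F F') = 6 # encode_factored F @ encode_factored F'"
| "encode_factored (Graph_Union F F') = 7 # encode_factored F @ encode_factored F'"

definition encode_instance :: "factored_graph \<Rightarrow> nat list \<Rightarrow> nat list \<Rightarrow> nat list" where
  "encode_instance F s t = encode_factored F @ encode_list s @ encode_list t"

text \<open>
  Solvability in time \<open>O(g(k) n^C)\<close> by one deterministic machine. The function \<open>g\<close> is arbitrary, and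
  nothing is demanded on words that do not encode an instance.
\<close>

definition reachability_fpt :: bool where
  "reachability_fpt \<longleftrightarrow>
     (\<exists>M (g :: nat \<Rightarrow> nat) (C :: nat) (c :: nat). wf_tm M \<and> deterministic M \<and>
        (\<forall>F n k s t.
           wf_factored F \<and> has_complexity F n k \<and>
           s \<in> pverts (graph_of F) \<and> t \<in> pverts (graph_of F) \<longrightarrow>
             halts_within M (encode_instance F s t) (c * (g k * n ^ C)) \<and>
             (accepts M (encode_instance F s t) \<longleftrightarrow> s \<rightarrow>\<^sup>*\<^bsub>with_proj (graph_of F)\<^esub> t)))"

end

theory Submission
  imports Defs
begin

text \<open>
  A nondeterministic machine \<open>M\<close> with work space \<open>S = O(log n)\<close> has a configuration graph that factors
  into boundedly many graphs on \<open>N = n + O(1)\<close> vertices. The head positions are single coordinates.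
  The contents of a work tape on either side of the head are split into \<open>c\<close> stacks, where cell \<open>i\<close>
  belongs to stack \<open>i mod c\<close>; for a large constant \<open>c\<close> each stack is a number below \<open>N\<close>. A rule of \<open>M\<close>
  changes every coordinate independently, by an affine map \<open>x \<mapsto> b x + a\<close>, its inverse or a single
  edge, so the configuration graph is a union of tensor products. Only the test of the input symbol
  depends on the word \<open>w\<close>. Acceptance is thus reachability in a factored graph of complexity
  \<open>(N, k)\<close> with \<open>k\<close> depending on \<open>M\<close> only.

  A deterministic machine writes this instance in time \<open>O(N\<^sup>2)\<close>: it lists the binary names of all
  vertices on two tapes and enumerates the edges \<open>(x, b x + a)\<close> by moving two heads over the lists at
  speeds \<open>1\<close> and \<open>b\<close>. It then runs the given algorithm on the instance, in time \<open>O(N\<^sup>C)\<close>.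
  Neither exponent depends on \<open>M\<close>.
\<close>

section \<open>Programs for multitape machines\<close>


text \<open>A search through all configurations also takes polynomial time, but its exponent grows
  with the constant in the space bound of \<open>M\<close>. Factoring turns that constant into a
  number of coordinates, hence into \<open>k\<close>, and for a fixed machine the arbitrary function
  \<open>g\<close> contributes only a constant factor \<open>g k\<close>. What remains are the
  exponent \<open>C\<close> of the assumed algorithm and the exponent 2 of writing the instance. The
  vertex set of the product contains many tuples that encode no configuration, and the edges at such
  tuples are not controlled. Only paths from the encoded initial configuration matter, and these
  pass through encodings of reachable configurations until the accepting state is left to a final
  clean-up, which leads all accepting configurations to one target. Writing the instance requires no
  arithmetic: the factors are affine maps, so that two pointers moving at constant speeds list their
  edges.\<close>

datatype tid = Out | Xs | Ys | Ctr

lemma UNIV_tid: "(UNIV :: tid set) = {Out, Xs, Ys, Ctr}"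
  using tid.exhaust by blast

instance tid :: finite
  by standard (simp add: UNIV_tid)

abbreviation tids :: "tid list" where "tids \<equiv> [Out, Xs, Ys, Ctr]"

type_synonym memory = "nat \<times> (tid \<Rightarrow> tape)"

text \<open>\<open>Basic\<close> is a single machine step on the input head and all four tapes. The
  functions are defined on all symbols; a finite transition table arises only after restriction to a
  finite alphabet \<open>\<Gamma>\<close>.\<close>

datatype prog =
  Basic "symbol \<Rightarrow> (tid \<Rightarrow> symbol) \<Rightarrow> move \<times> (tid \<Rightarrow> symbol \<times> move)"
| Seq prog prog
| Cond "symbol \<Rightarrow> (tid \<Rightarrow> symbol) \<Rightarrow> bool" prog prog
| While "symbol \<Rightarrow> (tid \<Rightarrow> symbol) \<Rightarrow> bool" prog

definition idle :: "(tid \<Rightarrow> symbol) \<Rightarrow> tid \<Rightarrow> symbol \<times> move" where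
  "idle s = (\<lambda>j. (s j, Stay))"

text \<open>The program counter is the stack of programs still to be executed. Unfolding
  \<open>Seq\<close>, \<open>Cond\<close> or \<open>While\<close> costs one idle step, which is the
  source of the \<open>+ 1\<close> in the time bounds.\<close>

fun control :: "prog list \<Rightarrow> symbol \<Rightarrow> (tid \<Rightarrow> symbol) \<Rightarrow>
    prog list \<times> move \<times> (tid \<Rightarrow> symbol \<times> move)" where
  "control [] a s = ([], Stay, idle s)"
| "control (Basic f # k) a s = (k, f a s)"
| "control (Seq p q # k) a s = (p # q # k, Stay, idle s)"
| "control (Cond b p q # k) a s = ((if b a s then p else q) # k, Stay, idle s)"
| "control (While b p # k) a s = (if b a s then p # While b p # k else k, Stay, idle s)"

definition scanned :: "(tid \<Rightarrow> tape) \<Rightarrow> tid \<Rightarrow> symbol" where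
  "scanned t = (\<lambda>j. snd (t j) (fst (t j)))"

definition pstep :: "nat list \<Rightarrow> prog list \<times> memory \<Rightarrow> prog list \<times> memory" where
  "pstep w = (\<lambda>(k, i, t). case control k (input_symbol w i) (scanned t) of
     (k', d, u) \<Rightarrow> (k', shift d i, \<lambda>j. act (u j) (t j)))"

text \<open>Quantifying over the continuation \<open>k\<close> lets runs be chained inside any
  context. The number of steps is only bounded, so that branches of different length share one
  bound.\<close>

definition runs :: "nat list \<Rightarrow> prog \<Rightarrow> nat \<Rightarrow> memory \<Rightarrow> memory \<Rightarrow> bool" where
  "runs w p T m m' \<longleftrightarrow> (\<forall>k. \<exists>\<tau> \<le> T. (pstep w ^^ \<tau>) (p # k, m) = (k, m'))"

text \<open>\<open>input_symbol\<close> is \<open>Right_End\<close> at every position past the word;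
  it is the condition on moves at \<open>Right_End\<close> that confines the head to
  \<open>length w + 1\<close>.\<close>

lemma input_pos_step:
  assumes "wf_tm M" "step M w cf cf'" "input_pos cf \<le> length w + 1"
  shows "input_pos cf' \<le> length w + 1"
proof -
  obtain r where r: "r \<in> rules M" "input_read r = input_symbol w (input_pos cf)"
    "input_pos cf' = shift (input_move r) (input_pos cf)"
    using assms(2) unfolding step_def by force
  then have "input_read r = Right_End \<longrightarrow> input_move r \<noteq> Go_Right" using assms(1) by (simp add: wf_tm_def)
  with r assms(3) show ?thesis
    by (cases "input_move r") (auto simp: input_symbol_def split: if_splits)
qed

lemma act_eq: "act u T = (shift (snd u) (fst T), (snd T)(fst T := fst u))"
  by (cases u; cases T) simp

lemma act_idle [simp]: "(\<lambda>j. act (idle (scanned t) j) (t j)) = t"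
  by (simp add: act_eq idle_def scanned_def)

section \<open>Time bounds for the program constructs\<close>

lemma runs_mono: "runs w p T m m' \<Longrightarrow> T \<le> U \<Longrightarrow> runs w p U m m'"
  unfolding runs_def by (meson le_trans)

lemma runs_Basic:
  "f (input_symbol w i) (scanned t) = (d, u) \<Longrightarrow>
   runs w (Basic f) 1 (i, t) (shift d i, \<lambda>j. act (u j) (t j))"
  unfolding runs_def by (auto intro!: exI[of _ 1] simp: pstep_def)

lemma funpow_trans:
  assumes "(f ^^ a) x = y" "(f ^^ b) y = z"
  shows "(f ^^ (b + a)) x = z"
  using assms by (simp add: funpow_add)

lemma runs_Seq:
  assumes "runs w p T m m'" "runs w q U m' m''"
  shows "runs w (Seq p q) (T + U + 1) m m''"
  unfolding runs_def
proof
  fix k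
  obtain a where a: "a \<le> T" "(pstep w ^^ a) (p # q # k, m) = (q # k, m')"
    using assms(1) unfolding runs_def by blast
  obtain b where b: "b \<le> U" "(pstep w ^^ b) (q # k, m') = (k, m'')"
    using assms(2) unfolding runs_def by blast
  have "(pstep w ^^ 1) (Seq p q # k, m) = (p # q # k, m)"
    by (cases m) (simp add: pstep_def)
  from funpow_trans[OF this funpow_trans[OF a(2) b(2)]] a b
  show "\<exists>\<tau>\<le>T + U + 1. (pstep w ^^ \<tau>) (Seq p q # k, m) = (k, m'')"
    by (intro exI[of _ "b + a + 1"]) auto
qed

lemma runs_Cond:
  assumes "runs w (if b (input_symbol w (fst m)) (scanned (snd m)) then p else q) T m m'"
  shows "runs w (Cond b p q) (T + 1) m m'"
  unfolding runs_def
proof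
  fix k
  let ?r = "if b (input_symbol w (fst m)) (scanned (snd m)) then p else q"
  obtain a where a: "a \<le> T" "(pstep w ^^ a) (?r # k, m) = (k, m')"
    using assms(1) unfolding runs_def by blast
  have "(pstep w ^^ 1) (Cond b p q # k, m) = (?r # k, m)"
    by (cases m) (simp add: pstep_def)
  from funpow_trans[OF this a(2)] a
  show "\<exists>\<tau>\<le>T + 1. (pstep w ^^ \<tau>) (Cond b p q # k, m) = (k, m')"
    by (intro exI[of _ "a + 1"]) auto
qed

lemma runs_While_end:
  "\<not> b (input_symbol w (fst m)) (scanned (snd m)) \<Longrightarrow> runs w (While b p) 1 m m"
  unfolding runs_def by (cases m) (auto intro!: exI[of _ 1] simp: pstep_def)

lemma runs_While_step:
  assumes "b (input_symbol w (fst m)) (scanned (snd m))"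
    "runs w p T m m'" "runs w (While b p) U m' m''"
  shows "runs w (While b p) (T + U + 1) m m''"
  unfolding runs_def
proof
  fix k
  obtain a where a: "a \<le> T" "(pstep w ^^ a) (p # While b p # k, m) = (While b p # k, m')"
    using assms(2) unfolding runs_def by blast
  obtain c where c: "c \<le> U" "(pstep w ^^ c) (While b p # k, m') = (k, m'')"
    using assms(3) unfolding runs_def by blast
  have "(pstep w ^^ 1) (While b p # k, m) = (p # While b p # k, m)"
    using assms(1) by (cases m) (simp add: pstep_def)
  from funpow_trans[OF this funpow_trans[OF a(2) c(2)]] a c
  show "\<exists>\<tau>\<le>T + U + 1. (pstep w ^^ \<tau>) (While b p # k, m) = (k, m'')"
    by (intro exI[of _ "c + a + 1"]) auto
qed

text \<open>The control states reached while a program is executed are the continuations that arise.\<close>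

fun conts :: "prog \<Rightarrow> prog list \<Rightarrow> prog list set" where
  "conts (Basic f) k = {Basic f # k}"
| "conts (Seq p q) k = insert (Seq p q # k) (conts p (q # k) \<union> conts q k)"
| "conts (Cond b p q) k = insert (Cond b p q # k) (conts p k \<union> conts q k)"
| "conts (While b p) k = insert (While b p # k) (conts p (While b p # k))"

lemma finite_conts: "finite (conts p k)"
  by (induction p arbitrary: k) auto

lemma conts_self: "p # k \<in> conts p k"
  by (cases p) auto

lemma conts_nonempty: "x \<in> conts p k \<Longrightarrow> x \<noteq> []"
  by (induction p arbitrary: k) auto

text \<open>A step stays among the continuations of \<open>p\<close> until it exits to
  \<open>k\<close>. With \<open>finite_conts\<close> this leaves finitely many control
  states.\<close>

lemma control_conts: "x \<in> conts p k \<Longrightarrow> fst (control x a s) \<in> insert k (conts p k)"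
  proof (induction p arbitrary: k)
  case (Seq p q)
  then consider "x = Seq p q # k" | "x \<in> conts p (q # k)" | "x \<in> conts q k" by auto
  then show ?case using Seq.IH(1)[of "q # k"] Seq.IH(2)[of k] conts_self[of q k] conts_self[of p "q # k"]
    by cases auto
next
  case (Cond b p q)
  then consider "x = Cond b p q # k" | "x \<in> conts p k" | "x \<in> conts q k" by auto
  then show ?case using Cond.IH(1)[of k] Cond.IH(2)[of k] conts_self[of p k] conts_self[of q k]
    by cases auto
next
  case (While b p)
  then consider "x = While b p # k" | "x \<in> conts p (While b p # k)" by auto
  then show ?case using While.IH[of "While b p # k"] conts_self[of p "While b p # k"]
    by cases auto
qed simp

section \<open>Alphabet and end markers\<close>

text \<open>The two conditions a legal finite machine needs: symbols written lie in
  \<open>\<Gamma>\<close> if those read do, and the input head is never sent across an end marker,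
  as \<open>wf_tm\<close> demands.\<close>

fun safe :: "symbol set \<Rightarrow> prog \<Rightarrow> bool" where
  "safe \<Gamma> (Basic f) \<longleftrightarrow> (\<forall>a s. a \<in> \<Gamma> \<and> (\<forall>j. s j \<in> \<Gamma>) \<longrightarrow> (\<forall>j. fst (snd (f a s) j) \<in> \<Gamma>)) \<and>
     (\<forall>s. fst (f Left_End s) \<noteq> Go_Left \<and> fst (f Right_End s) \<noteq> Go_Right)"
| "safe \<Gamma> (Seq p q) \<longleftrightarrow> safe \<Gamma> p \<and> safe \<Gamma> q"
| "safe \<Gamma> (Cond b p q) \<longleftrightarrow> safe \<Gamma> p \<and> safe \<Gamma> q"
| "safe \<Gamma> (While b p) \<longleftrightarrow> safe \<Gamma> p"

lemma safe_conts: "x \<in> conts p k \<Longrightarrow> safe \<Gamma> p \<Longrightarrow> list_all (safe \<Gamma>) k \<Longrightarrow> list_all (safe \<Gamma>) x"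
  by (induction p arbitrary: k) auto

lemma safe_control:
  assumes "list_all (safe \<Gamma>) k" "control k a s = (k', d, u)"
  shows "a \<in> \<Gamma> \<Longrightarrow> (\<And>j. s j \<in> \<Gamma>) \<Longrightarrow> fst (u j) \<in> \<Gamma>"
    and "a = Left_End \<Longrightarrow> d \<noteq> Go_Left" and "a = Right_End \<Longrightarrow> d \<noteq> Go_Right"
proof -
  have "(a \<in> \<Gamma> \<longrightarrow> (\<forall>j. s j \<in> \<Gamma>) \<longrightarrow> fst (u j) \<in> \<Gamma>) \<and>
    (a = Left_End \<longrightarrow> d \<noteq> Go_Left) \<and> (a = Right_End \<longrightarrow> d \<noteq> Go_Right)"
  proof (cases k)
    case (Cons p ps)
    then show ?thesis
    proof (cases p)
      case (Basic f)
      then have "f a s = (d, u)" "safe \<Gamma> (Basic f)" using assms Cons by auto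
      then show ?thesis by (metis fst_conv safe.simps(1) snd_conv)
    qed (use assms Cons in \<open>auto simp: idle_def\<close>)
  qed (use assms in \<open>auto simp: idle_def\<close>)
  then show "a \<in> \<Gamma> \<Longrightarrow> (\<And>j. s j \<in> \<Gamma>) \<Longrightarrow> fst (u j) \<in> \<Gamma>"
    and "a = Left_End \<Longrightarrow> d \<noteq> Go_Left" and "a = Right_End \<Longrightarrow> d \<noteq> Go_Right" by auto
qed


definition valid_memory :: "symbol set \<Rightarrow> memory \<Rightarrow> bool" where
  "valid_memory \<Gamma> m \<longleftrightarrow> (\<forall>j i. snd (snd m j) i \<in> \<Gamma>)"

lemma pstep_valid:
  assumes "valid_memory \<Gamma> m" "list_all (safe \<Gamma>) k" "\<And>i. input_symbol w i \<in> \<Gamma>"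
    "pstep w (k, m) = (k', m')"
  shows "valid_memory \<Gamma> m'"
proof -
  obtain i t where m: "m = (i, t)" by (cases m)
  obtain d u where tr: "control k (input_symbol w i) (scanned t) = (k', d, u)"
    and m': "m' = (shift d i, \<lambda>j. act (u j) (t j))"
    using assms(4) by (auto simp: m pstep_def split: prod.splits)
  have "scanned t j \<in> \<Gamma>" for j
    using assms(1) by (auto simp: m valid_memory_def scanned_def)
  then have "fst (u j) \<in> \<Gamma>" for j
    using safe_control(1)[OF assms(2) tr] assms(3) by blast
  then have "snd (act (u j) (t j)) x \<in> \<Gamma>" for j x
    using assms(1) by (cases "u j"; cases "t j") (auto simp: m valid_memory_def, (metis snd_conv fst_conv)+)
  then show ?thesis by (simp add: m' valid_memory_def)
qed

text \<open>
  The machine \<open>M\<close> reads its input from the tape \<open>Out\<close>, once the program \<open>p\<close> has written it there.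
\<close>

definition code_conts :: "(prog list + nat \<Rightarrow> nat) \<Rightarrow> tm \<Rightarrow> prog list \<Rightarrow> nat" where
  "code_conts e M k = (if k = [] then e (Inr (start_state M)) else e (Inl k))"

definition gen_rule :: "(prog list + nat \<Rightarrow> nat) \<Rightarrow> tm \<Rightarrow> prog list \<Rightarrow> symbol \<Rightarrow> (tid \<Rightarrow> symbol) \<Rightarrow> rule" where
  "gen_rule e M k a s = (case control k a s of (k', d, u) \<Rightarrow>
     \<lparr>from_state = e (Inl k), input_read = a,
      work_read = map s tids @ replicate (tapes M) Blank,
      to_state = code_conts e M k', input_move = d,
      work_action = map u tids @ replicate (tapes M) (Blank, Stay)\<rparr>)"

text \<open>The head of \<open>Out\<close> acts as the input head of \<open>M\<close>: it writes
  back what it reads, and the true input head rests. A rule has to name every scanned symbol, so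
  each rule of \<open>M\<close> is copied for all \<open>a\<close> and \<open>s\<close>.\<close>

definition sim_rule :: "(prog list + nat \<Rightarrow> nat) \<Rightarrow> rule \<Rightarrow> symbol \<Rightarrow> (tid \<Rightarrow> symbol) \<Rightarrow> rule" where
  "sim_rule e r a s =
     \<lparr>from_state = e (Inr (from_state r)), input_read = a,
      work_read = input_read r # map s [Xs, Ys, Ctr] @ work_read r,
      to_state = e (Inr (to_state r)), input_move = Stay,
      work_action = (input_read r, input_move r) # map (idle s) [Xs, Ys, Ctr] @ work_action r\<rparr>"

definition composed :: "(prog list + nat \<Rightarrow> nat) \<Rightarrow> symbol set \<Rightarrow> prog \<Rightarrow> tm \<Rightarrow> tm" where
  "composed e \<Gamma> p M =
     \<lparr>tapes = 4 + tapes M, start_state = e (Inl [p]), accept_state = e (Inr (accept_state M)),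
      rules = {gen_rule e M k a s | k a s. k \<in> conts p [] \<and> a \<in> \<Gamma> \<and> s \<in> UNIV \<rightarrow> \<Gamma>} \<union>
        {sim_rule e r a s | r a s. r \<in> rules M \<and> a \<in> \<Gamma> \<and> s \<in> UNIV \<rightarrow> \<Gamma>}\<rparr>"

lemma finite_fun_tid: "finite (\<Gamma> :: symbol set) \<Longrightarrow> finite ((UNIV :: tid set) \<rightarrow> \<Gamma>)"
proof -
  assume "finite \<Gamma>"
  then have "finite (PiE (UNIV :: tid set) (\<lambda>_. \<Gamma>))" by (intro finite_PiE) auto
  moreover have "PiE (UNIV :: tid set) (\<lambda>_. \<Gamma>) = UNIV \<rightarrow> \<Gamma>" by (auto simp: PiE_def)
  ultimately show ?thesis by simp
qed

section \<open>A machine that runs a program and then another machine\<close>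

text \<open>\<open>prog\<close> is uncountable, so no numbering of all control states exists.
  Injectivity is required only on the finitely many continuations that occur and on the states of
  \<open>M\<close>.\<close>

locale composition =
  fixes e :: "prog list + nat \<Rightarrow> nat" and \<Gamma> :: "symbol set" and p :: prog and M :: tm
  assumes wf: "wf_tm M" and det: "deterministic M" and fin: "finite \<Gamma>" and safe_p: "safe \<Gamma> p"
    and inj: "inj_on e (Inl ` conts p [] \<union> range Inr)"
begin

abbreviation "M' \<equiv> composed e \<Gamma> p M"

lemma e_eq [simp]:
  "e (Inr a) = e (Inr b) \<longleftrightarrow> a = b"
  "k \<in> conts p [] \<Longrightarrow> e (Inl k) \<noteq> e (Inr a)"
  "k \<in> conts p [] \<Longrightarrow> e (Inr a) \<noteq> e (Inl k)"
  "k \<in> conts p [] \<Longrightarrow> k' \<in> conts p [] \<Longrightarrow> e (Inl k) = e (Inl k') \<longleftrightarrow> k = k'"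
  using inj by (auto dest!: inj_onD)

lemma safe_k: "k \<in> insert [] (conts p []) \<Longrightarrow> list_all (safe \<Gamma>) k"
  using safe_conts[of k p "[]" \<Gamma>] safe_p by auto

lemma wf': "wf_tm M'"
proof -
  let ?A = "(\<lambda>(k, a, s). gen_rule e M k a s) ` (conts p [] \<times> \<Gamma> \<times> (UNIV \<rightarrow> \<Gamma>))"
  let ?B = "(\<lambda>(r, a, s). sim_rule e r a s) ` (rules M \<times> \<Gamma> \<times> (UNIV \<rightarrow> \<Gamma>))"
  have "rules M' \<subseteq> ?A \<union> ?B" by (force simp: composed_def image_iff)
  moreover have "finite (rules M)" using wf by (simp add: wf_tm_def)
  ultimately have "finite (rules M')"
    using fin finite_conts finite_fun_tid by (meson finite_SigmaI finite_UnI finite_imageI finite_subset)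
  moreover have "length (work_read r) = tapes M' \<and> length (work_action r) = tapes M' \<and>
        from_state r \<noteq> accept_state M' \<and>
        (input_read r = Left_End \<longrightarrow> input_move r \<noteq> Go_Left) \<and>
        (input_read r = Right_End \<longrightarrow> input_move r \<noteq> Go_Right)" if r: "r \<in> rules M'" for r
  proof -
    from r consider k a s where "r = gen_rule e M k a s" "k \<in> conts p []"
      | q a s where "r = sim_rule e q a s" "q \<in> rules M" by (auto simp: composed_def)
    then show ?thesis
    proof cases
      case 1
      obtain k' d u where tr: "control k a s = (k', d, u)" by (metis prod_cases3)
      with 1 safe_control(2,3)[OF safe_k tr] show ?thesis by (auto simp: gen_rule_def composed_def)
    next
      case 2
      then show ?thesis using wf by (auto simp: sim_rule_def composed_def wf_tm_def)
    qed
  qed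
  ultimately show ?thesis by (simp add: wf_tm_def)
qed

lemma tid_fun_eq: "map s tids = map s' tids \<Longrightarrow> s = s'"
  by (rule ext) (metis (full_types) list.inject list.simps(9) tid.exhaust)

lemma det': "deterministic M'"
  unfolding deterministic_def
proof (intro ballI impI)
  fix r r' assume r: "r \<in> rules M'" "r' \<in> rules M'"
    and eq: "from_state r = from_state r' \<and> input_read r = input_read r' \<and> work_read r = work_read r'"
  have cases: "(\<exists>k a s. r = gen_rule e M k a s \<and> k \<in> conts p []) \<or>
    (\<exists>q a s. r = sim_rule e q a s \<and> q \<in> rules M)" if "r \<in> rules M'" for r
    using that unfolding composed_def by simp blast
  have gen: "from_state (gen_rule e M k a s) = e (Inl k)" "input_read (gen_rule e M k a s) = a"
    "work_read (gen_rule e M k a s) = map s tids @ replicate (tapes M) Blank" for k a s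
    by (auto simp: gen_rule_def split: prod.splits)
  show "r = r'"
    using cases[OF r(1)] cases[OF r(2)]
  proof (elim disjE exE conjE)
    fix k a s k' a' s' assume *: "r = gen_rule e M k a s" "k \<in> conts p []"
      "r' = gen_rule e M k' a' s'" "k' \<in> conts p []"
    have "k = k'" "a = a'" using eq * by (simp_all add: gen)
    moreover have "s = s'" using eq * by (intro tid_fun_eq) (simp add: gen)
    ultimately show ?thesis using * by simp
  next
    fix q a s q' a' s' assume *: "r = sim_rule e q a s" "q \<in> rules M"
      "r' = sim_rule e q' a' s'" "q' \<in> rules M"
    have "q = q'" using eq * det by (simp add: sim_rule_def deterministic_def)
    then show ?thesis using eq * by (simp add: sim_rule_def idle_def)
  qed (use eq in \<open>auto simp: gen sim_rule_def\<close>)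
qed

definition gen_config :: "prog list \<Rightarrow> memory \<Rightarrow> config" where
  "gen_config k m = \<lparr>state = code_conts e M k, input_pos = fst m,
     work = map (snd m) tids @ replicate (tapes M) (0, \<lambda>_. Blank)\<rparr>"

definition sim_config :: "memory \<Rightarrow> config \<Rightarrow> config" where
  "sim_config m c = \<lparr>state = e (Inr (state c)), input_pos = fst m,
     work = (input_pos c, snd (snd m Out)) # map (snd m) [Xs, Ys, Ctr] @ work c\<rparr>"

lemma gen_step:
  assumes "k \<in> conts p []" "valid_memory \<Gamma> m" "\<And>i. input_symbol w i \<in> \<Gamma>"
    "pstep w (k, m) = (k', m')"
  shows "step M' w (gen_config k m) (gen_config k' m')"
proof -
  obtain i t where m: "m = (i, t)" by (cases m)
  obtain d u where tr: "control k (input_symbol w i) (scanned t) = (k', d, u)"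
    and m': "m' = (shift d i, \<lambda>j. act (u j) (t j))"
    using assms(4) by (auto simp: m pstep_def split: prod.splits)
  let ?r = "gen_rule e M k (input_symbol w i) (scanned t)"
  have "scanned t \<in> UNIV \<rightarrow> \<Gamma>"
    using assms(2) by (auto simp: m valid_memory_def scanned_def)
  then have "?r \<in> rules M'" using assms(1,3) unfolding composed_def by simp blast
  moreover have r: "?r = \<lparr>from_state = e (Inl k), input_read = input_symbol w i,
      work_read = map (scanned t) tids @ replicate (tapes M) Blank,
      to_state = code_conts e M k', input_move = d,
      work_action = map u tids @ replicate (tapes M) (Blank, Stay)\<rparr>"
    by (simp add: gen_rule_def tr)
  moreover have "state (gen_config k m) = e (Inl k)"
    using assms(1) conts_nonempty by (auto simp: gen_config_def code_conts_def)
  moreover have "map (\<lambda>(p, t). t p) (work (gen_config k m)) =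
      map (scanned t) tids @ replicate (tapes M) Blank"
    by (simp add: gen_config_def m scanned_def case_prod_beta)
  moreover have "map2 act (map u tids @ replicate (tapes M) (Blank, Stay)) (work (gen_config k m)) =
      work (gen_config k' m')"
    by (simp add: gen_config_def m m' fun_upd_idem)
  moreover have "input_pos (gen_config k m) = i" by (simp add: gen_config_def m)
  moreover have "gen_config k' m' = \<lparr>state = code_conts e M k', input_pos = shift d i,
      work = work (gen_config k' m')\<rparr>"
    by (simp add: gen_config_def m')
  ultimately show ?thesis
    unfolding step_def by (intro bexI[of _ ?r]) simp_all
qed

text \<open>In \<open>pstep\<close> the empty continuation idles forever, whereas the machine has
  then handed over to \<open>M\<close>. Hence only some \<open>\<tau>' \<le> \<tau>\<close> is
  claimed: the idle steps at the end are cut off.\<close>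

lemma gen_steps:
  assumes "(pstep w ^^ \<tau>) (k, m) = ([], m')" "k \<in> insert [] (conts p [])"
    "valid_memory \<Gamma> m" "\<And>i. input_symbol w i \<in> \<Gamma>"
  shows "\<exists>\<tau>' \<le> \<tau>. (step M' w ^^ \<tau>') (gen_config k m) (gen_config [] m')"
  using assms
proof (induction \<tau> arbitrary: k m)
  case 0
  then show ?case by auto
next
  case (Suc \<tau>)
  show ?case
  proof (cases "k = []")
    case True
    have "(pstep w ^^ i) ([], m) = ([], m)" for i
      by (induction i) (auto simp: pstep_def split: prod.splits)
    then have "m' = m" using Suc.prems(1) True by (metis prod.inject)
    then show ?thesis using True by (intro exI[of _ 0]) auto
  next
    case False
    then have k: "k \<in> conts p []" using Suc.prems by auto
    obtain k1 m1 where s: "pstep w (k, m) = (k1, m1)" by (rule prod.exhaust)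
    have "fst (pstep w (k, m)) \<in> insert [] (conts p [])"
      using control_conts[OF k] by (cases m) (simp add: pstep_def case_prod_beta)
    then have k1: "k1 \<in> insert [] (conts p [])" using s by simp
    have "(pstep w ^^ \<tau>) (k1, m1) = ([], m')"
      using Suc.prems(1) s by (simp add: funpow_Suc_right del: funpow.simps)
    then obtain \<tau>' where "\<tau>' \<le> \<tau>" "(step M' w ^^ \<tau>') (gen_config k1 m1) (gen_config [] m')"
      using Suc.IH k1 pstep_valid[OF Suc.prems(3) safe_k[OF Suc.prems(2)] Suc.prems(4) s] Suc.prems(4)
      by blast
    then show ?thesis using gen_step[OF k Suc.prems(3,4) s]
      by (intro exI[of _ "Suc \<tau>'"]) (auto intro: relpowp_Suc_I2 simp del: relpowp.simps)
  qed
qed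


text \<open>\<open>Out\<close> agrees with the input tape of \<open>M\<close> on the cells up to
  \<open>length v + 1\<close>, which the head of \<open>M\<close> cannot leave; so every rule sees
  the same symbol in both machines, and writing it back leaves \<open>Out\<close> unchanged.\<close>

lemma sim_step:
  assumes "valid_memory \<Gamma> m" "\<And>i. input_symbol w i \<in> \<Gamma>"
    "input_pos c \<le> length v + 1" "\<And>i. i \<le> length v + 1 \<Longrightarrow> snd (snd m Out) i = input_symbol v i"
  shows "step M' w (sim_config m c) x \<longleftrightarrow> (\<exists>c'. step M v c c' \<and> x = sim_config m c')"
proof
  assume "step M' w (sim_config m c) x"
  then obtain r where r: "r \<in> rules M'" "from_state r = state (sim_config m c)"
    "work_read r = map (\<lambda>(p, t). t p) (work (sim_config m c))"
    and x: "x = \<lparr>state = to_state r, input_pos = shift (input_move r) (input_pos (sim_config m c)),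
              work = map2 act (work_action r) (work (sim_config m c))\<rparr>"
    unfolding step_def by blast
  from r(1) consider k a s where "r = gen_rule e M k a s" "k \<in> conts p []"
    | q a s where "r = sim_rule e q a s" "q \<in> rules M" unfolding composed_def by auto
  then show "\<exists>c'. step M v c c' \<and> x = sim_config m c'"
  proof cases
    case 1
    with r(2) show ?thesis by (simp add: gen_rule_def sim_config_def case_prod_beta)
  next
    case 2
    let ?c' = "\<lparr>state = to_state q, input_pos = shift (input_move q) (input_pos c),
      work = map2 act (work_action q) (work c)\<rparr>"
    have eqs: "from_state q = state c" "input_read q = input_symbol v (input_pos c)"
      "work_read q = map (\<lambda>(p, t). t p) (work c)"
      "\<And>j. j \<in> {Xs, Ys, Ctr} \<Longrightarrow> s j = scanned (snd m) j"
      using r(2,3) 2 assms(3,4) by (auto simp: sim_rule_def sim_config_def scanned_def case_prod_beta)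
    have "step M v c ?c'" unfolding step_def using 2 eqs by blast
    moreover have "(snd (snd m Out))(input_pos c := input_symbol v (input_pos c)) = snd (snd m Out)"
      using assms(3,4) by (simp add: fun_upd_idem)
    then have "x = sim_config m ?c'"
      using assms(3) assms(4)[of "input_pos c"] 2 eqs
      by (simp add: x sim_rule_def sim_config_def idle_def scanned_def act_eq)
    ultimately show ?thesis by blast
  qed
next
  assume "\<exists>c'. step M v c c' \<and> x = sim_config m c'"
  then obtain q where q: "q \<in> rules M" "from_state q = state c"
    "input_read q = input_symbol v (input_pos c)" "work_read q = map (\<lambda>(p, t). t p) (work c)"
    and x: "x = sim_config m \<lparr>state = to_state q, input_pos = shift (input_move q) (input_pos c),
      work = map2 act (work_action q) (work c)\<rparr>"
    unfolding step_def by blast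
  let ?r = "sim_rule e q (input_symbol w (fst m)) (scanned (snd m))"
  have "scanned (snd m) \<in> UNIV \<rightarrow> \<Gamma>"
    using assms(1) by (auto simp: valid_memory_def scanned_def)
  then have "?r \<in> rules M'" using q(1) assms(2) unfolding composed_def by simp blast
  moreover have "(snd (snd m Out))(input_pos c := input_symbol v (input_pos c)) = snd (snd m Out)"
    using assms(3,4) by (simp add: fun_upd_idem)
  ultimately show "step M' w (sim_config m c) x"
    unfolding step_def using assms(3) assms(4)[of "input_pos c"] q
    by (intro bexI[of _ ?r])
      (simp_all add: x sim_rule_def sim_config_def idle_def scanned_def case_prod_beta act_eq)
qed

lemma steps_input_pos:
  "(step M v ^^ \<tau>) c c' \<Longrightarrow> input_pos c \<le> length v + 1 \<Longrightarrow> input_pos c' \<le> length v + 1"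
  by (induction \<tau> arbitrary: c') (auto dest: input_pos_step[OF wf])

lemma sim_steps:
  assumes "valid_memory \<Gamma> m" "\<And>i. input_symbol w i \<in> \<Gamma>"
    "input_pos c \<le> length v + 1" "\<And>i. i \<le> length v + 1 \<Longrightarrow> snd (snd m Out) i = input_symbol v i"
  shows "(step M' w ^^ \<tau>) (sim_config m c) x \<longleftrightarrow> (\<exists>c'. (step M v ^^ \<tau>) c c' \<and> x = sim_config m c')"
proof (induction \<tau> arbitrary: x)
  case (Suc \<tau>)
  have "(step M' w ^^ Suc \<tau>) (sim_config m c) x \<longleftrightarrow>
    (\<exists>c1. (step M v ^^ \<tau>) c c1 \<and> step M' w (sim_config m c1) x)"
    using Suc.IH by auto
  also have "\<dots> \<longleftrightarrow> (\<exists>c1. (step M v ^^ \<tau>) c c1 \<and> (\<exists>c'. step M v c1 c' \<and> x = sim_config m c'))"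
    using sim_step[OF assms(1,2) steps_input_pos[OF _ assms(3)] assms(4)] by blast
  also have "\<dots> \<longleftrightarrow> (\<exists>c'. (step M v ^^ Suc \<tau>) c c' \<and> x = sim_config m c')" by auto
  finally show ?case .
qed auto

end

lemma deterministic_step:
  assumes "deterministic M" "step M w c a" "step M w c b"
  shows "a = b"
  using assms unfolding step_def deterministic_def by (metis (no_types, lifting))

text \<open>In a functional relation, a shorter run is a prefix of every longer run from the same
  point.\<close>

lemma functional_relpowp:
  assumes "\<And>x y z. R x y \<Longrightarrow> R x z \<Longrightarrow> y = z" "(R ^^ a) x y" "(R ^^ (a + b)) x z"
  shows "(R ^^ b) y z"
  using assms(2,3)
proof (induction a arbitrary: x)
  case (Suc a)
  obtain u u' where "R x u" "(R ^^ a) u y" "R x u'" "(R ^^ (a + b)) u' z"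
    using Suc.prems by (metis add_Suc relpowp_Suc_E2)
  then show ?case using assms(1) Suc.IH by blast
qed auto

text \<open>Determinism carries halting and acceptance back: the only computation of
  \<open>M'\<close> passes through the configuration of the hand-over, so every longer run splits
  there into the program and a run of \<open>M\<close> on \<open>v\<close>.\<close>

theorem compose_machine:
  assumes "wf_tm M" "deterministic M" "finite \<Gamma>" "safe \<Gamma> p" "Blank \<in> \<Gamma>"
  obtains M' where "wf_tm M'" "deterministic M'"
    "\<And>w v T U i t. \<lbrakk>\<And>i. input_symbol w i \<in> \<Gamma>; runs w p T (0, \<lambda>_. (0, \<lambda>_. Blank)) (i, t);
       fst (t Out) = 0; \<And>i. i \<le> length v + 1 \<Longrightarrow> snd (t Out) i = input_symbol v i; halts_within M v U\<rbrakk> \<Longrightarrow>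
       halts_within M' w (T + U) \<and> (accepts M' w \<longleftrightarrow> accepts M v)"
proof -
  obtain f :: "prog list \<Rightarrow> nat" and n where f: "f ` conts p [] = {i. i < n}" "inj_on f (conts p [])"
    using finite_imp_inj_to_nat_seg[OF finite_conts] by blast
  \<comment> \<open>Continuations occupy the numbers below \<open>n\<close>, and the states of
    \<open>M\<close> are shifted above them.\<close>
  define e :: "prog list + nat \<Rightarrow> nat" where "e = case_sum f (\<lambda>q. n + q)"
  have "f k < n" if "k \<in> conts p []" for k using f(1) that by blast
  then have "inj_on e (Inl ` conts p [] \<union> range Inr)"
    using f(2) by (fastforce simp: e_def inj_on_def)
  then interpret composition e \<Gamma> p M using assms by unfold_locales auto
  show thesis
  proof (rule that[OF wf' det'])
    fix w v T U i t
    assume sym: "\<And>i. input_symbol w i \<in> \<Gamma>" and run: "runs w p T (0, \<lambda>_. (0, \<lambda>_. Blank)) (i, t)"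
      and out: "fst (t Out) = 0" "\<And>i. i \<le> length v + 1 \<Longrightarrow> snd (t Out) i = input_symbol v i"
      and halt: "halts_within M v U"
    let ?R = "step M' w"
    let ?m = "(i, t)"
    define m0 where "m0 = (0 :: nat, \<lambda>_ :: tid. (0 :: nat, \<lambda>_ :: nat. Blank))"
    have valid0: "valid_memory \<Gamma> m0" using assms(5) by (simp add: valid_memory_def m0_def)
    obtain \<tau>0 where "\<tau>0 \<le> T" "(pstep w ^^ \<tau>0) ([p], m0) = ([], ?m)"
      using run unfolding runs_def m0_def by blast
    with gen_steps[OF this(2) _ valid0 sym] conts_self obtain \<tau> where
      \<tau>: "\<tau> \<le> T" "(?R ^^ \<tau>) (gen_config [p] m0) (gen_config [] ?m)"
      by (metis insertI2 le_trans)
    have validk: "valid_memory \<Gamma> m' \<and> k' \<in> insert [] (conts p [])"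
      if "(pstep w ^^ j) ([p], m0) = (k', m')" for j k' m'
      using that
    proof (induction j arbitrary: k' m')
      case 0
      then show ?case using valid0 conts_self by auto
    next
      case (Suc j)
      obtain k1 m1 where 1: "(pstep w ^^ j) ([p], m0) = (k1, m1)" by (rule prod.exhaust)
      with Suc have 2: "pstep w (k1, m1) = (k', m')" "valid_memory \<Gamma> m1" "k1 \<in> insert [] (conts p [])"
        by auto
      have "fst (pstep w (k1, m1)) \<in> insert [] (conts p [])"
        using 2(3) control_conts[of k1 p "[]"] by (cases m1) (auto simp: pstep_def case_prod_beta)
      then show ?case using pstep_valid[OF 2(2) safe_k[OF 2(3)] sym 2(1)] 2(1) by simp
    qed
    have valid: "valid_memory \<Gamma> ?m" using validk \<open>(pstep w ^^ \<tau>0) ([p], m0) = ([], ?m)\<close> by blast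
    have init: "gen_config [p] m0 = init M'"
      by (simp add: gen_config_def init_def code_conts_def composed_def m0_def numeral_eq_Suc)
    have mid: "gen_config [] ?m = sim_config ?m (init M)"
      using out(1) by (cases "t Out") (simp add: gen_config_def sim_config_def init_def code_conts_def)
    have run1: "(?R ^^ \<tau>) (init M') (sim_config ?m (init M))" using \<tau>(2) init mid by simp
    have sim: "(?R ^^ j) (sim_config ?m (init M)) x \<longleftrightarrow>
        (\<exists>c'. (step M v ^^ j) (init M) c' \<and> x = sim_config ?m c')" for j x
      using sim_steps[OF valid sym] out(2) by (simp add: init_def)
    have functional: "(?R ^^ b) y z" if "(?R ^^ a) x y" "(?R ^^ (a + b)) x z" for a b x y z
      using functional_relpowp[where R = ?R] deterministic_step[OF det'] that by blast
    have split: "\<exists>c'. (step M v ^^ j) (init M) c' \<and> x = sim_config ?m c'"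
      if "(?R ^^ (\<tau> + j)) (init M') x" for j x
      using functional[OF run1 that] sim[of j x] by simp
    have "halts_within M' w (T + U)"
      unfolding halts_within_def
    proof (intro allI impI)
      fix x j assume x: "(?R ^^ j) (init M') x"
      show "j \<le> T + U"
      proof (cases "j \<le> \<tau>")
        case False
        then obtain j' where j: "j = \<tau> + j'" by (metis le_add_diff_inverse nat_le_linear)
        with split x halt have "j' \<le> U" unfolding halts_within_def by blast
        then show ?thesis using j \<tau>(1) by simp
      qed (use \<tau>(1) in simp)
    qed
    moreover have "accepts M v" if "accepts M' w"
    proof -
      obtain x j where x: "(?R ^^ j) (init M') x" "state x = accept_state M'"
        using \<open>accepts M' w\<close> unfolding accepts_def by (metis rtranclp_imp_relpowp)
      have no: "\<not> ?R x y" for y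
        using wf' x(2) unfolding step_def wf_tm_def by auto
      \<comment> \<open>An accepting configuration has no successor, while before the hand-over the
        unique run still continues. So acceptance cannot occur earlier.\<close>
      have "\<tau> \<le> j"
      proof (rule ccontr)
        assume "\<not> \<tau> \<le> j"
        then have "(?R ^^ (j + Suc (\<tau> - j - 1))) (init M') (sim_config ?m (init M))" using run1 by simp
        from functional[OF x(1) this] show False using no by (metis relpowp_Suc_E2)
      qed
      then obtain j' where "j = \<tau> + j'" by (metis le_add_diff_inverse)
      with split x(1) obtain c where "(step M v ^^ j') (init M) c" "x = sim_config ?m c" by blast
      then show ?thesis using x(2) unfolding accepts_def
        by (auto simp: sim_config_def composed_def dest: relpowp_imp_rtranclp)
    qed
    moreover have "accepts M' w" if "accepts M v"
    proof -
      obtain c j where c: "(step M v ^^ j) (init M) c" "state c = accept_state M"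
        using \<open>accepts M v\<close> unfolding accepts_def by (metis rtranclp_imp_relpowp)
      then have "(?R ^^ j) (sim_config ?m (init M)) (sim_config ?m c)" using sim by blast
      then have "?R\<^sup>*\<^sup>* (init M') (sim_config ?m c)"
        using relpowp_imp_rtranclp[OF run1] by (metis relpowp_imp_rtranclp rtranclp_trans)
      then show ?thesis using c(2) unfolding accepts_def
        by (intro exI[of _ "sim_config ?m c"]) (simp add: sim_config_def composed_def)
    qed
    ultimately show "halts_within M' w (T + U) \<and> (accepts M' w \<longleftrightarrow> accepts M v)" by blast
  qed
qed

section \<open>Writing a factored graph on a tape\<close>


definition content :: "symbol list \<Rightarrow> nat \<Rightarrow> symbol" where
  "content xs i = (if i < length xs then xs ! i else Blank)"

text \<open>A zipper: the scanned cell is the first of \<open>rs\<close>, or the first blank cell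
  after \<open>ls\<close> if \<open>rs\<close> is empty. In this form the effect of a basic step is
  computed by rewriting.\<close>

definition tape_of :: "symbol list \<Rightarrow> symbol list \<Rightarrow> tape" where
  "tape_of ls rs = (length ls, content (ls @ rs))"

lemma content_update: "(content (ls @ y # rs))(length ls := x) = content (ls @ x # rs)"
proof
  show "((content (ls @ y # rs))(length ls := x)) i = content (ls @ x # rs) i" for i
    by (cases "i = length ls") (auto simp: content_def nth_append nth_Cons')
qed

lemma content_extend: "(content ls)(length ls := x) = content (ls @ [x])"
proof
  show "((content ls)(length ls := x)) i = content (ls @ [x]) i" for i
    by (cases "i = length ls") (auto simp: content_def nth_append)
qed

lemma content_blank: "(content ls)(length ls := Blank) = content ls"
  by (rule fun_upd_idem) (simp add: content_def)

lemma tape_of_read [simp]: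
  "snd (tape_of ls (x # rs)) (fst (tape_of ls (x # rs))) = x"
  "snd (tape_of ls []) (fst (tape_of ls [])) = Blank"
  by (simp_all add: tape_of_def content_def)

lemma act_tape_of [simp]:
  "act (x, Go_Right) (tape_of ls (y # rs)) = tape_of (ls @ [x]) rs"
  "act (x, Go_Right) (tape_of ls []) = tape_of (ls @ [x]) []"
  "act (x, Stay) (tape_of ls (y # rs)) = tape_of ls (x # rs)"
  "act (x, Stay) (tape_of ls []) = tape_of ls [x]"
  "act (x, Go_Left) (tape_of (ls @ [z]) (y # rs)) = tape_of ls (z # x # rs)"
  "act (Blank, Go_Left) (tape_of (ls @ [z]) []) = tape_of ls [z]"
  using content_update[of ls y rs x] content_extend[of ls x] content_update[of "ls @ [z]" y rs x]
    content_blank[of "ls @ [z]"]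
  by (simp_all add: tape_of_def)

section \<open>Elementary programs and their running times\<close>

definition Nop :: prog where
  "Nop = Basic (\<lambda>a s. (Stay, idle s))"

definition Write :: "tid \<Rightarrow> symbol \<Rightarrow> move \<Rightarrow> prog" where
  "Write j x d = Basic (\<lambda>a s. (Stay, (idle s)(j := (x, d))))"

definition Go :: "tid \<Rightarrow> move \<Rightarrow> prog" where
  "Go j d = Basic (\<lambda>a s. (Stay, (idle s)(j := (s j, d))))"

definition Copy :: "tid \<Rightarrow> prog" where
  "Copy j = Basic (\<lambda>a s. (Stay, (idle s)(j := (s j, Go_Right), Out := (s j, Go_Right))))"

definition Advance :: prog where
  "Advance = Basic (\<lambda>a s. (if a = Right_End then Stay else Go_Right, idle s))"

definition Retreat :: prog where
  "Retreat = Basic (\<lambda>a s. (if a = Left_End then Stay else Go_Left, idle s))"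

text \<open>Passes a closing \<open>2\<close> but rests on \<open>Right_End\<close>, so that
  skipping names saturates at the end of the list.\<close>

definition Hop :: "tid \<Rightarrow> prog" where
  "Hop j = Basic (\<lambda>a s. (Stay, (idle s)(j := (s j, if s j = Letter 2 then Go_Right else Stay))))"

lemma act_idle_at [simp]: "act (idle (scanned t) j) (t j) = t j"
  using fun_cong[OF act_idle[of t], of j] .

lemma runs_Basic_Stay:
  assumes "f (input_symbol w i) (scanned t) = (Stay, u)" "t' = (\<lambda>k. act (u k) (t k))"
  shows "runs w (Basic f) 1 (i, t) (i, t')"
  using runs_Basic[where f = f and w = w and i = i and t = t and d = Stay and u = u] assms by simp

lemma act_fun_upd:
  "(\<lambda>k. act (((idle (scanned t))(j := a)) k) (t k)) = t(j := act a (t j))"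
  by (auto simp: fun_eq_iff)

lemma runs_Nop: "runs w Nop 1 (i, t) (i, t)"
  using runs_Basic[of "\<lambda>a s. (Stay, idle s)" w i t] unfolding Nop_def by simp

lemma runs_Write: "runs w (Write j x d) 1 (i, t) (i, t(j := act (x, d) (t j)))"
  unfolding Write_def act_fun_upd[symmetric] by (rule runs_Basic_Stay[OF _ refl]) (rule refl)

lemma runs_Go: "runs w (Go j d) 1 (i, t) (i, t(j := act (scanned t j, d) (t j)))"
  unfolding Go_def act_fun_upd[symmetric] by (rule runs_Basic_Stay[OF _ refl]) (rule refl)

lemma runs_Hop:
  "runs w (Hop j) 1 (i, t)
     (i, t(j := act (scanned t j, if scanned t j = Letter 2 then Go_Right else Stay) (t j)))"
  unfolding Hop_def act_fun_upd[symmetric] by (rule runs_Basic_Stay[OF _ refl]) (rule refl)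

lemma runs_Copy:
  assumes "j \<noteq> Out"
  shows "runs w (Copy j) 1 (i, t)
     (i, t(j := act (scanned t j, Go_Right) (t j), Out := act (scanned t j, Go_Right) (t Out)))"
proof -
  have *: "t(j := act (scanned t j, Go_Right) (t j), Out := act (scanned t j, Go_Right) (t Out)) =
    (\<lambda>k. act (((idle (scanned t))(j := (scanned t j, Go_Right), Out := (scanned t j, Go_Right))) k) (t k))"
    using assms by (auto simp: fun_eq_iff)
  show ?thesis unfolding Copy_def * by (rule runs_Basic_Stay[OF _ refl]) (rule refl)
qed

lemma runs_Advance:
  assumes "i \<le> length w + 1"
  shows "runs w Advance 1 (i, t) (min (length w + 1) (i + 1), t)"
proof -
  define d where "d = (if input_symbol w i = Right_End then Stay else Go_Right)"
  have "shift d i = min (length w + 1) (i + 1)"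
    using assms by (auto simp: d_def input_symbol_def)
  moreover have "runs w Advance 1 (i, t) (shift d i, \<lambda>j. act (idle (scanned t) j) (t j))"
    unfolding Advance_def by (rule runs_Basic) (simp add: d_def)
  ultimately show ?thesis by simp
qed

lemma runs_Retreat: "runs w Retreat 1 (i, t) (i - 1, t)"
proof -
  define d where "d = (if input_symbol w i = Left_End then Stay else Go_Left)"
  have "shift d i = i - 1" by (auto simp: d_def input_symbol_def)
  moreover have "runs w Retreat 1 (i, t) (shift d i, \<lambda>j. act (idle (scanned t) j) (t j))"
    unfolding Retreat_def by (rule runs_Basic) (simp add: d_def)
  ultimately show ?thesis by simp
qed

definition rewind_input :: prog where
  "rewind_input = While (\<lambda>a s. a \<noteq> Left_End) Retreat"

lemma runs_rewind_input: "runs w rewind_input (2 * i + 1) (i, t) (0, t)"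
proof (induction i)
  case 0
  then show ?case
    unfolding rewind_input_def by (rule runs_mono[OF runs_While_end]) (auto simp: input_symbol_def)
next
  case (Suc i)
  have "runs w rewind_input (1 + (2 * i + 1) + 1) (Suc i, t) (0, t)"
    using runs_Retreat[of w "Suc i" t] Suc unfolding rewind_input_def
    by (intro runs_While_step) (auto simp: input_symbol_def)
  then show ?case by (rule runs_mono) simp
qed

fun iter :: "nat \<Rightarrow> prog \<Rightarrow> prog" where
  "iter 0 p = Nop"
| "iter (Suc k) p = Seq p (iter k p)"

lemma runs_iter:
  assumes "\<And>j. j < k \<Longrightarrow> runs w p T (f j) (f (Suc j))"
  shows "runs w (iter k p) (k * (T + 1) + 1) (f 0) (f k)"
  using assms
proof (induction k arbitrary: f)
  case 0
  then show ?case using runs_Nop by (cases "f 0") simp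
next
  case (Suc k)
  have 1: "runs w p T (f 0) (f (Suc 0))" by (rule Suc.prems) simp
  have 2: "runs w (iter k p) (k * (T + 1) + 1) (f (Suc 0)) (f (Suc k))"
    by (rule Suc.IH[of "\<lambda>j. f (Suc j)"]) (rule Suc.prems, simp)
  show ?case unfolding iter.simps by (rule runs_mono[OF runs_Seq[OF 1 2]]) simp
qed

fun emit :: "nat list \<Rightarrow> prog" where
  "emit [] = Nop"
| "emit (x # xs) = Seq (Write Out (Letter x) Go_Right) (emit xs)"

text \<open>The leading \<open>Left_End\<close> makes the tape usable as an input tape later and
  stops a head that returns to the left.\<close>

definition out_tape :: "nat list \<Rightarrow> tape" where
  "out_tape u = tape_of (Left_End # map Letter u) []"

lemma act_out_tape [simp]: "act (Letter x, Go_Right) (out_tape u) = out_tape (u @ [x])"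
  by (simp add: out_tape_def)

lemma runs_emit:
  "t Out = out_tape u \<Longrightarrow> runs w (emit v) (2 * length v + 1) (i, t) (i, t(Out := out_tape (u @ v)))"
proof (induction v arbitrary: u t)
  case Nil
  then have "t(Out := out_tape (u @ [])) = t" by auto
  then have "runs w (emit []) 1 (i, t) (i, t(Out := out_tape (u @ [])))"
    using runs_Nop[of w i t] by (metis emit.simps(1))
  then show ?case by (rule runs_mono) simp
next
  case (Cons x v)
  let ?t = "t(Out := out_tape (u @ [x]))"
  have 1: "runs w (Write Out (Letter x) Go_Right) 1 (i, t) (i, ?t)"
    using runs_Write[of w Out "Letter x" Go_Right i t] Cons.prems by simp
  have "runs w (emit v) (2 * length v + 1) (i, ?t) (i, ?t(Out := out_tape ((u @ [x]) @ v)))"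
    by (rule Cons.IH) simp
  then have 2: "runs w (emit v) (2 * length v + 1) (i, ?t) (i, t(Out := out_tape (u @ x # v)))"
    by simp
  show ?case unfolding emit.simps by (rule runs_mono[OF runs_Seq[OF 1 2]]) simp
qed

text \<open>
  The tapes \<open>Xs\<close> and \<open>Ys\<close> list the binary names of all vertices \<open>0, \<dots>, N - 1\<close>, each
  closed by \<open>2\<close>. Their heads serve as pointers to vertices.
\<close>

definition name :: "nat \<Rightarrow> nat list" where
  "name v = binary v @ [2]"

definition names :: "nat \<Rightarrow> nat \<Rightarrow> tape" where
  "names N y = tape_of (Left_End # map Letter (concat (map name [0..<y])))
     (map Letter (concat (map name [y..<N])) @ [Right_End])"

lemma binary_bound: "set (binary m) \<subseteq> {0, 1}"
  by (induction m rule: binary.induct) (subst binary.simps, auto)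

text \<open>The true length is logarithmic. The linear bound already makes all programs below
  quadratic, and any fixed exponent will do.\<close>

lemma length_binary: "length (binary m) \<le> m + 1"
proof (induction m rule: binary.induct)
  case (1 m)
  show ?case
  proof (cases "m < 2")
    case False
    then show ?thesis using 1 by (subst binary.simps) auto
  qed (subst binary.simps, auto)
qed

lemma length_name: "v < N \<Longrightarrow> length (name v) \<le> N + 1"
  using length_binary[of v] by (simp add: name_def)

lemma names_split:
  "y < N \<Longrightarrow> names N y = tape_of (Left_End # map Letter (concat (map name [0..<y])))
     (map Letter (binary y) @ Letter 2 # map Letter (concat (map name [Suc y..<N])) @ [Right_End])"
  by (simp add: names_def upt_conv_Cons name_def)

lemma names_Suc:
  "y < N \<Longrightarrow> names N (Suc y) = tape_of ((Left_End # map Letter (concat (map name [0..<y]))) @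
       map Letter (binary y) @ [Letter 2])
     (map Letter (concat (map name [Suc y..<N])) @ [Right_End])"
  by (simp add: names_def name_def)

lemma names_at_end:
  assumes "y \<le> N" "t j = names N y"
  shows "scanned t j = Right_End \<longleftrightarrow> y = N"
proof (cases "y < N")
  case True
  have "binary y \<noteq> []" by (subst binary.simps) auto
  then obtain b bs where "binary y = b # bs" by (cases "binary y") auto
  then show ?thesis using True assms(2) by (simp add: names_split scanned_def)
next
  case False
  then show ?thesis using assms by (simp add: names_def scanned_def)
qed

section \<open>Moving pointers over the lists of names\<close>

definition copy_name :: "tid \<Rightarrow> prog" where
  "copy_name j = Seq (While (\<lambda>a s. s j \<noteq> Letter 2) (Copy j)) (Copy j)"

definition skip_name :: "tid \<Rightarrow> prog" where
  "skip_name j = Seq (While (\<lambda>a s. s j \<noteq> Letter 2 \<and> s j \<noteq> Right_End) (Go j Go_Right))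
     (Hop j)"

lemma runs_copy_letters:
  assumes "t j = tape_of ls (map Letter bs @ Letter 2 # rs)" "t Out = out_tape u" "j \<noteq> Out" "2 \<notin> set bs"
  shows "runs w (While (\<lambda>a s. s j \<noteq> Letter 2) (Copy j)) (2 * length bs + 1) (i, t)
    (i, t(j := tape_of (ls @ map Letter bs) (Letter 2 # rs), Out := out_tape (u @ bs)))"
  using assms
proof (induction bs arbitrary: t ls u)
  case Nil
  then have "t(j := tape_of (ls @ map Letter []) (Letter 2 # rs), Out := out_tape (u @ [])) = t" by auto
  moreover have "runs w (While (\<lambda>a s. s j \<noteq> Letter 2) (Copy j)) 1 (i, t) (i, t)"
    using Nil by (intro runs_While_end) (auto simp: scanned_def)
  ultimately have "runs w (While (\<lambda>a s. s j \<noteq> Letter 2) (Copy j)) 1 (i, t)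
     (i, t(j := tape_of (ls @ map Letter []) (Letter 2 # rs), Out := out_tape (u @ [])))" by metis
  then show ?case by (rule runs_mono) simp
next
  case (Cons b bs)
  let ?t = "t(j := tape_of (ls @ [Letter b]) (map Letter bs @ Letter 2 # rs), Out := out_tape (u @ [b]))"
  have "runs w (Copy j) 1 (i, t) (i, ?t)"
    using runs_Copy[of j w i t] Cons.prems by (simp add: scanned_def)
  moreover have "runs w (While (\<lambda>a s. s j \<noteq> Letter 2) (Copy j)) (2 * length bs + 1) (i, ?t)
      (i, ?t(j := tape_of ((ls @ [Letter b]) @ map Letter bs) (Letter 2 # rs), Out := out_tape ((u @ [b]) @ bs)))"
    using Cons.prems by (intro Cons.IH) auto
  moreover have "?t(j := tape_of ((ls @ [Letter b]) @ map Letter bs) (Letter 2 # rs), Out := out_tape ((u @ [b]) @ bs))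
      = t(j := tape_of (ls @ map Letter (b # bs)) (Letter 2 # rs), Out := out_tape (u @ b # bs))"
    using Cons.prems by (auto simp: fun_eq_iff)
  moreover have "scanned t j \<noteq> Letter 2" using Cons.prems by (auto simp: scanned_def)
  ultimately have "runs w (While (\<lambda>a s. s j \<noteq> Letter 2) (Copy j)) (1 + (2 * length bs + 1) + 1) (i, t)
     (i, t(j := tape_of (ls @ map Letter (b # bs)) (Letter 2 # rs), Out := out_tape (u @ b # bs)))"
    by (intro runs_While_step[where m' = "(i, ?t)"]) auto
  then show ?case by (rule runs_mono) simp
qed

lemma two_notin_binary: "2 \<notin> set (binary m)"
  using binary_bound[of m] by auto

lemma runs_copy_name:
  assumes "t j = names N y" "t Out = out_tape u" "j \<noteq> Out" "y < N"
  shows "runs w (copy_name j) (2 * N + 4) (i, t) (i, t(j := names N (Suc y), Out := out_tape (u @ name y)))"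
proof -
  let ?ls = "Left_End # map Letter (concat (map name [0..<y]))"
  let ?rs = "map Letter (concat (map name [Suc y..<N])) @ [Right_End]"
  let ?t = "t(j := tape_of (?ls @ map Letter (binary y)) (Letter 2 # ?rs), Out := out_tape (u @ binary y))"
  have "runs w (While (\<lambda>a s. s j \<noteq> Letter 2) (Copy j)) (2 * length (binary y) + 1) (i, t) (i, ?t)"
    using assms two_notin_binary by (intro runs_copy_letters) (simp_all add: names_split)
  moreover have "runs w (Copy j) 1 (i, ?t) (i, t(j := names N (Suc y), Out := out_tape (u @ name y)))"
  proof -
    have "?t(j := act (scanned ?t j, Go_Right) (?t j), Out := act (scanned ?t j, Go_Right) (?t Out)) =
        t(j := names N (Suc y), Out := out_tape (u @ name y))"
      using assms by (auto simp: fun_eq_iff scanned_def names_Suc name_def)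
    then show ?thesis using runs_Copy[of j w i ?t] assms(3) by simp
  qed
  ultimately have "runs w (copy_name j) (2 * length (binary y) + 1 + 1 + 1) (i, t)
      (i, t(j := names N (Suc y), Out := out_tape (u @ name y)))"
    unfolding copy_name_def by (rule runs_Seq)
  then show ?thesis by (rule runs_mono) (use length_binary[of y] assms in simp)
qed

lemma runs_skip_letters:
  assumes "t j = tape_of ls (map Letter bs @ Letter 2 # rs)" "2 \<notin> set bs"
  shows "runs w (While (\<lambda>a s. s j \<noteq> Letter 2 \<and> s j \<noteq> Right_End) (Go j Go_Right)) (2 * length bs + 1) (i, t)
    (i, t(j := tape_of (ls @ map Letter bs) (Letter 2 # rs)))"
  using assms
proof (induction bs arbitrary: t ls)
  case Nil
  then have "t(j := tape_of (ls @ map Letter []) (Letter 2 # rs)) = t" by auto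
  moreover have "runs w (While (\<lambda>a s. s j \<noteq> Letter 2 \<and> s j \<noteq> Right_End) (Go j Go_Right)) 1 (i, t) (i, t)"
    using Nil by (intro runs_While_end) (auto simp: scanned_def)
  ultimately have "runs w (While (\<lambda>a s. s j \<noteq> Letter 2 \<and> s j \<noteq> Right_End) (Go j Go_Right)) 1 (i, t)
     (i, t(j := tape_of (ls @ map Letter []) (Letter 2 # rs)))" by metis
  then show ?case by (rule runs_mono) simp
next
  case (Cons b bs)
  let ?t = "t(j := tape_of (ls @ [Letter b]) (map Letter bs @ Letter 2 # rs))"
  have "runs w (Go j Go_Right) 1 (i, t) (i, ?t)"
    using runs_Go[of w j Go_Right i t] Cons.prems by (simp add: scanned_def)
  moreover have "runs w (While (\<lambda>a s. s j \<noteq> Letter 2 \<and> s j \<noteq> Right_End) (Go j Go_Right)) (2 * length bs + 1) (i, ?t)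
      (i, ?t(j := tape_of ((ls @ [Letter b]) @ map Letter bs) (Letter 2 # rs)))"
    using Cons.prems by (intro Cons.IH) auto
  moreover have "scanned t j \<noteq> Letter 2" "scanned t j \<noteq> Right_End"
    using Cons.prems by (auto simp: scanned_def)
  ultimately have "runs w (While (\<lambda>a s. s j \<noteq> Letter 2 \<and> s j \<noteq> Right_End) (Go j Go_Right))
      (1 + (2 * length bs + 1) + 1) (i, t) (i, t(j := tape_of (ls @ map Letter (b # bs)) (Letter 2 # rs)))"
    by (intro runs_While_step[where m' = "(i, ?t)"]) auto
  then show ?case by (rule runs_mono) simp
qed

lemma runs_skip_name:
  assumes "t j = names N y" "y \<le> N"
  shows "runs w (skip_name j) (2 * N + 4) (i, t) (i, t(j := names N (min N (Suc y))))"
proof (cases "y < N")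
  case True
  let ?ls = "Left_End # map Letter (concat (map name [0..<y]))"
  let ?rs = "map Letter (concat (map name [Suc y..<N])) @ [Right_End]"
  let ?t = "t(j := tape_of (?ls @ map Letter (binary y)) (Letter 2 # ?rs))"
  have 1: "runs w (While (\<lambda>a s. s j \<noteq> Letter 2 \<and> s j \<noteq> Right_End) (Go j Go_Right))
      (2 * length (binary y) + 1) (i, t) (i, ?t)"
    using assms True two_notin_binary by (intro runs_skip_letters) (simp_all add: names_split)
  have "?t(j := act (scanned ?t j, if scanned ?t j = Letter 2 then Go_Right else Stay) (?t j)) =
      t(j := names N (min N (Suc y)))"
    using True min_absorb2[of "Suc y" N] by (simp add: scanned_def names_Suc)
  then have 2: "runs w (Hop j) 1 (i, ?t) (i, t(j := names N (min N (Suc y))))"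
    using runs_Hop[of w j i ?t] by simp
  show ?thesis unfolding skip_name_def
    by (rule runs_mono[OF runs_Seq[OF 1 2]]) (use length_binary[of y] True in simp)
next
  case False
  then have y: "y = N" using assms by simp
  have re: "scanned t j = Right_End" using names_at_end[of y N t j] assms y by simp
  have 1: "runs w (While (\<lambda>a s. s j \<noteq> Letter 2 \<and> s j \<noteq> Right_End) (Go j Go_Right)) 1 (i, t) (i, t)"
    using re by (intro runs_While_end) simp
  have "t(j := act (scanned t j, if scanned t j = Letter 2 then Go_Right else Stay) (t j)) = t"
    using re by (simp add: act_eq scanned_def fun_upd_idem)
  then have 2: "runs w (Hop j) 1 (i, t) (i, t)" using runs_Hop[of w j i t] by simp
  have "t(j := names N (min N (Suc y))) = t" using assms y by (simp add: min_def fun_upd_idem)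
  then show ?thesis unfolding skip_name_def
    using runs_mono[OF runs_Seq[OF 1 2], of "2 * N + 4"] by simp
qed

definition rewind_names :: "tid \<Rightarrow> prog" where
  "rewind_names j = Seq (While (\<lambda>a s. s j \<noteq> Left_End) (Go j Go_Left)) (Go j Go_Right)"

lemma runs_go_left:
  assumes "t j = tape_of (Left_End # ls) rs" "Left_End \<notin> set ls" "Left_End \<notin> set rs"
  shows "runs w (While (\<lambda>a s. s j \<noteq> Left_End) (Go j Go_Left)) (2 * length ls + 3) (i, t)
     (i, t(j := tape_of [] (Left_End # ls @ rs)))"
  using assms
proof (induction ls arbitrary: t rs rule: rev_induct)
  case Nil
  have r: "scanned t j \<noteq> Left_End" using Nil by (cases rs) (auto simp: scanned_def)
  have "act (scanned t j, Go_Left) (t j) = tape_of [] (Left_End # rs)"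
    using Nil act_tape_of(5,6)[where ls = "[]"] by (cases rs) (auto simp: scanned_def)
  then have "runs w (Go j Go_Left) 1 (i, t) (i, t(j := tape_of [] (Left_End # rs)))"
    using runs_Go[of w j Go_Left i t] by simp
  moreover have "runs w (While (\<lambda>a s. s j \<noteq> Left_End) (Go j Go_Left)) 1
     (i, t(j := tape_of [] (Left_End # rs))) (i, t(j := tape_of [] (Left_End # rs)))"
    by (intro runs_While_end) (simp add: scanned_def)
  ultimately have "runs w (While (\<lambda>a s. s j \<noteq> Left_End) (Go j Go_Left)) (1 + 1 + 1) (i, t)
      (i, t(j := tape_of [] (Left_End # [] @ rs)))"
    using r by (intro runs_While_step[where m' = "(i, t(j := tape_of [] (Left_End # rs)))"]) simp_all
  then show ?case by (rule runs_mono) simp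
next
  case (snoc x ls)
  let ?t = "t(j := tape_of (Left_End # ls) (x # rs))"
  have r: "scanned t j \<noteq> Left_End" using snoc.prems by (cases rs) (auto simp: scanned_def)
  have "act (scanned t j, Go_Left) (t j) = tape_of (Left_End # ls) (x # rs)"
    using snoc.prems act_tape_of(5,6)[where ls = "Left_End # ls"] by (cases rs) (auto simp: scanned_def)
  then have 1: "runs w (Go j Go_Left) 1 (i, t) (i, ?t)"
    using runs_Go[of w j Go_Left i t] by simp
  have "runs w (While (\<lambda>a s. s j \<noteq> Left_End) (Go j Go_Left)) (2 * length ls + 3) (i, ?t)
     (i, ?t(j := tape_of [] (Left_End # ls @ x # rs)))"
    using snoc.prems by (intro snoc.IH) auto
  then have 2: "runs w (While (\<lambda>a s. s j \<noteq> Left_End) (Go j Go_Left)) (2 * length ls + 3) (i, ?t)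
     (i, t(j := tape_of [] (Left_End # (ls @ [x]) @ rs)))" by simp
  show ?case
    by (rule runs_mono[OF runs_While_step[OF _ 1 2]]) (use r in auto)
qed

lemma length_names: "length (concat (map name [0..<y])) \<le> y * (y + 1)"
proof (induction y)
  case (Suc y)
  then show ?case using length_name[of y "Suc y"] by simp
qed simp

lemma runs_rewind_names:
  assumes "t j = names N y" "y \<le> N"
  shows "runs w (rewind_names j) (2 * N * (N + 1) + 6) (i, t) (i, t(j := names N 0))"
proof -
  let ?D = "map Letter (concat (map name [0..<N])) @ [Right_End]"
  have "[0..<y] @ [y..<N] = [0..<N]" using assms(2) by (metis le_add_diff_inverse upt_add_eq_append zero_le)
  then have D: "map Letter (concat (map name [0..<y])) @ map Letter (concat (map name [y..<N])) @ [Right_End] = ?D"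
    by (metis append.assoc concat_append map_append)
  let ?t = "t(j := tape_of [] (Left_End # ?D))"
  have 1: "runs w (While (\<lambda>a s. s j \<noteq> Left_End) (Go j Go_Left))
      (2 * length (map Letter (concat (map name [0..<y]))) + 3) (i, t) (i, ?t)"
    unfolding D[symmetric] by (intro runs_go_left) (auto simp: assms(1) names_def)
  have "runs w (Go j Go_Right) 1 (i, ?t) (i, ?t(j := act (scanned ?t j, Go_Right) (?t j)))" by (rule runs_Go)
  then have 2: "runs w (Go j Go_Right) 1 (i, ?t) (i, t(j := names N 0))"
    by (simp add: scanned_def names_def)
  have "length (concat (map name [0..<y])) \<le> y * (y + 1)" by (rule length_names)
  also have "\<dots> \<le> N * (N + 1)" using assms(2) by (intro mult_le_mono) auto
  finally show ?thesis unfolding rewind_names_def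
    by (intro runs_mono[OF runs_Seq[OF 1 2]]) simp
qed


definition pointers :: "nat \<Rightarrow> tape \<Rightarrow> nat list \<Rightarrow> nat \<Rightarrow> nat \<Rightarrow> tid \<Rightarrow> tape" where
  "pointers N c out x y = (\<lambda>j. case j of Out \<Rightarrow> out_tape out | Xs \<Rightarrow> names N x | Ys \<Rightarrow> names N y | Ctr \<Rightarrow> c)"

lemma pointers_simps [simp]:
  "pointers N c out x y Out = out_tape out" "pointers N c out x y Xs = names N x"
  "pointers N c out x y Ys = names N y" "pointers N c out x y Ctr = c"
  "(pointers N c out x y)(Out := out_tape out') = pointers N c out' x y"
  "(pointers N c out x y)(Xs := names N x') = pointers N c out x' y"
  "(pointers N c out x y)(Ys := names N y') = pointers N c out x y'"
  by (auto simp: pointers_def fun_eq_iff split: tid.split)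

lemma runs_mem:
  shows "x < N \<Longrightarrow> runs w (copy_name Xs) (2 * N + 4) (i, pointers N c out x y) (i, pointers N c (out @ name x) (Suc x) y)"
    and "y < N \<Longrightarrow> runs w (copy_name Ys) (2 * N + 4) (i, pointers N c out x y) (i, pointers N c (out @ name y) x (Suc y))"
    and "x \<le> N \<Longrightarrow> runs w (skip_name Xs) (2 * N + 4) (i, pointers N c out x y) (i, pointers N c out (min N (Suc x)) y)"
    and "y \<le> N \<Longrightarrow> runs w (skip_name Ys) (2 * N + 4) (i, pointers N c out x y) (i, pointers N c out x (min N (Suc y)))"
    and "x \<le> N \<Longrightarrow> runs w (rewind_names Xs) (2 * N * (N + 1) + 6) (i, pointers N c out x y) (i, pointers N c out 0 y)"
    and "y \<le> N \<Longrightarrow> runs w (rewind_names Ys) (2 * N * (N + 1) + 6) (i, pointers N c out x y) (i, pointers N c out x 0)"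
    and "runs w (emit v) (2 * length v + 1) (i, pointers N c out x y) (i, pointers N c (out @ v) x y)"
  using runs_copy_name[of "pointers N c out x y" Xs N x out w i] runs_copy_name[of "pointers N c out x y" Ys N y out w i]
    runs_skip_name[of "pointers N c out x y" Xs N x w i] runs_skip_name[of "pointers N c out x y" Ys N y w i]
    runs_rewind_names[of "pointers N c out x y" Xs N x w i] runs_rewind_names[of "pointers N c out x y" Ys N y w i]
    runs_emit[of "pointers N c out x y" out w v i]
  by simp_all

lemma at_end_mem:
  "x \<le> N \<Longrightarrow> scanned (pointers N c out x y) Xs = Right_End \<longleftrightarrow> x = N"
  "y \<le> N \<Longrightarrow> scanned (pointers N c out x y) Ys = Right_End \<longleftrightarrow> y = N"
  using names_at_end[of x N "pointers N c out x y" Xs] names_at_end[of y N "pointers N c out x y" Ys] by simp_all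

section \<open>Programs that append a word to the output\<close>

text \<open>The number \<open>N\<close> of vertices. It has to exceed the last head position
  \<open>length w + 1\<close>; the constant \<open>K\<close> also makes room for the states of
  \<open>M\<close>, the base and the number of blocks, and for the stacks on short inputs.\<close>

definition size_of :: "nat \<Rightarrow> nat list \<Rightarrow> nat" where
  "size_of K w = length w + 1 + K"

text \<open>Pointers and input head may start and end anywhere, so that such programs can be
  sequenced freely; a program that relies on a position rewinds first. The factor
  \<open>\<kappa>\<close> is independent of the word.\<close>

definition emits_within :: "nat \<Rightarrow> prog \<Rightarrow> (nat list \<Rightarrow> nat list) \<Rightarrow> nat \<Rightarrow> bool" where
  "emits_within K p f \<kappa> \<longleftrightarrow> (\<forall>w out x y i c. x \<le> size_of K w \<and> y \<le> size_of K w \<and> i \<le> length w + 1 \<longrightarrow>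
     (\<exists>x' y' i'. x' \<le> size_of K w \<and> y' \<le> size_of K w \<and> i' \<le> length w + 1 \<and>
       runs w p (\<kappa> * (size_of K w + 3) ^ 2)
         (i, pointers (size_of K w) c out x y) (i', pointers (size_of K w) c (out @ f w) x' y')))"

definition emits :: "nat \<Rightarrow> prog \<Rightarrow> (nat list \<Rightarrow> nat list) \<Rightarrow> bool" where
  "emits K p f \<longleftrightarrow> (\<exists>\<kappa>. emits_within K p f \<kappa>)"

lemma emitsI:
  assumes "\<And>w out x y i c. \<lbrakk>x \<le> size_of K w; y \<le> size_of K w; i \<le> length w + 1\<rbrakk> \<Longrightarrow>
     (\<exists>x' y' i'. x' \<le> size_of K w \<and> y' \<le> size_of K w \<and> i' \<le> length w + 1 \<and>
       runs w p (\<kappa> * (size_of K w + 3) ^ 2)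
         (i, pointers (size_of K w) c out x y) (i', pointers (size_of K w) c (out @ f w) x' y'))"
  shows "emits K p f"
  unfolding emits_def emits_within_def using assms by blast

lemma emits_Seq:
  assumes "emits K p f" "emits K q g"
  shows "emits K (Seq p q) (\<lambda>w. f w @ g w)"
proof -
  obtain \<kappa> \<mu> where \<kappa>: "emits_within K p f \<kappa>" and \<mu>: "emits_within K q g \<mu>"
    using assms unfolding emits_def by blast
  show ?thesis
  proof (rule emitsI[where \<kappa> = "\<kappa> + \<mu> + 1"])
    fix w out x y i c
    let ?N = "size_of K w"
    assume "x \<le> ?N" "y \<le> ?N" "i \<le> length w + 1"
    then obtain x' y' i' where 1: "x' \<le> ?N" "y' \<le> ?N" "i' \<le> length w + 1"
      "runs w p (\<kappa> * (?N + 3) ^ 2) (i, pointers ?N c out x y) (i', pointers ?N c (out @ f w) x' y')"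
      using \<kappa> unfolding emits_within_def by blast
    obtain x'' y'' i'' where 2: "x'' \<le> ?N" "y'' \<le> ?N" "i'' \<le> length w + 1"
      "runs w q (\<mu> * (?N + 3) ^ 2) (i', pointers ?N c (out @ f w) x' y') (i'', pointers ?N c ((out @ f w) @ g w) x'' y'')"
      using \<mu> 1(1-3) unfolding emits_within_def by blast
    have "runs w (Seq p q) ((\<kappa> + \<mu> + 1) * (?N + 3) ^ 2) (i, pointers ?N c out x y) (i'', pointers ?N c (out @ f w @ g w) x'' y'')"
      by (rule runs_mono[OF runs_Seq[OF 1(4)]], use 2(4) in simp) (simp add: algebra_simps)
    with 2 show "\<exists>x' y' i'. x' \<le> ?N \<and> y' \<le> ?N \<and> i' \<le> length w + 1 \<and>
       runs w (Seq p q) ((\<kappa> + \<mu> + 1) * (?N + 3) ^ 2) (i, pointers ?N c out x y) (i', pointers ?N c (out @ f w @ g w) x' y')"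
      by blast
  qed
qed

lemma emits_emit: "emits K (emit v) (\<lambda>_. v)"
proof (rule emitsI[where \<kappa> = "2 * length v + 1"], intro exI conjI)
  fix w out x y i c
  let ?N = "size_of K w"
  show "runs w (emit v) ((2 * length v + 1) * (?N + 3) ^ 2) (i, pointers ?N c out x y) (i, pointers ?N c (out @ v) x y)"
    using mult_le_mono2[of 1 "(?N + 3) ^ 2" "2 * length v + 1"] by (intro runs_mono[OF runs_mem(7)]) simp
qed

definition emit_vertices :: prog where
  "emit_vertices = Seq (rewind_names Xs) (Seq (While (\<lambda>_ s. s Xs \<noteq> Right_End) (copy_name Xs)) (emit [3]))"

lemma runs_copy_names:
  assumes "x \<le> N"
  shows "runs w (While (\<lambda>_ s. s Xs \<noteq> Right_End) (copy_name Xs)) ((N - x) * (2 * N + 5) + 1)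
    (i, pointers N c out x y) (i, pointers N c (out @ concat (map name [x..<N])) N y)"
  using assms
proof (induction "N - x" arbitrary: x out)
  case 0
  then show ?case using at_end_mem(1)[of x N c out y] by (auto intro!: runs_mono[OF runs_While_end])
next
  case (Suc d)
  then have x: "x < N" by simp
  have 1: "runs w (copy_name Xs) (2 * N + 4) (i, pointers N c out x y) (i, pointers N c (out @ name x) (Suc x) y)"
    using runs_mem(1) x by blast
  have 2: "runs w (While (\<lambda>_ s. s Xs \<noteq> Right_End) (copy_name Xs)) ((N - Suc x) * (2 * N + 5) + 1)
    (i, pointers N c (out @ name x) (Suc x) y)
    (i, pointers N c ((out @ name x) @ concat (map name [Suc x..<N])) N y)"
    using Suc.hyps(2) x by (intro Suc.hyps(1)) auto
  have 3: "runs w (While (\<lambda>_ s. s Xs \<noteq> Right_End) (copy_name Xs))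
     (2 * N + 4 + ((N - Suc x) * (2 * N + 5) + 1) + 1) (i, pointers N c out x y)
    (i, pointers N c ((out @ name x) @ concat (map name [Suc x..<N])) N y)"
    by (rule runs_While_step[OF _ 1 2]) (use at_end_mem(1)[of x N c out y] x in simp)
  have "N - x = Suc (N - Suc x)" using x by simp
  then have "2 * N + 4 + ((N - Suc x) * (2 * N + 5) + 1) + 1 = (N - x) * (2 * N + 5) + 1" by simp
  moreover have "(out @ name x) @ concat (map name [Suc x..<N]) = out @ concat (map name [x..<N])"
    using x by (simp add: upt_conv_Cons)
  ultimately show ?case using 3 by metis
qed

text \<open>With \<open>N + 3\<close> in place of \<open>N\<close>, the square dominates linear and
  constant terms as well, and every loop is bounded by a multiple of it.\<close>

lemma square_bounds:
  fixes N :: nat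
  defines "Q \<equiv> (N + 3) ^ 2"
  shows "N * (N + 1) \<le> Q" "N * (2 * N + 5) \<le> 2 * Q" "2 * N + 6 \<le> Q" "9 \<le> Q"
  unfolding Q_def by (auto simp: power2_eq_square algebra_simps)

lemma emits_vertices: "emits K emit_vertices (\<lambda>w. encode_list [0..<size_of K w])"
proof (rule emitsI[where \<kappa> = 8], intro exI conjI)
  fix w out x y i c
  let ?N = "size_of K w"
  assume x: "x \<le> ?N" and y: "y \<le> ?N" and i: "i \<le> length w + 1"
  have "runs w emit_vertices (2 * ?N * (?N + 1) + 6 + ((?N - 0) * (2 * ?N + 5) + 1 + (2 * length [3 :: nat] + 1) + 1) + 1)
    (i, pointers ?N c out x y) (i, pointers ?N c ((out @ concat (map name [0..<?N])) @ [3]) ?N y)"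
    unfolding emit_vertices_def using x
    by (intro runs_Seq[OF runs_mem(5) runs_Seq[OF runs_copy_names runs_mem(7)]]) auto
  then have "runs w emit_vertices (8 * (?N + 3) ^ 2)
    (i, pointers ?N c out x y) (i, pointers ?N c ((out @ concat (map name [0..<?N])) @ [3]) ?N y)"
    by (rule runs_mono) (use square_bounds[of ?N] in simp)
  then show "runs w emit_vertices (8 * (?N + 3) ^ 2)
    (i, pointers ?N c out x y) (i, pointers ?N c (out @ encode_list [0..<?N]) ?N y)"
    by (simp add: encode_list_def name_def[abs_def])
qed auto

section \<open>Edge lists of affine maps\<close>

text \<open>\<open>sw\<close> yields the inverse map. \<open>A\<close> restricts the symbol at input
  position \<open>x + h\<close>; the offset \<open>h\<close> serves edges that are listed by their
  target. The start \<open>x0\<close> is a parameter for the sake of induction along the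
  loop.\<close>

definition lin_edges :: "nat \<Rightarrow> nat list \<Rightarrow> nat \<Rightarrow> nat \<Rightarrow> bool \<Rightarrow> nat \<Rightarrow> symbol set \<Rightarrow> nat \<Rightarrow> (nat \<times> nat) list" where
  "lin_edges N w b a sw h A x0 = [if sw then (b * x + a, x) else (x, b * x + a).
     x \<leftarrow> [x0..<N], b * x + a < N \<and> input_symbol w (x + h) \<in> A]"

definition edge_names :: "(nat \<times> nat) list \<Rightarrow> nat list" where
  "edge_names es = concat (map (\<lambda>(u, v). name u @ name v) es)"

lemma encode_edges:
  "encode_list (concat (map (\<lambda>(u, v). [u, v]) es)) = edge_names es @ [3]"
  unfolding encode_list_def edge_names_def by (induction es) (auto simp: name_def)

lemma lin_less: "b * x + a < N \<Longrightarrow> 1 \<le> b \<Longrightarrow> x < (N :: nat)"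
  by (cases b) auto

text \<open>\<open>b * x + a\<close> does not decrease as \<open>x\<close> grows, so the loop may
  stop once the second pointer is at the end of its list.\<close>

lemma lin_edges_end: "N \<le> b * x0 + a \<Longrightarrow> lin_edges N w b a sw h A x0 = []"
proof -
  assume *: "N \<le> b * x0 + a"
  have "N \<le> b * x + a" if "x0 \<le> x" for x
    using mult_le_mono2[OF that, of b] * by linarith
  then have "\<not> b * x + a < N" if "x \<in> set [x0..<N]" for x using that by (simp add: not_less)
  then show ?thesis unfolding lin_edges_def by (simp add: concat_eq_Nil_conv)
qed

lemma lin_edges_Cons:
  assumes "b * x0 + a < N" "1 \<le> b"
  shows "lin_edges N w b a sw h A x0 =
    (if input_symbol w (x0 + h) \<in> A then [if sw then (b * x0 + a, x0) else (x0, b * x0 + a)] else []) @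
    lin_edges N w b a sw h A (Suc x0)"
proof -
  have "x0 < N" using lin_less[OF assms] .
  then show ?thesis using assms(1) by (simp add: lin_edges_def upt_conv_Cons)
qed

text \<open>Copying a name and skipping it both advance a pointer by one. Hence after either branch
  \<open>b - 1\<close> further skips bring \<open>Ys\<close> from \<open>b * x + a\<close> to
  \<open>b * (x + 1) + a\<close>.\<close>

definition lin_step :: "nat \<Rightarrow> bool \<Rightarrow> symbol set \<Rightarrow> prog" where
  "lin_step b sw A =
     Seq (Cond (\<lambda>x s. x \<in> A)
           (if sw then Seq (copy_name Ys) (copy_name Xs) else Seq (copy_name Xs) (copy_name Ys))
           (Seq (skip_name Xs) (skip_name Ys)))
       (Seq (iter (b - 1) (skip_name Ys)) Advance)"

definition emit_edges :: "nat \<Rightarrow> nat \<Rightarrow> bool \<Rightarrow> nat \<Rightarrow> symbol set \<Rightarrow> prog" where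
  "emit_edges b a sw h A =
     Seq rewind_input (Seq (iter h Advance) (Seq (rewind_names Xs) (Seq (rewind_names Ys)
       (Seq (iter a (skip_name Ys)) (Seq (While (\<lambda>_ s. s Ys \<noteq> Right_End) (lin_step b sw A)) (emit [3]))))))"

text \<open>Every position past the word shows \<open>Right_End\<close>, so a head that has stopped
  there still reads the symbol of its nominal position \<open>x + h\<close>.\<close>

lemma input_symbol_min: "input_symbol w (min (Suc (length w)) i) = input_symbol w i"
  by (auto simp: input_symbol_def)

lemma runs_iter_skip:
  assumes "y \<le> N"
  shows "runs w (iter k (skip_name Ys)) (k * (2 * N + 5) + 1) (i, pointers N c out x y) (i, pointers N c out x (min N (y + k)))"
proof -
  have "runs w (iter k (skip_name Ys)) (k * (2 * N + 4 + 1) + 1)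
     (i, pointers N c out x (min N (y + 0))) (i, pointers N c out x (min N (y + k)))"
  proof (rule runs_iter[where f = "\<lambda>j. (i, pointers N c out x (min N (y + j)))"])
    fix j
    have "min N (Suc (min N (y + j))) = min N (y + Suc j)" by simp
    then show "runs w (skip_name Ys) (2 * N + 4) (i, pointers N c out x (min N (y + j)))
        (i, pointers N c out x (min N (y + Suc j)))"
      using runs_mem(4)[of "min N (y + j)" N w i c out x] by simp
  qed
  moreover have "min N (y + 0) = y" using assms by simp
  ultimately show ?thesis by (simp add: algebra_simps)
qed

lemma runs_iter_advance:
  assumes "i \<le> length w + 1"
  shows "runs w (iter k Advance) (2 * k + 1) (i, t) (min (length w + 1) (i + k), t)"
proof -
  have "runs w (iter k Advance) (k * (1 + 1) + 1)
     (min (length w + 1) (i + 0), t) (min (length w + 1) (i + k), t)"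
  proof (rule runs_iter[where f = "\<lambda>j. (min (length w + 1) (i + j), t)"])
    fix j
    have "min (length w + 1) (min (length w + 1) (i + j) + 1) = min (length w + 1) (i + Suc j)" by simp
    then show "runs w Advance 1 (min (length w + 1) (i + j), t) (min (length w + 1) (i + Suc j), t)"
      using runs_Advance[of "min (length w + 1) (i + j)" w t] by simp
  qed
  moreover have "min (length w + 1) (i + 0) = i" using assms by simp
  ultimately show ?thesis by (simp add: mult_2)
qed

lemma runs_lin_step:
  assumes "b * x + a < N" "1 \<le> b"
    and es_def: "es = (if input_symbol w (x + h) \<in> A then [if sw then (b * x + a, x) else (x, b * x + a)] else [])"
  shows "runs w (lin_step b sw A) ((b + 3) * (2 * N + 6))
    (min (length w + 1) (x + h), pointers N c out x (b * x + a))
    (min (length w + 1) (Suc x + h), pointers N c (out @ edge_names es) (Suc x) (min N (b * Suc x + a)))"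
proof -
  let ?i = "min (length w + 1) (x + h)"
  let ?y = "b * x + a"
  have x: "x < N" using lin_less[OF assms(1,2)] .
  let ?if = "if sw then Seq (copy_name Ys) (copy_name Xs) else Seq (copy_name Xs) (copy_name Ys)"
  let ?p = "if input_symbol w ?i \<in> A then ?if else Seq (skip_name Xs) (skip_name Ys)"
  have "runs w ?p (2 * N + 4 + (2 * N + 4) + 1) (?i, pointers N c out x ?y)
    (?i, pointers N c (out @ edge_names es) (Suc x) (Suc ?y))"
  proof (cases "input_symbol w (x + h) \<in> A")
    case True
    show ?thesis
    proof (cases sw)
      case sw: True
      have "runs w (Seq (copy_name Ys) (copy_name Xs)) (2 * N + 4 + (2 * N + 4) + 1) (?i, pointers N c out x ?y)
        (?i, pointers N c ((out @ name ?y) @ name x) (Suc x) (Suc ?y))"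
        using runs_Seq[OF runs_mem(2)[OF assms(1)] runs_mem(1)[OF x]] by blast
      then show ?thesis using True sw by (simp add: input_symbol_min es_def edge_names_def)
    next
      case sw: False
      have "runs w (Seq (copy_name Xs) (copy_name Ys)) (2 * N + 4 + (2 * N + 4) + 1) (?i, pointers N c out x ?y)
        (?i, pointers N c ((out @ name x) @ name ?y) (Suc x) (Suc ?y))"
        using runs_Seq[OF runs_mem(1)[OF x] runs_mem(2)[OF assms(1)]] by blast
      then show ?thesis using True sw by (simp add: input_symbol_min es_def edge_names_def)
    qed
  next
    case False
    have "runs w (Seq (skip_name Xs) (skip_name Ys)) (2 * N + 4 + (2 * N + 4) + 1) (?i, pointers N c out x ?y)
      (?i, pointers N c out (min N (Suc x)) (min N (Suc ?y)))"
      using runs_Seq[OF runs_mem(3) runs_mem(4)] x assms(1) less_imp_le by blast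
    moreover have "min N (Suc x) = Suc x" "min N (Suc ?y) = Suc ?y" using x assms(1) by auto
    ultimately show ?thesis using False by (simp add: input_symbol_min es_def edge_names_def)
  qed
  then have 1: "runs w (Cond (\<lambda>x s. x \<in> A) ?if (Seq (skip_name Xs) (skip_name Ys))) (2 * N + 4 + (2 * N + 4) + 1 + 1)
     (?i, pointers N c out x ?y) (?i, pointers N c (out @ edge_names es) (Suc x) (Suc ?y))"
    by (intro runs_Cond) simp
  have e: "Suc ?y + (b - 1) = b * Suc x + a" using assms(2) by simp
  then have 2: "runs w (iter (b - 1) (skip_name Ys)) ((b - 1) * (2 * N + 5) + 1)
      (?i, pointers N c (out @ edge_names es) (Suc x) (Suc ?y))
      (?i, pointers N c (out @ edge_names es) (Suc x) (min N (b * Suc x + a)))"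
    using runs_iter_skip[OF Suc_leI[OF assms(1)], of w "b - 1"] unfolding e by blast
  have "min (length w + 1) (?i + 1) = min (length w + 1) (Suc x + h)" by simp
  then have 3: "runs w Advance 1 (?i, pointers N c (out @ edge_names es) (Suc x) (min N (b * Suc x + a)))
     (min (length w + 1) (Suc x + h), pointers N c (out @ edge_names es) (Suc x) (min N (b * Suc x + a)))"
    using runs_Advance[of ?i w] by simp
  have "(b - 1) * (2 * N + 5) \<le> b * (2 * N + 6)" by (intro mult_le_mono) auto
  then show ?thesis unfolding lin_step_def
    by (intro runs_mono[OF runs_Seq[OF 1 runs_Seq[OF 2 3]]]) (simp add: algebra_simps)
qed

lemma runs_lin_loop:
  assumes "1 \<le> b"
  shows "\<exists>x' i'. x' \<le> max x N \<and> i' \<le> length w + 1 \<and>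
   runs w (While (\<lambda>_ s. s Ys \<noteq> Right_End) (lin_step b sw A)) ((N - x) * ((b + 3) * (2 * N + 6) + 1) + 1)
    (min (length w + 1) (x + h), pointers N c out x (min N (b * x + a)))
    (i', pointers N c (out @ edge_names (lin_edges N w b a sw h A x)) x' N)"
proof (induction "N - x" arbitrary: x out rule: less_induct)
  case less
  let ?W = "While (\<lambda>_ s. s Ys \<noteq> Right_End) (lin_step b sw A)"
  show ?case
  proof (cases "b * x + a < N")
    case True
    have x: "x < N" using lin_less[OF True assms] .
    let ?es = "if input_symbol w (x + h) \<in> A then [if sw then (b * x + a, x) else (x, b * x + a)] else []"
    note 1 = runs_lin_step[OF True assms refl, where w = w and h = h and A = A and sw = sw and c = c and out = out]
    have "N - Suc x < N - x" using x by simp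
    from less[OF this, of "out @ edge_names ?es"] obtain x' i' where
      2: "x' \<le> max (Suc x) N" "i' \<le> length w + 1"
        "runs w ?W ((N - Suc x) * ((b + 3) * (2 * N + 6) + 1) + 1)
         (min (length w + 1) (Suc x + h), pointers N c (out @ edge_names ?es) (Suc x) (min N (b * Suc x + a)))
         (i', pointers N c ((out @ edge_names ?es) @ edge_names (lin_edges N w b a sw h A (Suc x))) x' N)"
      by blast
    have 3: "runs w ?W ((b + 3) * (2 * N + 6) + ((N - Suc x) * ((b + 3) * (2 * N + 6) + 1) + 1) + 1)
       (min (length w + 1) (x + h), pointers N c out x (b * x + a))
       (i', pointers N c ((out @ edge_names ?es) @ edge_names (lin_edges N w b a sw h A (Suc x))) x' N)"
      by (rule runs_While_step[OF _ 1 2(3)]) (use at_end_mem(2)[of "b * x + a" N c out x] True in simp)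
    have "N - x = Suc (N - Suc x)" using x by simp
    then have "(b + 3) * (2 * N + 6) + ((N - Suc x) * ((b + 3) * (2 * N + 6) + 1) + 1) + 1 =
        (N - x) * ((b + 3) * (2 * N + 6) + 1) + 1" by simp
    moreover have "(out @ edge_names ?es) @ edge_names (lin_edges N w b a sw h A (Suc x)) =
        out @ edge_names (lin_edges N w b a sw h A x)"
      unfolding lin_edges_Cons[OF True assms] by (simp add: edge_names_def)
    moreover have "min N (b * x + a) = b * x + a" "x' \<le> max x N" using True 2(1) x by auto
    ultimately show ?thesis using 3 2(2) by metis
  next
    case False
    then have "min N (b * x + a) = N" by simp
    moreover have "runs w ?W ((N - x) * ((b + 3) * (2 * N + 6) + 1) + 1)
      (min (length w + 1) (x + h), pointers N c out x N) (min (length w + 1) (x + h), pointers N c out x N)"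
      by (rule runs_mono[OF runs_While_end]) (use at_end_mem(2)[of N N c out x] in auto)
    ultimately show ?thesis using lin_edges_end[of N b x a w sw h A] False
      by (intro exI[of _ x] exI[of _ "min (length w + 1) (x + h)"]) (simp add: edge_names_def)
  qed
qed

text \<open>There are at most \<open>N\<close> rounds. Each handles a number of names that depends
  on \<open>b\<close> only, and each name has length \<open>O(N)\<close>.\<close>

lemma emits_edges:
  assumes "1 \<le> b"
  shows "emits K (emit_edges b a sw h A)
    (\<lambda>w. encode_list (concat (map (\<lambda>(u, v). [u, v]) (lin_edges (size_of K w) w b a sw h A 0))))"
proof (rule emitsI[where \<kappa> = "2 * b + 2 * h + 2 * a + 40"])
  fix w out x y i c
  let ?N = "size_of K w"
  let ?Q = "(?N + 3) ^ 2"
  let ?es = "lin_edges ?N w b a sw h A 0"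
  let ?W = "While (\<lambda>_ s. s Ys \<noteq> Right_End) (lin_step b sw A)"
  assume x: "x \<le> ?N" and y: "y \<le> ?N" and i: "i \<le> length w + 1"
  let ?h = "min (length w + 1) (0 + h)"
  obtain x' i' where loop: "x' \<le> max 0 ?N" "i' \<le> length w + 1"
    "runs w ?W ((?N - 0) * ((b + 3) * (2 * ?N + 6) + 1) + 1)
     (?h, pointers ?N c out 0 (min ?N (b * 0 + a))) (i', pointers ?N c (out @ edge_names ?es) x' ?N)"
    using runs_lin_loop[OF assms, where x = 0] by blast
  have 6: "runs w (Seq ?W (emit [3])) ((?N - 0) * ((b + 3) * (2 * ?N + 6) + 1) + 1 + (2 * length [3 :: nat] + 1) + 1)
     (?h, pointers ?N c out 0 (min ?N (0 + a))) (i', pointers ?N c ((out @ edge_names ?es) @ [3]) x' ?N)"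
    using runs_Seq[OF loop(3) runs_mem(7)[where v = "[3]"]] by (simp del: emit.simps)
  have 5: "runs w (iter a (skip_name Ys)) (a * (2 * ?N + 5) + 1) (?h, pointers ?N c out 0 0)
      (?h, pointers ?N c out 0 (min ?N (0 + a)))"
    by (rule runs_iter_skip) simp
  have 2: "runs w (iter h Advance) (2 * h + 1) (0, pointers ?N c out x y) (?h, pointers ?N c out x y)"
    by (rule runs_iter_advance) simp
  note runs = runs_Seq[OF runs_rewind_input[of w i] runs_Seq[OF 2 runs_Seq[OF runs_mem(5)[OF x]
     runs_Seq[OF runs_mem(6)[OF y] runs_Seq[OF 5 6]]]]]
  have i: "i \<le> ?N + 3" using i by (simp add: size_of_def)
  have "?N * ((b + 3) * (2 * ?N + 6) + 1) \<le> 2 * (b + 4) * ?Q"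
  proof -
    have "?N * ((b + 3) * (2 * ?N + 6) + 1) \<le> (?N + 3) * (2 * (b + 4) * (?N + 3))"
      by (intro mult_le_mono) (auto simp: algebra_simps)
    then show ?thesis by (simp add: power2_eq_square algebra_simps)
  qed
  moreover have "a * (2 * ?N + 5) \<le> 2 * a * ?Q"
  proof -
    have "a * (2 * ?N + 5) \<le> a * (2 * ?Q)" using square_bounds(3)[of ?N] by (intro mult_le_mono) auto
    then show ?thesis by simp
  qed
  moreover have "2 * h + 1 \<le> (2 * h + 1) * ?Q" using mult_le_mono2[of 1 ?Q "2 * h + 1"] by simp
  ultimately have bound: "2 * i + 1 + (2 * h + 1 + (2 * ?N * (?N + 1) + 6 + (2 * ?N * (?N + 1) + 6 +
      (a * (2 * ?N + 5) + 1 + ((?N - 0) * ((b + 3) * (2 * ?N + 6) + 1) + 1 + (2 * length [3 :: nat] + 1) + 1) + 1) + 1) + 1) + 1) + 1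
      \<le> (2 * b + 2 * h + 2 * a + 40) * ?Q"
    using square_bounds[of ?N] i by (simp add: algebra_simps)
  have "runs w (emit_edges b a sw h A) ((2 * b + 2 * h + 2 * a + 40) * ?Q)
    (i, pointers ?N c out x y) (i', pointers ?N c ((out @ edge_names ?es) @ [3]) x' ?N)"
    unfolding emit_edges_def by (rule runs_mono[OF runs bound])
  then show "\<exists>x' y' i'. x' \<le> ?N \<and> y' \<le> ?N \<and> i' \<le> length w + 1 \<and>
    runs w (emit_edges b a sw h A) ((2 * b + 2 * h + 2 * a + 40) * ?Q) (i, pointers ?N c out x y)
     (i', pointers ?N c (out @ encode_list (concat (map (\<lambda>(u, v). [u, v]) ?es))) x' y')"
    using loop(1,2) by (intro exI[of _ x'] exI[of _ ?N] exI[of _ i']) (simp add: encode_edges)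
qed


section \<open>A binary counter and the lists of names\<close>

text \<open>Increment with carry for numerals that start with the least significant digit; the
  counter tape holds its value in this order.\<close>

fun incr :: "nat list \<Rightarrow> nat list" where
  "incr [] = [1]"
| "incr (b # bs) = (if b = 1 then 0 # incr bs else 1 # bs)"

lemma rev_binary_Suc: "rev (binary (Suc m)) = incr (rev (binary m))"
proof (induction m rule: binary.induct)
  case (1 m)
  show ?case
  proof (cases "m < 2")
    case True
    then have "m = 0 \<or> m = 1" by auto
    then show ?thesis
      using binary.simps[of 0] binary.simps[of 1] binary.simps[of 2] by (auto simp: numeral_2_eq_2)
  next
    case False
    show ?thesis
    proof (cases "m mod 2 = 0")
      case True
      then have "Suc m div 2 = m div 2" "Suc m mod 2 = 1" by presburger+
      then show ?thesis using False True binary.simps[of m] binary.simps[of "Suc m"] by simp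
    next
      case odd: False
      then have "Suc m div 2 = Suc (m div 2)" "Suc m mod 2 = 0" "m mod 2 = 1" by presburger+
      then show ?thesis using False 1 binary.simps[of m] binary.simps[of "Suc m"] by simp
    qed
  qed
qed

definition counting :: "nat list \<Rightarrow> tape \<Rightarrow> tid \<Rightarrow> tape" where
  "counting u c = (\<lambda>j. case j of Out \<Rightarrow> out_tape [] | Xs \<Rightarrow> out_tape u | Ys \<Rightarrow> out_tape u | Ctr \<Rightarrow> c)"

lemma counting_simps [simp]:
  "counting u c Out = out_tape []" "counting u c Xs = out_tape u" "counting u c Ys = out_tape u" "counting u c Ctr = c"
  "(counting u c)(Ctr := c') = counting u c'"
  "scanned (counting u c) Ctr = snd c (fst c)"
  by (auto simp: counting_def fun_eq_iff scanned_def split: tid.split)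

definition Feed :: "symbol option \<Rightarrow> move \<Rightarrow> prog" where
  "Feed x d = Basic (\<lambda>a s. let y = (case x of None \<Rightarrow> s Ctr | Some y \<Rightarrow> y) in
     (Stay, (idle s)(Xs := (y, Go_Right), Ys := (y, Go_Right), Ctr := (s Ctr, d))))"

lemma runs_Feed:
  assumes "(case x of None \<Rightarrow> snd c (fst c) | Some y \<Rightarrow> y) = Letter b"
  shows "runs w (Feed x d) 1 (i, counting u c) (i, counting (u @ [b]) (act (snd c (fst c), d) c))"
  unfolding Feed_def
proof (rule runs_Basic_Stay)
  let ?u = "(idle (scanned (counting u c)))(Xs := (Letter b, Go_Right), Ys := (Letter b, Go_Right),
    Ctr := (snd c (fst c), d))"
  show "(let y = case x of None \<Rightarrow> scanned (counting u c) Ctr | Some y \<Rightarrow> y in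
     (Stay, (idle (scanned (counting u c)))(Xs := (y, Go_Right), Ys := (y, Go_Right),
        Ctr := (scanned (counting u c) Ctr, d)))) = (Stay, ?u)"
    using assms by (cases x) (simp_all add: Let_def)
  have "act (?u j) (counting u c j) = counting (u @ [b]) (act (snd c (fst c), d) c) j" for j
    using act_idle_at[of "counting u c" Out] by (cases j) (simp_all del: act_idle_at)
  then show "counting (u @ [b]) (act (snd c (fst c), d) c) = (\<lambda>j. act (?u j) (counting u c j))" by auto
qed

text \<open>The invariant of a scan to the left: the head is on the last digit, or on
  \<open>Left_End\<close> if none is left.\<close>

definition on_last :: "nat list \<Rightarrow> symbol list \<Rightarrow> tape" where
  "on_last l rs = tape_of (butlast (Left_End # map Letter l)) (last (Left_End # map Letter l) # rs)"

lemma on_last_simps: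
  "on_last [] rs = tape_of [] (Left_End # rs)"
  "on_last (l @ [b]) rs = tape_of (Left_End # map Letter l) (Letter b # rs)"
  by (simp_all add: on_last_def butlast_append)

lemma act_left_on_last:
  "act (x, Go_Left) (tape_of (Left_End # map Letter l) (y # rs)) = on_last l (x # rs)"
  "act (Blank, Go_Left) (tape_of (Left_End # map Letter l) []) = on_last l []"
  unfolding on_last_def
  using act_tape_of(5)[of x "butlast (Left_End # map Letter l)" "last (Left_End # map Letter l)" y rs]
    act_tape_of(6)[of "butlast (Left_End # map Letter l)" "last (Left_End # map Letter l)"]
  by (simp_all only: append_butlast_last_id list.distinct not_False_eq_True)

lemma runs_feed_left:
  "runs w (While (\<lambda>_ s. s Ctr \<noteq> Left_End) (Feed None Go_Left)) (2 * length l + 1)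
     (i, counting u (on_last l rs)) (i, counting (u @ rev l) (tape_of [] (Left_End # map Letter l @ rs)))"
proof (induction l arbitrary: u rs rule: rev_induct)
  case Nil
  have "runs w (While (\<lambda>_ s. s Ctr \<noteq> Left_End) (Feed None Go_Left)) 1
     (i, counting u (on_last [] rs)) (i, counting u (on_last [] rs))"
    by (rule runs_While_end) (simp add: on_last_simps)
  then show ?case by (simp add: on_last_simps)
next
  case (snoc b l)
  have 1: "runs w (Feed None Go_Left) 1 (i, counting u (on_last (l @ [b]) rs)) (i, counting (u @ [b]) (on_last l (Letter b # rs)))"
    using runs_Feed[where x = None and c = "on_last (l @ [b]) rs" and b = b and d = Go_Left and w = w and i = i and u = u]
    by (simp add: on_last_simps act_left_on_last)
  have 2: "runs w (While (\<lambda>_ s. s Ctr \<noteq> Left_End) (Feed None Go_Left)) (2 * length l + 1)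
     (i, counting (u @ [b]) (on_last l (Letter b # rs)))
     (i, counting (u @ rev (l @ [b])) (tape_of [] (Left_End # map Letter (l @ [b]) @ rs)))"
    using snoc[of "u @ [b]" "Letter b # rs"] by simp
  show ?case
    by (rule runs_mono[OF runs_While_step[OF _ 1 2]]) (auto simp: on_last_simps)
qed

text \<open>The loop turns the initial ones into the zeros \<open>z\<close>. As \<open>r\<close> is
  empty or starts with a digit other than \<open>1\<close>, what remains of the increment is a
  single write of \<open>1\<close>.\<close>

lemma runs_carry:
  "\<exists>z r. runs w (While (\<lambda>_ s. s Ctr = Letter 1) (Write Ctr (Letter 0) Go_Right)) (2 * length l + 1)
     (i, counting u (tape_of ls (map Letter l))) (i, counting u (tape_of (ls @ map Letter z) (map Letter r))) \<and>
     incr l = z @ incr r \<and> (r = [] \<or> hd r \<noteq> 1)"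
proof (induction l arbitrary: ls)
  case Nil
  have "runs w (While (\<lambda>_ s. s Ctr = Letter 1) (Write Ctr (Letter 0) Go_Right)) 1
     (i, counting u (tape_of ls [])) (i, counting u (tape_of ls []))"
    by (rule runs_While_end) simp
  then show ?case by (intro exI[of _ "[]"]) simp
next
  case (Cons b l)
  show ?case
  proof (cases "b = 1")
    case True
    obtain z r where 2: "runs w (While (\<lambda>_ s. s Ctr = Letter 1) (Write Ctr (Letter 0) Go_Right)) (2 * length l + 1)
      (i, counting u (tape_of (ls @ [Letter 0]) (map Letter l)))
      (i, counting u (tape_of ((ls @ [Letter 0]) @ map Letter z) (map Letter r)))"
      "incr l = z @ incr r" "r = [] \<or> hd r \<noteq> 1"
      using Cons by blast
    have 1: "runs w (Write Ctr (Letter 0) Go_Right) 1 (i, counting u (tape_of ls (map Letter (b # l))))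
       (i, counting u (tape_of (ls @ [Letter 0]) (map Letter l)))"
      using runs_Write[of w Ctr "Letter 0" Go_Right i "counting u (tape_of ls (map Letter (b # l)))"] by simp
    have "runs w (While (\<lambda>_ s. s Ctr = Letter 1) (Write Ctr (Letter 0) Go_Right)) (1 + (2 * length l + 1) + 1)
      (i, counting u (tape_of ls (map Letter (b # l)))) (i, counting u (tape_of ((ls @ [Letter 0]) @ map Letter z) (map Letter r)))"
      by (rule runs_While_step[OF _ 1 2(1)]) (simp add: True)
    then show ?thesis using 2 True by (intro exI[of _ "0 # z"] exI[of _ r]) simp
  next
    case False
    have "runs w (While (\<lambda>_ s. s Ctr = Letter 1) (Write Ctr (Letter 0) Go_Right)) (2 * length (b # l) + 1)
       (i, counting u (tape_of ls (map Letter (b # l)))) (i, counting u (tape_of ls (map Letter (b # l))))"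
      by (rule runs_mono[OF runs_While_end]) (use False in auto)
    then show ?thesis using False by (intro exI[of _ "[]"] exI[of _ "b # l"]) auto
  qed
qed

lemma runs_go_right:
  "runs w (While (\<lambda>_ s. s Ctr \<noteq> Blank) (Go Ctr Go_Right)) (2 * length l + 1)
     (i, counting u (tape_of ls (map Letter l))) (i, counting u (tape_of (ls @ map Letter l) []))"
proof (induction l arbitrary: ls)
  case Nil
  have "runs w (While (\<lambda>_ s. s Ctr \<noteq> Blank) (Go Ctr Go_Right)) 1
     (i, counting u (tape_of ls [])) (i, counting u (tape_of ls []))"
    by (rule runs_While_end) simp
  then show ?case by simp
next
  case (Cons b l)
  have 1: "runs w (Go Ctr Go_Right) 1 (i, counting u (tape_of ls (map Letter (b # l))))
       (i, counting u (tape_of (ls @ [Letter b]) (map Letter l)))"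
    using runs_Go[of w Ctr Go_Right i "counting u (tape_of ls (map Letter (b # l)))"] by simp
  have 2: "runs w (While (\<lambda>_ s. s Ctr \<noteq> Blank) (Go Ctr Go_Right)) (2 * length l + 1)
    (i, counting u (tape_of (ls @ [Letter b]) (map Letter l))) (i, counting u (tape_of (ls @ map Letter (b # l)) []))"
    using Cons[of "ls @ [Letter b]"] by simp
  show ?case by (rule runs_mono[OF runs_While_step[OF _ 1 2]]) auto
qed

lemma length_incr: "length (incr l) \<le> length l + 1"
  by (induction l rule: incr.induct) auto

text \<open>The counter starts with its least significant digit, so scanning it to the left yields
  the digits in the order of a name. The way back to the right performs the increment.\<close>

definition next_name :: prog where
  "next_name = Seq (Go Ctr Go_Left) (Seq (While (\<lambda>_ s. s Ctr \<noteq> Left_End) (Feed None Go_Left))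
     (Seq (Feed (Some (Letter 2)) Go_Right)
     (Seq (While (\<lambda>_ s. s Ctr = Letter 1) (Write Ctr (Letter 0) Go_Right))
     (Seq (Write Ctr (Letter 1) Go_Right) (While (\<lambda>_ s. s Ctr \<noteq> Blank) (Go Ctr Go_Right))))))"

lemma runs_next_name:
  "runs w next_name (6 * m + 22) (i, counting u (out_tape (rev (binary m))))
     (i, counting (u @ name m) (out_tape (rev (binary (Suc m)))))"
proof -
  let ?l = "rev (binary m)"
  have 1: "runs w (Go Ctr Go_Left) 1 (i, counting u (out_tape ?l)) (i, counting u (on_last ?l []))"
    using runs_Go[of w Ctr Go_Left i "counting u (out_tape ?l)"]
    by (simp add: out_tape_def act_left_on_last)
  have 2: "runs w (While (\<lambda>_ s. s Ctr \<noteq> Left_End) (Feed None Go_Left)) (2 * length ?l + 1)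
     (i, counting u (on_last ?l [])) (i, counting (u @ binary m) (tape_of [] (Left_End # map Letter ?l)))"
    using runs_feed_left[of w ?l i u "[]"] by simp
  have 3: "runs w (Feed (Some (Letter 2)) Go_Right) 1 (i, counting (u @ binary m) (tape_of [] (Left_End # map Letter ?l)))
     (i, counting (u @ name m) (tape_of [Left_End] (map Letter ?l)))"
    using runs_Feed[where x = "Some (Letter 2)" and c = "tape_of [] (Left_End # map Letter ?l)" and b = 2 and d = Go_Right
        and w = w and i = i and u = "u @ binary m"]
    by (simp add: name_def)
  obtain z r where 4: "runs w (While (\<lambda>_ s. s Ctr = Letter 1) (Write Ctr (Letter 0) Go_Right)) (2 * length ?l + 1)
     (i, counting (u @ name m) (tape_of [Left_End] (map Letter ?l)))
     (i, counting (u @ name m) (tape_of ([Left_End] @ map Letter z) (map Letter r)))"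
    and inc: "incr ?l = z @ incr r" "r = [] \<or> hd r \<noteq> 1"
    using runs_carry by blast
  let ?t = "counting (u @ name m) (tape_of ([Left_End] @ map Letter z) (map Letter r))"
  have r: "incr r = 1 # tl r" using inc(2) by (cases r) auto
  have 5: "runs w (Write Ctr (Letter 1) Go_Right) 1 (i, ?t)
     (i, counting (u @ name m) (tape_of ([Left_End] @ map Letter (z @ [1])) (map Letter (tl r))))"
    using runs_Write[of w Ctr "Letter 1" Go_Right i ?t] by (cases r) auto
  have 6: "runs w (While (\<lambda>_ s. s Ctr \<noteq> Blank) (Go Ctr Go_Right)) (2 * length (tl r) + 1)
     (i, counting (u @ name m) (tape_of ([Left_End] @ map Letter (z @ [1])) (map Letter (tl r))))
     (i, counting (u @ name m) (tape_of (([Left_End] @ map Letter (z @ [1])) @ map Letter (tl r)) []))"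
    by (rule runs_go_right)
  have "([Left_End] @ map Letter (z @ [1])) @ map Letter (tl r) = Left_End # map Letter (rev (binary (Suc m)))"
    using inc(1) r by (simp add: rev_binary_Suc)
  then have 6: "runs w (While (\<lambda>_ s. s Ctr \<noteq> Blank) (Go Ctr Go_Right)) (2 * length (tl r) + 1)
     (i, counting (u @ name m) (tape_of ([Left_End] @ map Letter (z @ [1])) (map Letter (tl r))))
     (i, counting (u @ name m) (out_tape (rev (binary (Suc m)))))"
    using 6 by (simp add: out_tape_def)
  have "length (tl r) \<le> length ?l"
    using length_incr[of ?l] inc(1) r by simp
  moreover have "length ?l \<le> m + 1" using length_binary[of m] by simp
  ultimately show ?thesis unfolding next_name_def
    by (intro runs_mono[OF runs_Seq[OF 1 runs_Seq[OF 2 runs_Seq[OF 3 runs_Seq[OF 4 runs_Seq[OF 5 6]]]]]]) simp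
qed

lemma runs_next_names:
  assumes "m + k \<le> N"
  shows "runs w (iter k next_name) (k * (6 * N + 23) + 1)
    (i, counting (concat (map name [0..<m])) (out_tape (rev (binary m))))
    (i, counting (concat (map name [0..<m + k])) (out_tape (rev (binary (m + k)))))"
proof -
  have "runs w (iter k next_name) (k * (6 * N + 22 + 1) + 1)
    (i, counting (concat (map name [0..<m + 0])) (out_tape (rev (binary (m + 0)))))
    (i, counting (concat (map name [0..<m + k])) (out_tape (rev (binary (m + k)))))"
  proof (rule runs_iter[where f = "\<lambda>j. (i, counting (concat (map name [0..<m + j])) (out_tape (rev (binary (m + j)))))"])
    fix j assume "j < k"
    then show "runs w next_name (6 * N + 22) (i, counting (concat (map name [0..<m + j])) (out_tape (rev (binary (m + j)))))
      (i, counting (concat (map name [0..<m + Suc j])) (out_tape (rev (binary (m + Suc j)))))"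
      using runs_mono[OF runs_next_name[of w "m + j" i "concat (map name [0..<m + j])"]] assms by simp
  qed
  then show ?thesis by (simp add: algebra_simps)
qed

text \<open>The input serves as a unary counter: one name for each cell before
  \<open>Right_End\<close>, the left end marker included.\<close>

lemma runs_input_names:
  assumes "i \<le> length w + 1" "length w + 1 \<le> N"
  shows "runs w (While (\<lambda>a s. a \<noteq> Right_End) (Seq next_name Advance)) ((length w + 1 - i) * (6 * N + 25) + 1)
    (i, counting (concat (map name [0..<i])) (out_tape (rev (binary i))))
    (length w + 1, counting (concat (map name [0..<length w + 1])) (out_tape (rev (binary (length w + 1)))))"
  using assms(1)
proof (induction "length w + 1 - i" arbitrary: i)
  case 0
  then have "i = length w + 1" by simp
  then have "runs w (While (\<lambda>a s. a \<noteq> Right_End) (Seq next_name Advance)) 1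
    (i, counting (concat (map name [0..<i])) (out_tape (rev (binary i))))
    (i, counting (concat (map name [0..<i])) (out_tape (rev (binary i))))"
    by (intro runs_While_end) (simp add: input_symbol_def)
  with \<open>i = length w + 1\<close> show ?case by simp
next
  case (Suc d)
  let ?p = "Seq next_name Advance"
  let ?s = "\<lambda>i. (i, counting (concat (map name [0..<i])) (out_tape (rev (binary i))))"
  have i: "i < length w + 1" using Suc.hyps(2) by simp
  have 1: "runs w next_name (6 * N + 22) (?s i) (i, counting (concat (map name [0..<Suc i])) (out_tape (rev (binary (Suc i)))))"
    using runs_mono[OF runs_next_name[of w i i "concat (map name [0..<i])"]] i assms(2) by simp
  have m: "min (length w + 1) (i + 1) = Suc i" using i by simp
  have "runs w Advance 1 (i, counting (concat (map name [0..<Suc i])) (out_tape (rev (binary (Suc i))))) (?s (Suc i))"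
    using runs_Advance[of i w] i unfolding m by simp
  note 2 = runs_Seq[OF 1 this]
  have 3: "runs w (While (\<lambda>a s. a \<noteq> Right_End) ?p) ((length w + 1 - Suc i) * (6 * N + 25) + 1) (?s (Suc i)) (?s (length w + 1))"
    using Suc.hyps(2) i by (intro Suc.hyps(1)) auto
  have "input_symbol w i \<noteq> Right_End" using i by (simp add: input_symbol_def)
  then have 4: "runs w (While (\<lambda>a s. a \<noteq> Right_End) ?p)
     (6 * N + 22 + 1 + 1 + ((length w + 1 - Suc i) * (6 * N + 25) + 1) + 1) (?s i) (?s (length w + 1))"
    by (intro runs_While_step[OF _ 2 3]) simp
  have "length w + 1 - i = Suc (length w + 1 - Suc i)" using i by simp
  then have "6 * N + 22 + 1 + 1 + ((length w + 1 - Suc i) * (6 * N + 25) + 1) + 1 =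
      (length w + 1 - i) * (6 * N + 25) + 1" by simp
  with 4 show ?case by metis
qed

definition write_ends :: prog where
  "write_ends = Seq (Write Out Left_End Go_Right) (Seq (Write Xs Left_End Go_Right)
     (Seq (Write Ys Left_End Go_Right) (Seq (Write Ctr Left_End Go_Right) (Write Ctr (Letter 0) Go_Right))))"

definition prepare :: "nat \<Rightarrow> prog" where
  "prepare K = Seq write_ends
     (Seq (While (\<lambda>a s. a \<noteq> Right_End) (Seq next_name Advance))
     (Seq (iter K next_name) (Seq (Write Xs Right_End Stay) (Write Ys Right_End Stay))))"

lemma runs_write_ends:
  "runs w write_ends 9 (0, \<lambda>_. (0, \<lambda>_. Blank)) (0, counting [] (out_tape (rev (binary 0))))"
proof -
  have b: "(0, \<lambda>_. Blank) = tape_of [] []" by (simp add: tape_of_def content_def fun_eq_iff)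
  let ?b = "\<lambda>_ :: tid. tape_of [] []"
  let ?t1 = "?b(Out := tape_of [Left_End] [])"
  let ?t2 = "?t1(Xs := tape_of [Left_End] [])"
  let ?t3 = "?t2(Ys := tape_of [Left_End] [])"
  let ?t4 = "?t3(Ctr := tape_of [Left_End] [])"
  let ?t5 = "?t4(Ctr := tape_of [Left_End, Letter 0] [])"
  have 1: "runs w (Write Out Left_End Go_Right) 1 (0, ?b) (0, ?t1)"
    using runs_Write[of w Out Left_End Go_Right 0 ?b] by simp
  have 2: "runs w (Write Xs Left_End Go_Right) 1 (0, ?t1) (0, ?t2)"
    using runs_Write[of w Xs Left_End Go_Right 0 ?t1] by simp
  have 3: "runs w (Write Ys Left_End Go_Right) 1 (0, ?t2) (0, ?t3)"
    using runs_Write[of w Ys Left_End Go_Right 0 ?t2] by simp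
  have 4: "runs w (Write Ctr Left_End Go_Right) 1 (0, ?t3) (0, ?t4)"
    using runs_Write[of w Ctr Left_End Go_Right 0 ?t3] by simp
  have 5: "runs w (Write Ctr (Letter 0) Go_Right) 1 (0, ?t4) (0, ?t5)"
    using runs_Write[of w Ctr "Letter 0" Go_Right 0 ?t4] by simp
  have "?t5 = counting [] (out_tape (rev (binary 0)))"
    using binary.simps[of 0] by (auto simp: fun_eq_iff counting_def out_tape_def split: tid.split)
  moreover have "runs w write_ends (1 + (1 + (1 + (1 + 1 + 1) + 1) + 1) + 1) (0, ?b) (0, ?t5)"
    unfolding write_ends_def by (rule runs_Seq[OF 1 runs_Seq[OF 2 runs_Seq[OF 3 runs_Seq[OF 4 5]]]])
  ultimately have "runs w write_ends (1 + (1 + (1 + (1 + 1 + 1) + 1) + 1) + 1) (0, ?b)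
    (0, counting [] (out_tape (rev (binary 0))))"
    by metis
  then show ?thesis unfolding b by (rule runs_mono) simp
qed

lemma runs_prepare:
  fixes w K
  defines "N \<equiv> size_of K w"
  shows "\<exists>c. runs w (prepare K) (60 * (N + 3) ^ 2) (0, \<lambda>_. (0, \<lambda>_. Blank)) (length w + 1, pointers N c [] N N)"
proof -
  let ?n = "length w + 1"
  let ?c = "out_tape (rev (binary N))"
  let ?u = "concat (map name [0..<N])"
  have N: "N = ?n + K" by (simp add: N_def size_of_def)
  have 2: "runs w (While (\<lambda>a s. a \<noteq> Right_End) (Seq next_name Advance)) ((?n - 0) * (6 * N + 25) + 1)
    (0, counting [] (out_tape (rev (binary 0)))) (?n, counting (concat (map name [0..<?n])) (out_tape (rev (binary ?n))))"
    using runs_input_names[of 0 w N] N by simp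
  have 3: "runs w (iter K next_name) (K * (6 * N + 23) + 1)
    (?n, counting (concat (map name [0..<?n])) (out_tape (rev (binary ?n)))) (?n, counting ?u ?c)"
    using runs_next_names[of ?n K N w] N by simp
  let ?t = "(counting ?u ?c)(Xs := names N N)"
  have e: "act (Right_End, Stay) (out_tape ?u) = names N N"
    by (simp add: out_tape_def names_def)
  have 4: "runs w (Write Xs Right_End Stay) 1 (?n, counting ?u ?c) (?n, ?t)"
    using runs_Write[of w Xs Right_End Stay ?n "counting ?u ?c"] e by simp
  have "?t(Ys := names N N) = pointers N ?c [] N N"
    by (auto simp: fun_eq_iff pointers_def counting_def split: tid.split)
  then have 5: "runs w (Write Ys Right_End Stay) 1 (?n, ?t) (?n, pointers N ?c [] N N)"
    using runs_Write[of w Ys Right_End Stay ?n ?t] e by simp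
  have "runs w (prepare K) (60 * (N + 3) ^ 2) (0, \<lambda>_. (0, \<lambda>_. Blank)) (?n, pointers N ?c [] N N)"
    unfolding prepare_def
  proof (rule runs_mono[OF runs_Seq[OF runs_write_ends runs_Seq[OF 2 runs_Seq[OF 3 runs_Seq[OF 4 5]]]]])
    have "(?n - 0) * (6 * N + 25) + K * (6 * N + 23) \<le> ?n * (6 * N + 25) + K * (6 * N + 25)" by simp
    also have "\<dots> = N * (6 * N + 25)" unfolding N by (simp add: algebra_simps)
    also have "\<dots> \<le> 30 * (N + 3) ^ 2" by (simp add: power2_eq_square algebra_simps)
    finally show "9 + ((?n - 0) * (6 * N + 25) + 1 + (K * (6 * N + 23) + 1 + (1 + 1 + 1) + 1) + 1) + 1 \<le> 60 * (N + 3) ^ 2"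
      using square_bounds(4)[of N] by simp
  qed
  then show ?thesis by blast
qed

section \<open>From an emitted word to an input tape\<close>

lemma pstep_head:
  assumes "pstep w (k, i, t) = (k', i', t')"
  shows "fst (t' j) \<le> fst (t j) + 1"
proof -
  have *: "fst (act u T) \<le> fst T + 1" for u T by (cases "snd u") (auto simp: act_eq)
  have "t' j = act (snd (snd (control k (input_symbol w i) (scanned t))) j) (t j)"
    using assms by (auto simp: pstep_def case_prod_beta)
  then show ?thesis using * by metis
qed

text \<open>Heads move at most one cell per step, so the running time bounds the length of the
  output and thereby the time to rewind it.\<close>

lemma runs_head:
  assumes "runs w p T (i, t) (i', t')"
  shows "fst (t' j) \<le> fst (t j) + T"
proof -
  have "fst (t2 j) \<le> fst (t1 j) + \<tau>" if "(pstep w ^^ \<tau>) (k1, i1, t1) = (k2, i2, t2)" for \<tau> k1 i1 t1 k2 i2 t2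
    using that
  proof (induction \<tau> arbitrary: k2 i2 t2)
    case (Suc \<tau>)
    obtain k3 i3 t3 where 1: "(pstep w ^^ \<tau>) (k1, i1, t1) = (k3, i3, t3)" by (metis prod_cases3)
    then have "fst (t2 j) \<le> fst (t3 j) + 1" using Suc.prems by (intro pstep_head[of w k3 i3 t3 k2 i2]) simp
    then show ?case using Suc.IH[OF 1] by simp
  qed simp
  then show ?thesis using assms unfolding runs_def by (meson le_trans nat_add_left_cancel_le)
qed

lemma safe_basics [simp]:
  assumes "{Left_End, Right_End} \<union> Letter ` {..7} \<subseteq> \<Gamma>"
  shows "safe \<Gamma> Nop" "safe \<Gamma> (Go j d)" "safe \<Gamma> (Copy j)" "safe \<Gamma> Advance" "safe \<Gamma> Retreat" "safe \<Gamma> (Hop j)"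
    "safe \<Gamma> (Feed None d)" "safe \<Gamma> (Feed (Some (Letter 2)) d)"
    "x \<in> \<Gamma> \<Longrightarrow> safe \<Gamma> (Write j x d)"
  using assms by (auto simp: Nop_def Go_def Copy_def Advance_def Retreat_def Hop_def Feed_def Write_def idle_def Let_def)

lemma safe_iter [simp]: "{Left_End, Right_End} \<union> Letter ` {..7} \<subseteq> \<Gamma> \<Longrightarrow> safe \<Gamma> p \<Longrightarrow> safe \<Gamma> (iter k p)"
  by (induction k) auto

lemma safe_emit [simp]: "{Left_End, Right_End} \<union> Letter ` {..7} \<subseteq> \<Gamma> \<Longrightarrow> set v \<subseteq> {..7} \<Longrightarrow> safe \<Gamma> (emit v)"
proof (induction v)
  case (Cons x v)
  then have "Letter x \<in> \<Gamma>" by auto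
  with Cons show ?case by simp
qed simp

lemma safe_programs:
  assumes "{Left_End, Right_End} \<union> Letter ` {..7} \<subseteq> \<Gamma>"
  shows "safe \<Gamma> (prepare K)" "safe \<Gamma> emit_vertices" "safe \<Gamma> (emit_edges b a sw h A)"
proof -
  have "Left_End \<in> \<Gamma>" "Right_End \<in> \<Gamma>" "Letter 0 \<in> \<Gamma>" "Letter 1 \<in> \<Gamma>" using assms by auto
  then show "safe \<Gamma> (prepare K)" "safe \<Gamma> emit_vertices" "safe \<Gamma> (emit_edges b a sw h A)"
    using assms by (auto simp: prepare_def write_ends_def next_name_def emit_vertices_def emit_edges_def lin_step_def
        rewind_names_def rewind_input_def copy_name_def skip_name_def simp del: emit.simps)
qed

text \<open>After the word is emitted, an end marker is appended and the head returns to
  \<open>Left_End\<close>; \<open>Out\<close> then looks like an input tape with \<open>f w\<close>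
  on it, which is what \<open>compose_machine\<close> expects.\<close>

theorem generator:
  assumes "emits K p f" "{Left_End, Right_End} \<union> Letter ` {..7} \<subseteq> \<Gamma>" "safe \<Gamma> p"
  obtains p' \<kappa> where "safe \<Gamma> p'"
    "\<And>w. \<exists>i t. runs w p' (\<kappa> * (size_of K w + 3) ^ 2) (0, \<lambda>_. (0, \<lambda>_. Blank)) (i, t) \<and>
       fst (t Out) = 0 \<and> (\<forall>i \<le> length (f w) + 1. snd (t Out) i = input_symbol (f w) i)"
proof -
  obtain \<kappa> where \<kappa>: "emits_within K p f \<kappa>"
    using assms(1) unfolding emits_def by blast
  let ?p = "Seq (prepare K) (Seq p (Seq (Write Out Right_End Stay)
     (While (\<lambda>a s. s Out \<noteq> Left_End) (Go Out Go_Left))))"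
  show thesis
  proof (rule that[where \<kappa> = "3 * \<kappa> + 190"])
    have "Left_End \<in> \<Gamma>" "Right_End \<in> \<Gamma>" using assms(2) by auto
    then show "safe \<Gamma> ?p" using assms(2,3) safe_programs(1)[OF assms(2)] by simp
    fix w
    let ?N = "size_of K w"
    let ?Q = "(?N + 3) ^ 2"
    obtain c where 1: "runs w (prepare K) (60 * ?Q) (0, \<lambda>_. (0, \<lambda>_. Blank)) (length w + 1, pointers ?N c [] ?N ?N)"
      using runs_prepare by blast
    obtain x y i where 2: "runs w p (\<kappa> * ?Q) (length w + 1, pointers ?N c [] ?N ?N) (i, pointers ?N c ([] @ f w) x y)"
      using \<kappa> unfolding emits_within_def by (metis le_refl)
    let ?m = "pointers ?N c (f w) x y"
    let ?t = "?m(Out := tape_of (Left_End # map Letter (f w)) [Right_End])"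
    have 3: "runs w (Write Out Right_End Stay) 1 (i, pointers ?N c ([] @ f w) x y) (i, ?t)"
      using runs_Write[of w Out Right_End Stay i ?m] by (simp add: out_tape_def)
    let ?out = "tape_of [] (Left_End # map Letter (f w) @ [Right_End])"
    have 4: "runs w (While (\<lambda>a s. s Out \<noteq> Left_End) (Go Out Go_Left)) (2 * length (map Letter (f w)) + 3)
        (i, ?t) (i, ?t(Out := ?out))"
      by (rule runs_go_left) auto
    \<comment> \<open>The output is no longer than the time spent so far, about
      \<open>(60 + \<kappa>) * ?Q\<close>. Rewinding takes twice its length, hence a total near
      three times this amount.\<close>
    have "fst (pointers ?N c ([] @ f w) x y Out) \<le> fst (0 :: nat, \<lambda>_ :: nat. Blank) + (60 * ?Q + \<kappa> * ?Q + 1)"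
      using runs_head[OF runs_Seq[OF 1 2], of Out] by simp
    then have "length (f w) \<le> 60 * ?Q + \<kappa> * ?Q" by (simp add: out_tape_def tape_of_def)
    then have "60 * ?Q + (\<kappa> * ?Q + (1 + (2 * length (map Letter (f w)) + 3) + 1) + 1) + 1 \<le> (3 * \<kappa> + 190) * ?Q"
      using square_bounds(4)[of ?N] by (simp add: algebra_simps)
    then have "runs w ?p ((3 * \<kappa> + 190) * ?Q) (0, \<lambda>_. (0, \<lambda>_. Blank)) (i, ?t(Out := ?out))"
      using runs_mono[OF runs_Seq[OF 1 runs_Seq[OF 2 runs_Seq[OF 3 4]]]] by blast
    moreover have "\<forall>i \<le> length (f w) + 1. snd ?out i = input_symbol (f w) i"
      by (auto simp: tape_of_def content_def input_symbol_def nth_Cons' nth_append)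
    ultimately show "\<exists>i t. runs w ?p ((3 * \<kappa> + 190) * ?Q) (0, \<lambda>_. (0, \<lambda>_. Blank)) (i, t) \<and>
       fst (t Out) = 0 \<and> (\<forall>i \<le> length (f w) + 1. snd (t Out) i = input_symbol (f w) i)"
      by (intro exI[of _ i] exI[of _ "?t(Out := ?out)"]) (simp add: tape_of_def)
  qed
qed


section \<open>Unions of tensor products\<close>

text \<open>A description of a factor that is the same for all words. It determines both the
  explicit graph for a given \<open>w\<close> and a program that writes this graph, and the shape of
  the formula depends on descriptions alone.\<close>

datatype kind = Edge nat nat | Lin nat nat bool nat "symbol set"

fun kind_edges :: "nat \<Rightarrow> nat list \<Rightarrow> kind \<Rightarrow> (nat \<times> nat) list" where
  "kind_edges N w (Edge u v) = [(u, v)]"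
| "kind_edges N w (Lin b a sw h A) = lin_edges N w b a sw h A 0"

fun wf_kind :: "nat \<Rightarrow> kind \<Rightarrow> bool" where
  "wf_kind N (Edge u v) \<longleftrightarrow> u < N \<and> v < N"
| "wf_kind N (Lin b a sw h A) \<longleftrightarrow> 1 \<le> b"

text \<open>Every factor has all of \<open>0, ..., N - 1\<close> as vertices. So tensor products
  with equally many factors share one vertex set, and the naming condition of
  \<open>wf_factored\<close> holds.\<close>

definition input_of :: "nat \<Rightarrow> nat list \<Rightarrow> kind \<Rightarrow> explicit_graph" where
  "input_of N w k = ([0..<N], kind_edges N w k)"

fun tensors :: "nat \<Rightarrow> nat list \<Rightarrow> kind list \<Rightarrow> factored_graph" where
  "tensors N w [] = Input ([], [])"
| "tensors N w [k] = Input (input_of N w k)"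
| "tensors N w (k # ks) = Tensor (Input (input_of N w k)) (tensors N w ks)"

fun unions :: "nat \<Rightarrow> nat list \<Rightarrow> kind list list \<Rightarrow> factored_graph" where
  "unions N w [] = Input ([], [])"
| "unions N w [ks] = tensors N w ks"
| "unions N w (ks # kss) = Graph_Union (tensors N w ks) (unions N w kss)"

lemma lin_edges_iff:
  assumes "1 \<le> b"
  shows "(x, y) \<in> set (lin_edges N w b a sw h A 0) \<longleftrightarrow>
    (if sw then x = b * y + a \<and> x < N \<and> input_symbol w (y + h) \<in> A
     else y = b * x + a \<and> y < N \<and> input_symbol w (x + h) \<in> A)"
  using lin_less[OF _ assms] by (auto simp: lin_edges_def)

text \<open>The running variable \<open>x\<close> is itself a component of the edge, at a fixed
  place; so no edge is listed twice.\<close>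

lemma distinct_lin_edges: "1 \<le> b \<Longrightarrow> distinct (lin_edges N w b a sw h A x0)"
proof -
  assume b: "1 \<le> b"
  have concat_filter: "concat (map (\<lambda>x. if P x then [f x] else []) xs) = map f (filter P xs)"
    for P and f :: "nat \<Rightarrow> nat \<times> nat" and xs
    by (induction xs) auto
  show ?thesis unfolding lin_edges_def concat_filter by (auto simp: distinct_map inj_on_def)
qed

text \<open>Adjacency in the tensor product of the factors \<open>ks\<close>, coordinate by
  coordinate.\<close>

fun moves :: "nat \<Rightarrow> nat list \<Rightarrow> kind list \<Rightarrow> nat list \<Rightarrow> nat list \<Rightarrow> bool" where
  "moves N w [] [] [] = True"
| "moves N w (k # ks) (x # v) (y # u) \<longleftrightarrow> (x, y) \<in> set (kind_edges N w k) \<and> moves N w ks v u"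
| "moves N w _ _ _ = False"

lemma moves_Cons: "moves N w (k # ks) (x # v) U \<longleftrightarrow>
    (\<exists>y u. U = y # u \<and> (x, y) \<in> set (kind_edges N w k) \<and> moves N w ks v u)"
  by (cases U) auto

lemma moves_nth: "moves N w ks v u \<longleftrightarrow> length v = length ks \<and> length u = length ks \<and>
    (\<forall>i < length ks. (v ! i, u ! i) \<in> set (kind_edges N w (ks ! i)))"
  by (induction N w ks v u rule: moves.induct) (auto simp: nth_Cons' less_Suc_eq_0_disj)

lemma moves_append:
  "length v = length ks \<Longrightarrow> moves N w (ks @ ks') (v @ v') U \<longleftrightarrow>
    (\<exists>u u'. U = u @ u' \<and> moves N w ks v u \<and> moves N w ks' v' u')"
proof (induction ks arbitrary: v U)
  case Nil
  have "moves N w [] [] u \<longleftrightarrow> u = []" for u by (cases u) auto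
  then show ?case using Nil by simp
next
  case (Cons k ks)
  then obtain x v1 where v: "v = x # v1" "length v1 = length ks" by (cases v) auto
  show ?case
  proof
    assume "moves N w ((k # ks) @ ks') (v @ v') U"
    then obtain y U1 where "U = y # U1" "(x, y) \<in> set (kind_edges N w k)" "moves N w (ks @ ks') (v1 @ v') U1"
      using v by (auto simp: moves_Cons)
    moreover from this obtain u u' where "U1 = u @ u'" "moves N w ks v1 u" "moves N w ks' v' u'"
      using Cons.IH[OF v(2)] by blast
    ultimately show "\<exists>u u'. U = u @ u' \<and> moves N w (k # ks) v u \<and> moves N w ks' v' u'"
      using v by (intro exI[of _ "y # u"] exI[of _ u']) simp
  next
    assume "\<exists>u u'. U = u @ u' \<and> moves N w (k # ks) v u \<and> moves N w ks' v' u'"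
    then obtain y u u' where "U = y # u @ u'" "(x, y) \<in> set (kind_edges N w k)" "moves N w ks v1 u" "moves N w ks' v' u'"
      using v by (auto simp: moves_Cons)
    then show "moves N w ((k # ks) @ ks') (v @ v') U"
      using Cons.IH[OF v(2)] v by auto
  qed
qed

lemma wf_kind_edges: "wf_kind N k \<Longrightarrow> (x, y) \<in> set (kind_edges N w k) \<Longrightarrow> x < N \<and> y < N"
  by (cases k) (auto simp: lin_edges_iff lin_less split: if_splits)

lemma graph_of_input:
  "pverts (graph_of (Input (input_of N w k))) = {[x] | x. x < N}"
  "parcs (graph_of (Input (input_of N w k))) = {([x], [y]) | x y. (x, y) \<in> set (kind_edges N w k)}"
  by (auto simp: input_graph_def input_of_def)

lemma graph_of_tensors:
  assumes "ks \<noteq> []"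
  shows "pverts (graph_of (tensors N w ks)) = {v. length v = length ks \<and> set v \<subseteq> {..<N}}"
    and "parcs (graph_of (tensors N w ks)) = {(v, u). moves N w ks v u}"
  using assms
proof (induction N w ks rule: tensors.induct)
  case (2 N w k)
  {
    case 1
    show ?case by (auto simp: graph_of_input[simplified] length_Suc_conv)
  next
    case 2
    have "moves N w [k] v u \<longleftrightarrow> (\<exists>x y. v = [x] \<and> u = [y] \<and> (x, y) \<in> set (kind_edges N w k))" for v u
      by (auto simp: moves_nth length_Suc_conv)
    then show ?case by (auto simp: graph_of_input[simplified])
  }
next
  case (3 N w k k' ks)
  {
    case 1
    have "v \<in> pverts (graph_of (tensors N w (k # k' # ks))) \<longleftrightarrow>
        (\<exists>x u. v = x # u \<and> x < N \<and> length u = length (k' # ks) \<and> set u \<subseteq> {..<N})" for v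
    proof -
      have "v \<in> pverts (graph_of (tensors N w (k # k' # ks))) \<longleftrightarrow>
          (\<exists>a u. v = a @ u \<and> a \<in> {[x] | x. x < N} \<and> u \<in> {v. length v = length (k' # ks) \<and> set v \<subseteq> {..<N}})"
        using 3(1) graph_of_input(1)[of N w k] by (simp add: tensor_product_def)
      also have "\<dots> \<longleftrightarrow> (\<exists>x u. v = [x] @ u \<and> x < N \<and> length u = length (k' # ks) \<and> set u \<subseteq> {..<N})"
        by blast
      finally show ?thesis by simp
    qed
    moreover have "length v = length (k # k' # ks) \<and> set v \<subseteq> {..<N} \<longleftrightarrow>
        (\<exists>x u. v = x # u \<and> x < N \<and> length u = length (k' # ks) \<and> set u \<subseteq> {..<N})" for v
      by (cases v) auto
    ultimately show ?case by (intro set_eqI) (simp only: mem_Collect_eq)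
  next
    case 2
    have "moves N w (k # k' # ks) v u \<longleftrightarrow>
      (\<exists>x y v1 u1. v = [x] @ v1 \<and> u = [y] @ u1 \<and> (x, y) \<in> set (kind_edges N w k) \<and> moves N w (k' # ks) v1 u1)" for v u
      by (cases v; cases u) auto
    moreover have "(v, u) \<in> parcs (graph_of (tensors N w (k # k' # ks))) \<longleftrightarrow>
      (\<exists>x y v1 u1. v = [x] @ v1 \<and> u = [y] @ u1 \<and> (x, y) \<in> set (kind_edges N w k) \<and> moves N w (k' # ks) v1 u1)" for v u
    proof -
      have "(v, u) \<in> parcs (graph_of (tensors N w (k # k' # ks))) \<longleftrightarrow>
        (\<exists>a v1 b u1. v = a @ v1 \<and> u = b @ u1 \<and> (a, b) \<in> {([x], [y]) | x y. (x, y) \<in> set (kind_edges N w k)} \<and>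
          (v1, u1) \<in> {(v, u). moves N w (k' # ks) v u})"
        using 3(2) graph_of_input(2)[of N w k] by (simp add: tensor_product_def)
      also have "\<dots> \<longleftrightarrow> (\<exists>x y v1 u1. v = [x] @ v1 \<and> u = [y] @ u1 \<and> (x, y) \<in> set (kind_edges N w k) \<and> moves N w (k' # ks) v1 u1)"
        by blast
      finally show ?thesis .
    qed
    ultimately have "(v, u) \<in> parcs (graph_of (tensors N w (k # k' # ks))) \<longleftrightarrow> moves N w (k # k' # ks) v u" for v u
      by (simp only:)
    then show ?case by (intro set_eqI) (simp only: mem_Collect_eq case_prod_unfold split_paired_all fst_conv snd_conv)
  }
qed auto

lemma graph_of_unions:
  assumes "kss \<noteq> []" "\<And>ks. ks \<in> set kss \<Longrightarrow> length ks = m" "0 < m"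
  shows "pverts (graph_of (unions N w kss)) = {v. length v = m \<and> set v \<subseteq> {..<N}} \<and>
    parcs (graph_of (unions N w kss)) = {(v, u). \<exists>ks \<in> set kss. moves N w ks v u}"
  using assms
proof (induction N w kss rule: unions.induct)
  case (2 N w ks)
  then have "ks \<noteq> []" by auto
  with 2 graph_of_tensors[of ks N w] show ?case by auto
next
  case (3 N w ks ks' kss)
  then have "ks \<noteq> []" by auto
  with 3 graph_of_tensors[of ks N w] show ?case by (auto simp: graph_union_def)
qed auto

lemma inputs_tensors: "ks \<noteq> [] \<Longrightarrow> inputs (tensors N w ks) = input_of N w ` set ks"
  by (induction N w ks rule: tensors.induct) auto

lemma inputs_unions:
  "kss \<noteq> [] \<Longrightarrow> [] \<notin> set kss \<Longrightarrow> inputs (unions N w kss) = input_of N w ` (\<Union>ks \<in> set kss. set ks)"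
  by (induction N w kss rule: unions.induct) (auto simp: inputs_tensors)

definition num_operations :: "kind list list \<Rightarrow> nat" where
  "num_operations kss = sum_list (map (\<lambda>ks. length ks - 1) kss) + (length kss - 1)"

lemma operations_tensors: "operations (tensors N w ks) = length ks - 1"
  by (induction N w ks rule: tensors.induct) auto

lemma operations_unions: "operations (unions N w kss) = num_operations kss"
  unfolding num_operations_def
  by (induction N w kss rule: unions.induct) (auto simp: operations_tensors)

lemma wf_unions:
  assumes "kss \<noteq> []" "[] \<notin> set kss" "\<And>ks k. ks \<in> set kss \<Longrightarrow> k \<in> set ks \<Longrightarrow> wf_kind N k"
  shows "wf_factored (unions N w kss)"
    and "has_complexity (unions N w kss) N (num_operations kss + 1)"
proof -
  have "wf_explicit (input_of N w k)" if "wf_kind N k" for k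
    using that wf_kind_edges[OF that]
    by (cases k) (auto simp: wf_explicit_def input_of_def distinct_lin_edges)
  then have 1: "\<forall>G \<in> inputs (unions N w kss). wf_explicit G"
    using assms by (auto simp: inputs_unions)
  obtain ks k where "ks \<in> set kss" "k \<in> set ks"
    using assms(1,2) by (metis ex_in_conv set_empty)
  then have "(\<Union>G \<in> inputs (unions N w kss). set (fst G)) = {..<N}"
    using assms(1,2) by (auto simp: inputs_unions input_of_def)
  with 1 show "wf_factored (unions N w kss)" unfolding wf_factored_def by blast
  show "has_complexity (unions N w kss) N (num_operations kss + 1)"
    using assms(1,2) operations_unions
    by (auto simp: has_complexity_def inputs_unions input_of_def)
qed

section \<open>Programs that write formulas\<close>

fun emit_kind :: "kind \<Rightarrow> prog" where
  "emit_kind (Edge u v) = Seq (emit [4]) (Seq emit_vertices (emit (encode_list [u, v])))"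
| "emit_kind (Lin b a sw h A) = Seq (emit [4]) (Seq emit_vertices (emit_edges b a sw h A))"

fun emit_tensors :: "kind list \<Rightarrow> prog" where
  "emit_tensors [] = Nop"
| "emit_tensors [k] = emit_kind k"
| "emit_tensors (k # ks) = Seq (emit [6]) (Seq (emit_kind k) (emit_tensors ks))"

fun emit_unions :: "kind list list \<Rightarrow> prog" where
  "emit_unions [] = Nop"
| "emit_unions [ks] = emit_tensors ks"
| "emit_unions (ks # kss) = Seq (emit [7]) (Seq (emit_tensors ks) (emit_unions kss))"

lemma emits_kind:
  assumes "\<And>w. wf_kind (size_of K w) k"
  shows "emits K (emit_kind k) (\<lambda>w. encode_factored (Input (input_of (size_of K w) w k)))"
proof (cases k)
  case (Edge u v)
  have "emits K (emit_kind k) (\<lambda>w. [4] @ encode_list [0..<size_of K w] @ encode_list [u, v])"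
    unfolding Edge emit_kind.simps by (intro emits_Seq emits_emit emits_vertices)
  then show ?thesis by (simp add: Edge input_of_def)
next
  case (Lin b a sw h A)
  then have b: "1 \<le> b" using assms by simp
  have "emits K (emit_kind k) (\<lambda>w. [4] @ encode_list [0..<size_of K w] @
     encode_list (concat (map (\<lambda>(u, v). [u, v]) (lin_edges (size_of K w) w b a sw h A 0))))"
    unfolding Lin emit_kind.simps by (intro emits_Seq emits_emit emits_vertices emits_edges b)
  then show ?thesis by (simp add: Lin input_of_def)
qed

lemma emits_tensors:
  assumes "ks \<noteq> []" "\<And>w k. k \<in> set ks \<Longrightarrow> wf_kind (size_of K w) k"
  shows "emits K (emit_tensors ks) (\<lambda>w. encode_factored (tensors (size_of K w) w ks))"
  using assms
proof (induction ks rule: emit_tensors.induct)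
  case (2 k)
  then show ?case using emits_kind[of K k] by simp
next
  case (3 k k' ks)
  have "emits K (emit_tensors (k # k' # ks)) (\<lambda>w. [6] @ encode_factored (Input (input_of (size_of K w) w k)) @
      encode_factored (tensors (size_of K w) w (k' # ks)))"
    unfolding emit_tensors.simps using 3 by (intro emits_Seq emits_emit emits_kind) auto
  then show ?case by simp
qed simp

lemma emits_unions:
  assumes "kss \<noteq> []" "[] \<notin> set kss" "\<And>w ks k. ks \<in> set kss \<Longrightarrow> k \<in> set ks \<Longrightarrow> wf_kind (size_of K w) k"
  shows "emits K (emit_unions kss) (\<lambda>w. encode_factored (unions (size_of K w) w kss))"
  using assms
proof (induction kss rule: emit_unions.induct)
  case (2 ks)
  then show ?case using emits_tensors[of ks K] by auto
next
  case (3 ks ks' kss)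
  have "emits K (emit_unions (ks # ks' # kss)) (\<lambda>w. [7] @ encode_factored (tensors (size_of K w) w ks) @
      encode_factored (unions (size_of K w) w (ks' # kss)))"
    unfolding emit_unions.simps using 3 by (intro emits_Seq emits_emit emits_tensors) auto
  then show ?case by simp
qed simp

lemma encode_list_bound: "set (encode_list v) \<subseteq> {..7}"
proof -
  have "set (binary m) \<subseteq> {..7}" for m using binary_bound[of m] by auto
  then show ?thesis unfolding encode_list_def by (induction v) auto
qed

lemma safe_unions:
  assumes "{Left_End, Right_End} \<union> Letter ` {..7} \<subseteq> \<Gamma>"
  shows "safe \<Gamma> (emit_unions kss)"
proof -
  have k: "safe \<Gamma> (emit_kind k)" for k
    using assms encode_list_bound safe_programs[OF assms] by (cases k) (simp_all del: emit.simps)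
  have "safe \<Gamma> (emit_tensors ks)" for ks
    by (induction ks rule: emit_tensors.induct) (use k assms in \<open>simp_all del: emit.simps\<close>)
  then show ?thesis
    by (induction kss rule: emit_unions.induct) (use assms in \<open>simp_all del: emit.simps\<close>)
qed

section \<open>Configurations as vertices\<close>


text \<open>\<open>Blank\<close> is the digit 0, so the stacks of an empty tape are 0 and the
  initial configuration has zeros in all coordinates but the state.\<close>

fun code :: "symbol \<Rightarrow> nat" where
  "code Blank = 0"
| "code Left_End = 1"
| "code Right_End = 2"
| "code (Letter a) = a + 3"

lemma code_inj: "code a = code b \<longleftrightarrow> a = b"
  by (cases a; cases b) auto

abbreviation Keep :: kind where "Keep \<equiv> Lin 1 0 False 0 UNIV"
abbreviation Incr :: kind where "Incr \<equiv> Lin 1 1 False 0 UNIV"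
abbreviation Decr :: kind where "Decr \<equiv> Lin 1 1 True 0 UNIV"
abbreviation Push :: "nat \<Rightarrow> nat \<Rightarrow> kind" where "Push B a \<equiv> Lin B a False 0 UNIV"
text \<open>For \<open>a < B\<close> a stack has an outgoing edge here only if its last digit is
  \<open>a\<close>: popping also tests a guessed digit.\<close>

abbreviation Pop :: "nat \<Rightarrow> nat \<Rightarrow> kind" where "Pop B a \<equiv> Lin B a True 0 UNIV"

text \<open>
  Cell \<open>i\<close> of a tape belongs to block \<open>i mod c\<close>. A vertex stores the contents of block \<open>j\<close> left of the
  head and right of the head as two stacks, that is as numbers in base \<open>B\<close> whose last digits are next
  to the head. Since a head move pushes to one block and pops from one block, no carry between
  coordinates arises, and a block has only about \<open>S / c\<close> cells, so its numbers stay below \<open>N\<close>.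
\<close>

fun left_stack :: "nat \<Rightarrow> nat \<Rightarrow> (nat \<Rightarrow> symbol) \<Rightarrow> nat \<Rightarrow> nat \<Rightarrow> nat" where
  "left_stack c B t j 0 = 0"
| "left_stack c B t j (Suc p) =
     (if p mod c = j then B * left_stack c B t j p + code (t p) else left_stack c B t j p)"

fun right_stack :: "nat \<Rightarrow> nat \<Rightarrow> (nat \<Rightarrow> symbol) \<Rightarrow> nat \<Rightarrow> nat \<Rightarrow> nat \<Rightarrow> nat" where
  "right_stack c B t j i 0 = 0"
| "right_stack c B t j i (Suc d) =
     (if i mod c = j then B * right_stack c B t j (Suc i) d + code (t i) else right_stack c B t j (Suc i) d)"

text \<open>A factor sees only its own coordinate. Therefore \<open>p mod c\<close>, which selects
  the blocks affected by a move, and the scanned symbol are coordinates of their own. The right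
  stacks end with cell \<open>S - 1\<close>, the last one that may be visited.\<close>

definition tape_vertex :: "nat \<Rightarrow> nat \<Rightarrow> nat \<Rightarrow> tape \<Rightarrow> nat list" where
  "tape_vertex c B S = (\<lambda>(p, t). [p, p mod c, code (t p)] @
     map (\<lambda>j. left_stack c B t j p) [0..<c] @ map (\<lambda>j. right_stack c B t j (Suc p) (S - Suc p)) [0..<c])"

text \<open>A move guesses a block \<open>j\<close> and the symbol \<open>z\<close> that will be
  scanned next, with one tensor product per guess. The edge at the residue checks \<open>j\<close>,
  and the popped stack checks \<open>z\<close>. The alternative with \<open>Edge 0 0\<close> is a
  left move on the leftmost cell, where the head stays.\<close>

definition tape_kinds :: "nat \<Rightarrow> nat \<Rightarrow> symbol \<Rightarrow> symbol \<times> move \<Rightarrow> kind list list" where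
  "tape_kinds c B a = (\<lambda>(a', d). let keep = replicate c Keep in case d of
     Stay \<Rightarrow> [[Keep, Keep, Edge (code a) (code a')] @ keep @ keep]
   | Go_Right \<Rightarrow> [[Incr, Edge j (Suc j mod c), Edge (code a) z] @
        keep[j := Push B (code a')] @ keep[Suc j mod c := Pop B z]. j \<leftarrow> [0..<c], z \<leftarrow> [0..<B]]
   | Go_Left \<Rightarrow> ([Edge 0 0, Keep, Edge (code a) (code a')] @ keep @ keep) #
       [[Decr, Edge (Suc j mod c) j, Edge (code a) z] @
        keep[j := Pop B z] @ keep[Suc j mod c := Push B (code a')]. j \<leftarrow> [0..<c], z \<leftarrow> [0..<B]])"

lemma length_tape_vertex: "length (tape_vertex c B S T) = 3 + 2 * c"
  by (cases T) (simp add: tape_vertex_def)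

lemma length_tape_kinds: "ks \<in> set (tape_kinds c B a b) \<Longrightarrow> length ks = 3 + 2 * c"
  by (cases b; cases "snd b") (auto simp: tape_kinds_def Let_def)

section \<open>Updates and bounds of single coordinates\<close>

lemma replicate_moves:
  assumes "j < n" "length v = n" "set v \<subseteq> {..<N}"
  shows "moves N w ((replicate n Keep)[j := k]) v u \<longleftrightarrow>
    (\<exists>y. (v ! j, y) \<in> set (kind_edges N w k) \<and> u = v[j := y])"
proof
  assume m: "moves N w ((replicate n Keep)[j := k]) v u"
  then have len: "length u = n" and
    e: "\<And>i. i < n \<Longrightarrow> (v ! i, u ! i) \<in> set (kind_edges N w ((replicate n Keep)[j := k] ! i))"
    by (auto simp: moves_nth)
  have nth: "u ! i = v[j := u ! j] ! i" if "i < n" for i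
    using e[OF that] that assms by (cases "i = j") (auto simp: lin_edges_iff)
  have "u = v[j := u ! j]"
  proof (rule nth_equalityI)
    show "length u = length (v[j := u ! j])" using len assms by simp
    show "i < length u \<Longrightarrow> u ! i = v[j := u ! j] ! i" for i using nth[of i] len by argo
  qed
  moreover have "(v ! j, u ! j) \<in> set (kind_edges N w k)" using e[OF assms(1)] assms by simp
  ultimately show "\<exists>y. (v ! j, y) \<in> set (kind_edges N w k) \<and> u = v[j := y]" by metis
next
  assume "\<exists>y. (v ! j, y) \<in> set (kind_edges N w k) \<and> u = v[j := y]"
  then obtain y where y: "(v ! j, y) \<in> set (kind_edges N w k)" "u = v[j := y]" by blast
  have "v ! i < N" if "i < n" for i using that assms by (meson lessThan_iff nth_mem subsetD)
  then show "moves N w ((replicate n Keep)[j := k]) v u"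
    using y assms by (auto simp: moves_nth nth_list_update lin_edges_iff)
qed

lemma replicate_moves_keep:
  assumes "length v = n" "set v \<subseteq> {..<N}"
  shows "moves N w (replicate n Keep) v u \<longleftrightarrow> u = v"
proof
  assume m: "moves N w (replicate n Keep) v u"
  show "u = v"
    by (rule nth_equalityI) (use m assms in \<open>auto simp: moves_nth lin_edges_iff\<close>)
next
  have "v ! i < N" if "i < n" for i using that assms by (meson lessThan_iff nth_mem subsetD)
  then show "u = v \<Longrightarrow> moves N w (replicate n Keep) v u"
    using assms by (auto simp: moves_nth lin_edges_iff)
qed

text \<open>These cells are of the form \<open>q * c + j\<close> with
  \<open>q \<le> S div c\<close>; so this bounds the number of digits of a stack.\<close>

lemma card_block: "e \<le> S \<Longrightarrow> 0 < c \<Longrightarrow> card {i \<in> {b..<e}. i mod c = j} \<le> S div c + 1"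
proof -
  assume e: "e \<le> S" and c: "0 < c"
  have "{i \<in> {b..<e}. i mod c = j} \<subseteq> (\<lambda>q. q * c + j) ` {..S div c}"
  proof
    fix i assume "i \<in> {i \<in> {b..<e}. i mod c = j}"
    then have "i = (i div c) * c + j" "i div c \<le> S div c"
      using e by (auto simp: div_le_mono)
    then show "i \<in> (\<lambda>q. q * c + j) ` {..S div c}" by blast
  qed
  then have "card {i \<in> {b..<e}. i mod c = j} \<le> card ((\<lambda>q. q * c + j) ` {..S div c})"
    by (intro card_mono) auto
  also have "\<dots> \<le> card {..S div c}" by (rule card_image_le) simp
  finally show ?thesis by simp
qed

lemma push_bound: "x < B ^ m \<Longrightarrow> a < B \<Longrightarrow> B * x + a < B ^ Suc (m :: nat)" for a B x :: nat
proof -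
  assume "x < B ^ m" "a < B"
  then have "B * x + a < B * x + B" "B * (x + 1) \<le> B * B ^ m" by (simp, intro mult_le_mono, auto)
  then show ?thesis by simp
qed

lemma left_stack_bound:
  assumes "\<forall>i. code (t i) < B"
  shows "left_stack c B t j p < B ^ card {i \<in> {0..<p}. i mod c = j}"
proof (induction p)
  case (Suc p)
  show ?case
  proof (cases "p mod c = j")
    case True
    then have "{i \<in> {0..<Suc p}. i mod c = j} = insert p {i \<in> {0..<p}. i mod c = j}" by auto
    then show ?thesis using push_bound[OF Suc assms[rule_format]] True by simp
  next
    case False
    then have "{i \<in> {0..<Suc p}. i mod c = j} = {i \<in> {0..<p}. i mod c = j}"
      using less_Suc_eq by auto
    then show ?thesis using Suc False by simp
  qed
qed simp

lemma right_stack_bound: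
  assumes "\<forall>i. code (t i) < B"
  shows "right_stack c B t j b d < B ^ card {i \<in> {b..<b + d}. i mod c = j}"
proof (induction d arbitrary: b)
  case (Suc d)
  have eq: "{b..<b + Suc d} = insert b {Suc b..<Suc b + d}" by auto
  show ?case
  proof (cases "b mod c = j")
    case True
    then have "{i \<in> {b..<b + Suc d}. i mod c = j} = insert b {i \<in> {Suc b..<Suc b + d}. i mod c = j}"
      unfolding eq by auto
    then show ?thesis using push_bound[OF Suc[of "Suc b"] assms[rule_format, of b]] True by simp
  next
    case False
    then have "{i \<in> {b..<b + Suc d}. i mod c = j} = {i \<in> {Suc b..<Suc b + d}. i mod c = j}"
      unfolding eq by auto
    then show ?thesis using Suc[of "Suc b"] False by simp
  qed
qed simp

lemma left_stack_cong: "(\<And>i. i < p \<Longrightarrow> t i = t' i) \<Longrightarrow> left_stack c B t j p = left_stack c B t' j p"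
  by (induction p) auto

lemma right_stack_cong:
  "(\<And>i. b \<le> i \<Longrightarrow> t i = t' i) \<Longrightarrow> right_stack c B t j b d = right_stack c B t' j b d"
  by (induction d arbitrary: b) auto

section \<open>A step on one tape as an edge\<close>

locale stack_encoding =
  fixes c B S N :: nat and w :: "nat list"
  assumes c: "1 \<le> c" "c \<le> N" and B: "B \<le> N" and S: "S \<le> N" and bound: "B ^ (S div c + 1) \<le> N"
begin

definition valid_tape :: "tape \<Rightarrow> bool" where
  "valid_tape T \<longleftrightarrow> fst T < S \<and> (\<forall>i. code (snd T i) < B)"

lemma left_less:
  assumes "\<forall>i. code (t i) < B" "p \<le> S"
  shows "left_stack c B t j p < N"
proof -
  have "0 < B" using spec[OF assms(1), of 0] by simp
  then have "B ^ card {i \<in> {0..<p}. i mod c = j} \<le> B ^ (S div c + 1)"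
    using card_block[of p S c 0 j] assms(2) c by (intro power_increasing) auto
  then show ?thesis using left_stack_bound[OF assms(1), of c j p] bound by simp
qed

lemma right_less:
  assumes "\<forall>i. code (t i) < B" "b + d \<le> S"
  shows "right_stack c B t j b d < N"
proof -
  have "0 < B" using spec[OF assms(1), of 0] by simp
  then have "B ^ card {i \<in> {b..<b + d}. i mod c = j} \<le> B ^ (S div c + 1)"
    using card_block[of "b + d" S c b j] assms(2) c by (intro power_increasing) auto
  then show ?thesis using right_stack_bound[OF assms(1), of c j b d] bound by simp
qed

lemma tape_vertex_bound: "valid_tape T \<Longrightarrow> set (tape_vertex c B S T) \<subseteq> {..<N}"
proof -
  assume v: "valid_tape T"
  obtain p t where T: "T = (p, t)" by (cases T)
  have t: "\<forall>i. code (t i) < B" "p < S" using v by (auto simp: valid_tape_def T)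
  have "p mod c < N" using c by (meson less_le_trans mod_less_divisor zero_less_one)
  moreover have "code (t p) < N" using spec[OF t(1), of p] B by simp
  moreover have "left_stack c B t j p < N" for j using left_less[OF t(1)] t(2) by simp
  moreover have "right_stack c B t j (Suc p) (S - Suc p) < N" for j using right_less[OF t(1)] t(2) by simp
  ultimately show ?thesis using t(2) S by (auto simp: T tape_vertex_def)
qed

lemma upd_map: "j < n \<Longrightarrow> (map f [0..<n])[j := y] = map (f(j := y)) [0..<n]"
  by (rule nth_equalityI) (auto simp: nth_list_update)

lemma moves_split:
  assumes "length ks = c" "length ks' = c"
  shows "moves N w ([k1, k2, k3] @ ks @ ks') ([x1, x2, x3] @ map f [0..<c] @ map g [0..<c]) U \<longleftrightarrow>
    (\<exists>y1 y2 y3 u u'. U = [y1, y2, y3] @ u @ u' \<and> (x1, y1) \<in> set (kind_edges N w k1) \<and>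
       (x2, y2) \<in> set (kind_edges N w k2) \<and> (x3, y3) \<in> set (kind_edges N w k3) \<and>
       moves N w ks (map f [0..<c]) u \<and> moves N w ks' (map g [0..<c]) u')"
proof -
  have a: "moves N w (ks @ ks') (map f [0..<c] @ map g [0..<c]) V \<longleftrightarrow>
    (\<exists>u u'. V = u @ u' \<and> moves N w ks (map f [0..<c]) u \<and> moves N w ks' (map g [0..<c]) u')" for V
    using assms by (intro moves_append) simp
  show ?thesis
    unfolding append_Cons append_Nil moves_Cons a
    by (intro iffI; elim exE conjE; hypsubst; intro exI conjI; (assumption | rule refl))
qed

lemma tape_kinds_read:
  assumes "ks \<in> set (tape_kinds c B a b)" "moves N w ks (tape_vertex c B S (p, t)) U"
  shows "t p = a"
proof -
  obtain k1 k2 z ls rs where ks: "ks = [k1, k2, Edge (code a) z] @ ls @ rs" "length ls = c" "length rs = c"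
    using assms(1) by (cases b; cases "snd b") (auto simp: tape_kinds_def Let_def)
  have "code (t p) = code a"
    using assms(2) unfolding ks(1) tape_vertex_def prod.case moves_split[OF ks(2,3)] by auto
  then show ?thesis by (simp add: code_inj)
qed

text \<open>The kind \<open>k1\<close> of the position is left open, since two cases keep the head
  in place: the move \<open>Stay\<close>, and a left move on the leftmost cell.\<close>

lemma stay_moves:
  assumes "valid_tape (p, t)" "t p = a" "valid_tape (p, t(p := a'))"
    and k1: "\<And>y. (p, y) \<in> set (kind_edges N w k1) \<longleftrightarrow> y = p"
  shows "moves N w ([k1, Keep, Edge (code a) (code a')] @ replicate c Keep @ replicate c Keep)
      (tape_vertex c B S (p, t)) U \<longleftrightarrow> U = tape_vertex c B S (p, t(p := a'))"
proof -
  have t: "\<forall>i. code (t i) < B" "p < S" using assms(1) by (auto simp: valid_tape_def)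
  have "p mod c < N" using c by (meson less_le_trans mod_less_divisor zero_less_one)
  have le: "left_stack c B (t(p := a')) j p = left_stack c B t j p" for j by (rule left_stack_cong) simp
  have re: "right_stack c B (t(p := a')) j (Suc p) d = right_stack c B t j (Suc p) d" for j d
    by (rule right_stack_cong) simp
  have l: "moves N w (replicate c Keep) (map (\<lambda>j. left_stack c B t j p) [0..<c]) u \<longleftrightarrow>
      u = map (\<lambda>j. left_stack c B (t(p := a')) j p) [0..<c]" for u
    using left_less[OF t(1)] t(2) by (subst replicate_moves_keep) (auto simp: le)
  have r: "moves N w (replicate c Keep) (map (\<lambda>j. right_stack c B t j (Suc p) (S - Suc p)) [0..<c]) u \<longleftrightarrow>
      u = map (\<lambda>j. right_stack c B (t(p := a')) j (Suc p) (S - Suc p)) [0..<c]" for u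
    using right_less[OF t(1)] t(2) by (subst replicate_moves_keep) (auto simp: re)
  show ?thesis
    unfolding tape_vertex_def prod.case moves_split[OF length_replicate length_replicate] l r
    using t(2) S assms(2) \<open>p mod c < N\<close> by (auto simp: k1 lin_edges_iff)
qed

text \<open>Exactly one guess survives: the residue coordinate forces \<open>j = p mod c\<close>,
  and the popped digit forces \<open>z\<close> to be the content of the next cell.\<close>

lemma right_moves:
  assumes "valid_tape (p, t)" "t p = a" "valid_tape (Suc p, t(p := a'))"
  shows "(\<exists>j z. j < c \<and> z < B \<and> moves N w ([Incr, Edge j (Suc j mod c), Edge (code a) z] @
        (replicate c Keep)[j := Push B (code a')] @ (replicate c Keep)[Suc j mod c := Pop B z])
      (tape_vertex c B S (p, t)) U) \<longleftrightarrow> U = tape_vertex c B S (Suc p, t(p := a'))"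
proof -
  let ?t = "t(p := a')"
  let ?k = "p mod c"
  let ?k' = "Suc p mod c"
  have t: "\<forall>i. code (t i) < B" and p: "Suc p < S" and t': "\<forall>i. code (?t i) < B"
    using assms(1,3) by (auto simp: valid_tape_def)
  have B1: "1 \<le> B" using spec[OF t(1), of 0] by simp
  have k: "?k < c" "?k' < c" and k': "Suc ?k mod c = ?k'" using c by (auto simp: mod_Suc_eq)
  have le: "left_stack c B ?t j p = left_stack c B t j p" for j by (rule left_stack_cong) simp
  have re: "right_stack c B t j i d = right_stack c B ?t j i d" if "Suc p \<le> i" for i j d
    by (rule right_stack_cong) (use that in auto)
  obtain d where d: "S - Suc p = Suc d" "S - Suc (Suc p) = d"
    using p by (metis Suc_diff_Suc)
  have l: "moves N w ((replicate c Keep)[?k := Push B (code a')]) (map (\<lambda>j. left_stack c B t j p) [0..<c]) u \<longleftrightarrow>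
      u = map (\<lambda>j. left_stack c B ?t j (Suc p)) [0..<c]" for u
  proof -
    \<comment> \<open>A push has an edge only if its result is below \<open>N\<close>. The result is
      the left stack of the target, for which the bound is known.\<close>
    have "left_stack c B ?t ?k (Suc p) < N" by (rule left_less[OF t']) (use p in simp)
    then have "B * left_stack c B t ?k p + code a' < N" by (simp add: le)
    moreover have "(map (\<lambda>j. left_stack c B t j p) [0..<c])[?k := B * left_stack c B t ?k p + code a'] =
        map (\<lambda>j. left_stack c B ?t j (Suc p)) [0..<c]"
      using le k(1) by (subst upd_map) auto
    ultimately show ?thesis
      using left_less[OF t] p k(1) B1 by (subst replicate_moves) (auto simp: lin_edges_iff)
  qed
  have r: "moves N w ((replicate c Keep)[?k' := Pop B z]) (map (\<lambda>j. right_stack c B t j (Suc p) (S - Suc p)) [0..<c]) u \<longleftrightarrow>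
      z = code (?t (Suc p)) \<and> u = map (\<lambda>j. right_stack c B ?t j (Suc (Suc p)) (S - Suc (Suc p))) [0..<c]"
    if z: "z < B" for u z
  proof -
    let ?x = "right_stack c B t ?k' (Suc p) (S - Suc p)"
    have x: "?x = B * right_stack c B ?t ?k' (Suc (Suc p)) d + code (?t (Suc p))" by (simp add: d re)
    have xN: "?x < N" by (rule right_less[OF t]) (use p in simp)
    \<comment> \<open>Division with remainder by \<open>B\<close> determines both the digit popped
      and the rest of the stack.\<close>
    have "?x = B * y + z \<longleftrightarrow> z = code (?t (Suc p)) \<and> y = right_stack c B ?t ?k' (Suc (Suc p)) d" for y
    proof
      assume *: "?x = B * y + z"
      then have "?x mod B = z" "?x div B = y" using z by auto
      then show "z = code (?t (Suc p)) \<and> y = right_stack c B ?t ?k' (Suc (Suc p)) d"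
        using x spec[OF t', of "Suc p"] by auto
    qed (use x in simp)
    moreover have "(map (\<lambda>j. right_stack c B t j (Suc p) (S - Suc p)) [0..<c])[?k' := right_stack c B ?t ?k' (Suc (Suc p)) d]
        = map (\<lambda>j. right_stack c B ?t j (Suc (Suc p)) (S - Suc (Suc p))) [0..<c]"
      using k(2) by (subst upd_map) (auto simp: d re)
    ultimately show ?thesis
      using right_less[OF t, of "Suc p" "S - Suc p"] p k(2) B1 xN
      by (subst replicate_moves) (auto simp: lin_edges_iff)
  qed
  have ls: "length ((replicate c Keep)[j := k]) = c" for j k by simp
  show ?thesis
    unfolding tape_vertex_def prod.case moves_split[OF ls ls]
  proof (intro iffI, goal_cases)
    case 1
    then obtain j z y1 y2 y3 u u' where U: "U = [y1, y2, y3] @ u @ u'" "z < B"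
      "(p, y1) \<in> set (kind_edges N w Incr)" "(p mod c, y2) \<in> set (kind_edges N w (Edge j (Suc j mod c)))"
      "(code (t p), y3) \<in> set (kind_edges N w (Edge (code a) z))" and
      m: "moves N w ((replicate c Keep)[j := Push B (code a')]) (map (\<lambda>j. left_stack c B t j p) [0..<c]) u"
       "moves N w ((replicate c Keep)[Suc j mod c := Pop B z]) (map (\<lambda>j. right_stack c B t j (Suc p) (S - Suc p)) [0..<c]) u'"
      by blast
    have j: "j = ?k" "Suc j mod c = ?k'" "y2 = ?k'" using U(4) k' by auto
    have "y1 = Suc p" "y3 = z" using U(3,5) by (auto simp: lin_edges_iff)
    then show ?case
      using U(1) m[unfolded j(1) k'] j(3) l r[OF U(2)] by simp
  next
    case 2
    show ?case
    proof (intro exI conjI)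
      show "?k < c" "code (?t (Suc p)) < B" using k spec[OF t'] by blast+
      show "moves N w ((replicate c Keep)[?k := Push B (code a')]) (map (\<lambda>j. left_stack c B t j p) [0..<c])
          (map (\<lambda>j. left_stack c B ?t j (Suc p)) [0..<c])" using l by blast
      show "moves N w ((replicate c Keep)[Suc ?k mod c := Pop B (code (?t (Suc p)))])
          (map (\<lambda>j. right_stack c B t j (Suc p) (S - Suc p)) [0..<c])
          (map (\<lambda>j. right_stack c B ?t j (Suc (Suc p)) (S - Suc (Suc p))) [0..<c])"
        unfolding k' using r[OF spec[OF t']] by blast
    qed (use 2 k' assms(2) p S in \<open>auto simp: lin_edges_iff\<close>)
  qed
qed

text \<open>The residue of the head determines that of the cell to its left, as the cyclic successor
  is injective on residues. This makes the guess of \<open>j\<close> unique in left moves.\<close>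

lemma Suc_mod_inj: "j < c \<Longrightarrow> Suc j mod c = Suc q mod c \<Longrightarrow> j = q mod c"
  by (auto simp: mod_Suc split: if_splits)

lemma left_moves:
  assumes "valid_tape (Suc q, t)" "t (Suc q) = a" "valid_tape (q, t(Suc q := a'))"
  shows "(\<exists>j z. j < c \<and> z < B \<and> moves N w ([Decr, Edge (Suc j mod c) j, Edge (code a) z] @
        (replicate c Keep)[j := Pop B z] @ (replicate c Keep)[Suc j mod c := Push B (code a')])
      (tape_vertex c B S (Suc q, t)) U) \<longleftrightarrow> U = tape_vertex c B S (q, t(Suc q := a'))"
proof -
  let ?t = "t(Suc q := a')"
  let ?k = "q mod c"
  let ?k' = "Suc q mod c"
  have t: "\<forall>i. code (t i) < B" and p: "Suc q < S" and t': "\<forall>i. code (?t i) < B"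
    using assms(1,3) by (auto simp: valid_tape_def)
  have B1: "1 \<le> B" using spec[OF t(1), of 0] by simp
  have k: "?k < c" "?k' < c" and k': "Suc ?k mod c = ?k'" using c by (auto simp: mod_Suc_eq)
  have le: "left_stack c B ?t j q = left_stack c B t j q" for j by (rule left_stack_cong) simp
  have re: "right_stack c B ?t j i d = right_stack c B t j i d" if "Suc (Suc q) \<le> i" for i j d
    by (rule right_stack_cong) (use that in auto)
  obtain d where d: "S - Suc q = Suc d" "S - Suc (Suc q) = d"
    using p by (metis Suc_diff_Suc)
  have r: "moves N w ((replicate c Keep)[?k' := Push B (code a')])
       (map (\<lambda>j. right_stack c B t j (Suc (Suc q)) (S - Suc (Suc q))) [0..<c]) u \<longleftrightarrow>
      u = map (\<lambda>j. right_stack c B ?t j (Suc q) (S - Suc q)) [0..<c]" for u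
  proof -
    have "right_stack c B ?t ?k' (Suc q) (S - Suc q) < N" by (rule right_less[OF t']) (use p in simp)
    then have "B * right_stack c B t ?k' (Suc (Suc q)) (S - Suc (Suc q)) + code a' < N" by (simp add: d re)
    moreover have "(map (\<lambda>j. right_stack c B t j (Suc (Suc q)) (S - Suc (Suc q))) [0..<c])
         [?k' := B * right_stack c B t ?k' (Suc (Suc q)) (S - Suc (Suc q)) + code a'] =
        map (\<lambda>j. right_stack c B ?t j (Suc q) (S - Suc q)) [0..<c]"
      using k(2) by (subst upd_map) (auto simp: d re)
    ultimately show ?thesis
      using right_less[OF t] p k(2) B1 by (subst replicate_moves) (auto simp: lin_edges_iff)
  qed
  have l: "moves N w ((replicate c Keep)[?k := Pop B z]) (map (\<lambda>j. left_stack c B t j (Suc q)) [0..<c]) u \<longleftrightarrow>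
      z = code (?t q) \<and> u = map (\<lambda>j. left_stack c B ?t j q) [0..<c]"
    if z: "z < B" for u z
  proof -
    let ?x = "left_stack c B t ?k (Suc q)"
    have x: "?x = B * left_stack c B ?t ?k q + code (?t q)" by (simp add: le)
    have xN: "?x < N" by (rule left_less[OF t]) (use p in simp)
    have "?x = B * y + z \<longleftrightarrow> z = code (?t q) \<and> y = left_stack c B ?t ?k q" for y
    proof
      assume *: "?x = B * y + z"
      then have "?x mod B = z" "?x div B = y" using z by auto
      then show "z = code (?t q) \<and> y = left_stack c B ?t ?k q"
        using x spec[OF t', of q] by auto
    qed (use x in simp)
    moreover have "(map (\<lambda>j. left_stack c B t j (Suc q)) [0..<c])[?k := left_stack c B ?t ?k q]
        = map (\<lambda>j. left_stack c B ?t j q) [0..<c]"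
      using k(1) by (subst upd_map) (auto simp: le)
    ultimately show ?thesis
      using left_less[OF t, of "Suc q"] p k(1) B1 xN
      by (subst replicate_moves) (auto simp: lin_edges_iff simp del: left_stack.simps)
  qed
  have ls: "length ((replicate c Keep)[j := k]) = c" for j k by simp
  show ?thesis
    unfolding tape_vertex_def prod.case moves_split[OF ls ls]
  proof (intro iffI, goal_cases)
    case 1
    then obtain j z y1 y2 y3 u u' where U: "U = [y1, y2, y3] @ u @ u'" "z < B"
      "(Suc q, y1) \<in> set (kind_edges N w Decr)" "(Suc q mod c, y2) \<in> set (kind_edges N w (Edge (Suc j mod c) j))"
      "(code (t (Suc q)), y3) \<in> set (kind_edges N w (Edge (code a) z))" "j < c" and
      m: "moves N w ((replicate c Keep)[j := Pop B z]) (map (\<lambda>j. left_stack c B t j (Suc q)) [0..<c]) u"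
       "moves N w ((replicate c Keep)[Suc j mod c := Push B (code a')])
         (map (\<lambda>j. right_stack c B t j (Suc (Suc q)) (S - Suc (Suc q))) [0..<c]) u'"
      by blast
    have *: "Suc j mod c = ?k'" "y2 = j" using U(4) by auto
    have "j = ?k" by (rule Suc_mod_inj[OF U(6) *(1)])
    with * have j: "j = ?k" "y2 = ?k" by simp_all
    have "y1 = q" "y3 = z" using U(3,5) by (auto simp: lin_edges_iff)
    then show ?case
      using U(1) m[unfolded j(1) k'] j(2) r l[OF U(2)] by simp
  next
    case 2
    show ?case
    proof (intro exI conjI)
      show "?k < c" "code (?t q) < B" using k spec[OF t'] by blast+
      show "moves N w ((replicate c Keep)[?k := Pop B (code (?t q))]) (map (\<lambda>j. left_stack c B t j (Suc q)) [0..<c])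
          (map (\<lambda>j. left_stack c B ?t j q) [0..<c])" using l[OF spec[OF t']] by blast
      show "moves N w ((replicate c Keep)[Suc ?k mod c := Push B (code a')])
          (map (\<lambda>j. right_stack c B t j (Suc (Suc q)) (S - Suc (Suc q))) [0..<c])
          (map (\<lambda>j. right_stack c B ?t j (Suc q) (S - Suc q)) [0..<c])"
        unfolding k' using r by blast
    qed (use 2 k' assms(2) p S in \<open>auto simp: lin_edges_iff\<close>)
  qed
qed

lemma ex_comprehension:
  "(\<exists>x \<in> set [f j z. j \<leftarrow> [0..<m], z \<leftarrow> [0..<n]]. P x) \<longleftrightarrow> (\<exists>j z. j < m \<and> z < n \<and> P (f j z))"
proof -
  have set: "set [f j z. j \<leftarrow> [0..<m], z \<leftarrow> [0..<n]] = {f j z | j z. j < m \<and> z < n}" by fastforce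
  show ?thesis unfolding set by auto
qed

lemma tape_moves:
  assumes "valid_tape (p, t)" "t p = a" "valid_tape (act (a', d) (p, t))"
  shows "(\<exists>ks \<in> set (tape_kinds c B a (a', d)). moves N w ks (tape_vertex c B S (p, t)) U) \<longleftrightarrow>
    U = tape_vertex c B S (act (a', d) (p, t))"
proof (cases d)
  case Stay
  have "(p, y) \<in> set (kind_edges N w Keep) \<longleftrightarrow> y = p" for y
    using assms(1) S by (auto simp: lin_edges_iff valid_tape_def)
  then show ?thesis
    using stay_moves[OF assms(1,2), of a' Keep U] assms(3) Stay by (simp add: tape_kinds_def Let_def)
next
  case Go_Right
  have "(\<exists>ks \<in> set (tape_kinds c B a (a', d)). P ks) \<longleftrightarrow> (\<exists>j z. j < c \<and> z < B \<and>
      P ([Incr, Edge j (Suc j mod c), Edge (code a) z] @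
        (replicate c Keep)[j := Push B (code a')] @ (replicate c Keep)[Suc j mod c := Pop B z]))" for P
    unfolding tape_kinds_def Let_def Go_Right prod.case move.case by (rule ex_comprehension)
  then show ?thesis
    using right_moves[OF assms(1,2), of a' U] assms(3) Go_Right by simp
next
  case Go_Left
  have *: "(\<exists>ks \<in> set (tape_kinds c B a (a', d)). P ks) \<longleftrightarrow>
      P ([Edge 0 0, Keep, Edge (code a) (code a')] @ replicate c Keep @ replicate c Keep) \<or>
      (\<exists>j z. j < c \<and> z < B \<and> P ([Decr, Edge (Suc j mod c) j, Edge (code a) z] @
        (replicate c Keep)[j := Pop B z] @ (replicate c Keep)[Suc j mod c := Push B (code a')]))" for P
    unfolding tape_kinds_def Let_def Go_Left prod.case move.case list.set bex_simps ex_comprehension ..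
  \<comment> \<open>\<open>Decr\<close> has no edge out of \<open>0\<close>, and
    \<open>Edge 0 0\<close> has none out of a positive position; so the two forms of a left move
    exclude each other.\<close>
  show ?thesis
  proof (cases p)
    case 0
    have "\<not> moves N w ([Decr, k2, k3] @ ks) (tape_vertex c B S (0, t)) U" for k2 k3 ks
      by (auto simp: tape_vertex_def moves_Cons lin_edges_iff)
    then show ?thesis
      unfolding * using stay_moves[of 0 t a a' "Edge 0 0" U] assms 0 Go_Left by simp
  next
    case (Suc q)
    have "\<not> moves N w ([Edge 0 0, k2, k3] @ ks) (tape_vertex c B S (Suc q, t)) U" for k2 k3 ks
      by (auto simp: tape_vertex_def moves_Cons)
    then show ?thesis
      unfolding * using left_moves[of q t a a' U] assms Suc Go_Left by simp
  qed
qed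

end


text \<open>When the head moves left, the edges are listed by their target, one cell before the symbol read.\<close>

fun input_kind :: "symbol \<Rightarrow> move \<Rightarrow> kind" where
  "input_kind a Stay = Lin 1 0 False 0 {a}"
| "input_kind a Go_Right = Lin 1 1 False 0 {a}"
| "input_kind a Go_Left = Lin 1 1 True 1 {a}"

section \<open>The factored graph of a machine\<close>

text \<open>The tapes guess independently, hence one tensor product for each combination of their
  alternatives. How many there are depends on the rule, \<open>c\<close> and \<open>B\<close>, but
  not on the word.\<close>

definition rule_kinds :: "nat \<Rightarrow> nat \<Rightarrow> rule \<Rightarrow> kind list list" where
  "rule_kinds c B r = [[Edge (from_state r) (to_state r), input_kind (input_read r) (input_move r)] @ concat kss.
     kss \<leftarrow> product_lists (map2 (tape_kinds c B) (work_read r) (work_action r))]"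

definition vertex_dim :: "nat \<Rightarrow> tm \<Rightarrow> nat" where
  "vertex_dim c M = 2 + tapes M * (3 + 2 * c)"

text \<open>In the accepting state every other coordinate may be decreased, so that one target suffices.\<close>

definition cleanup_kinds :: "nat \<Rightarrow> tm \<Rightarrow> kind list list" where
  "cleanup_kinds c M = [(Edge (accept_state M) (accept_state M) # replicate (vertex_dim c M - 1) Keep)[i := Decr].
     i \<leftarrow> [1..<vertex_dim c M]]"

definition machine_kinds :: "nat \<Rightarrow> nat \<Rightarrow> tm \<Rightarrow> rule list \<Rightarrow> kind list list" where
  "machine_kinds c B M rs = concat (map (rule_kinds c B) rs) @ cleanup_kinds c M"

lemma list_all2_concat_length:
  "list_all2 (\<lambda>ks kss. ks \<in> set kss) kss ksss \<Longrightarrow> (\<And>kss ks. kss \<in> set ksss \<Longrightarrow> ks \<in> set kss \<Longrightarrow> length ks = m) \<Longrightarrow>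
   length (concat kss) = length ksss * m"
proof (induction rule: list_all2_induct)
  case (Cons x xs y ys)
  have "length x = m" using Cons.hyps(1) Cons.prems[of y x] by simp
  moreover have "length (concat xs) = length ys * m" by (rule Cons.IH) (use Cons.prems in auto)
  ultimately show ?case by simp
qed simp

lemma length_machine_kinds:
  assumes "wf_tm M" "set rs = rules M" "ks \<in> set (machine_kinds c B M rs)"
  shows "length ks = vertex_dim c M"
proof -
  have "length ks = vertex_dim c M" if r: "r \<in> rules M" and ks: "ks \<in> set (rule_kinds c B r)" for r
  proof -
    let ?l = "map2 (tape_kinds c B) (work_read r) (work_action r)"
    obtain kss where kss: "list_all2 (\<lambda>x ys. x \<in> set ys) kss ?l" "length ks = 2 + length (concat kss)"
      using ks by (auto simp: rule_kinds_def product_lists_set)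
    have "length (concat kss) = length ?l * (3 + 2 * c)"
      by (rule list_all2_concat_length[OF kss(1)]) (auto intro: length_tape_kinds)
    moreover have "length ?l = tapes M" using assms(1) r by (simp add: wf_tm_def)
    ultimately show ?thesis using kss(2) by (simp add: vertex_dim_def)
  qed
  moreover have "length ks = vertex_dim c M" if ks: "ks \<in> set (cleanup_kinds c M)"
  proof -
    obtain i where "ks = (Edge (accept_state M) (accept_state M) # replicate (vertex_dim c M - 1) Keep)[i := Decr]"
      using ks by (auto simp: cleanup_kinds_def)
    then show ?thesis by (simp only: length_list_update) (simp add: vertex_dim_def)
  qed
  ultimately show ?thesis using assms(2,3) by (auto simp: machine_kinds_def)
qed

text \<open>Even a machine without rules has clean-up edges, because the input position is a
  coordinate besides the state.\<close>

lemma machine_kinds_nonempty: "machine_kinds c B M rs \<noteq> []"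
  by (simp add: machine_kinds_def cleanup_kinds_def vertex_dim_def)

lemma wf_tape_kinds:
  assumes "ks \<in> set (tape_kinds c B a b)" "k \<in> set ks" "code a < N" "code (fst b) < N" "1 \<le> c" "c \<le> N" "0 < B" "B \<le> N"
  shows "wf_kind N k"
proof -
  have c: "Suc j mod c < N" for j
    using assms(5,6) by (meson less_le_trans mod_less_divisor zero_less_one)
  show ?thesis
    using assms c by (cases b; cases "snd b")
      (auto simp: tape_kinds_def Let_def dest!: subsetD[OF set_update_subset_insert] split: if_splits)
qed

definition source_vertex :: "nat \<Rightarrow> tm \<Rightarrow> nat list" where
  "source_vertex c M = start_state M # replicate (vertex_dim c M - 1) 0"

definition target_vertex :: "nat \<Rightarrow> tm \<Rightarrow> nat list" where
  "target_vertex c M = accept_state M # replicate (vertex_dim c M - 1) 0"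

section \<open>Paths in the instance and accepting computations\<close>

locale nl_instance = stack_encoding c B S N w for c B S N w +
  fixes M :: tm and rs :: "rule list"
  assumes wf: "wf_tm M" and rs: "set rs = rules M" and space: "space_within M w S"
    and N: "length w + 2 \<le> N" and B0: "0 < B"
    and states: "\<And>r. r \<in> rules M \<Longrightarrow> from_state r < N \<and> to_state r < N" "start_state M < N" "accept_state M < N"
    and codes: "\<And>r x. r \<in> rules M \<Longrightarrow> x \<in> set (work_action r) \<Longrightarrow> code (fst x) < B"
      "\<And>r a. r \<in> rules M \<Longrightarrow> a \<in> set (work_read r) \<Longrightarrow> code a < B"
begin

abbreviation source :: "nat list" where "source \<equiv> source_vertex c M"

abbreviation target :: "nat list" where "target \<equiv> target_vertex c M"

abbreviation vertex :: "tape \<Rightarrow> nat list" where "vertex \<equiv> tape_vertex c B S"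

definition config_vertex :: "config \<Rightarrow> nat list" where
  "config_vertex cf = [state cf, input_pos cf] @ concat (map vertex (work cf))"

definition tapes_move :: "symbol list \<Rightarrow> (symbol \<times> move) list \<Rightarrow> nat list \<Rightarrow> nat list \<Rightarrow> bool" where
  "tapes_move rd wa v u \<longleftrightarrow>
     (\<exists>kss. list_all2 (\<lambda>x ys. x \<in> set ys) kss (map2 (tape_kinds c B) rd wa) \<and> moves N w (concat kss) v u)"

lemma tapes_move_Nil: "tapes_move [] [] [] u \<longleftrightarrow> u = []"
  by (cases u) (auto simp: tapes_move_def)

lemma tapes_move_Cons:
  "tapes_move (a # rd) (b # wa) (vertex T @ v) U \<longleftrightarrow>
    (\<exists>u u'. U = u @ u' \<and> (\<exists>ks \<in> set (tape_kinds c B a b). moves N w ks (vertex T) u) \<and> tapes_move rd wa v u')"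
  (is "?L \<longleftrightarrow> ?R")
proof
  assume ?L
  then obtain ks kss where *: "ks \<in> set (tape_kinds c B a b)"
    "list_all2 (\<lambda>x ys. x \<in> set ys) kss (map2 (tape_kinds c B) rd wa)" "moves N w (ks @ concat kss) (vertex T @ v) U"
    by (auto simp: tapes_move_def list_all2_Cons2)
  then show ?R
    using moves_append[of "vertex T" ks N w "concat kss" v U] length_tape_kinds[OF *(1)] length_tape_vertex
    unfolding tapes_move_def by metis
next
  assume ?R
  then obtain u u' ks kss where *: "U = u @ u'" "ks \<in> set (tape_kinds c B a b)" "moves N w ks (vertex T) u"
    "list_all2 (\<lambda>x ys. x \<in> set ys) kss (map2 (tape_kinds c B) rd wa)" "moves N w (concat kss) v u'"
    unfolding tapes_move_def by blast
  then have "moves N w (concat (ks # kss)) (vertex T @ v) U"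
    using moves_append[of "vertex T" ks N w "concat kss" v U] length_tape_kinds[OF *(2)] length_tape_vertex
    by auto
  then show ?L using * unfolding tapes_move_def by (intro exI[of _ "ks # kss"]) simp
qed

lemma tapes_read:
  assumes "length rd = length wa" "length wa = length ts" "tapes_move rd wa (concat (map vertex ts)) U"
  shows "rd = map (\<lambda>(p, t). t p) ts"
  using assms
proof (induction rd wa ts arbitrary: U rule: list_induct3)
  case (Cons a rd b wa T ts)
  obtain p t where T: "T = (p, t)" by (cases T)
  from Cons.prems obtain u u' ks where "ks \<in> set (tape_kinds c B a b)" "moves N w ks (vertex T) u"
    "tapes_move rd wa (concat (map vertex ts)) u'"
    by (auto simp: tapes_move_Cons)
  then show ?case using Cons.IH tape_kinds_read[of ks a b p t u] T by auto
qed simp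

lemma tapes_step:
  assumes "length rd = length wa" "length wa = length ts" "rd = map (\<lambda>(p, t). t p) ts"
    "\<forall>T \<in> set ts. valid_tape T" "\<forall>T \<in> set (map2 act wa ts). valid_tape T"
  shows "tapes_move rd wa (concat (map vertex ts)) U \<longleftrightarrow> U = concat (map vertex (map2 act wa ts))"
  using assms
proof (induction rd wa ts arbitrary: U rule: list_induct3)
  case Nil
  then show ?case by (simp add: tapes_move_Nil)
next
  case (Cons a rd b wa T ts)
  obtain p t where T: "T = (p, t)" by (cases T)
  obtain a' d where b: "b = (a', d)" by (cases b)
  have "(\<exists>ks \<in> set (tape_kinds c B a b). moves N w ks (vertex T) u) \<longleftrightarrow> u = vertex (act b T)" for u
    unfolding T b using Cons.prems T b by (intro tape_moves) auto
  moreover have "tapes_move rd wa (concat (map vertex ts)) u' \<longleftrightarrow> u' = concat (map vertex (map2 act wa ts))" for u'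
    using Cons.prems by (intro Cons.IH) auto
  ultimately show ?case by (simp add: tapes_move_Cons)
qed

lemma input_kind_moves:
  assumes "r \<in> rules M" "p \<le> length w + 1"
  shows "(p, y) \<in> set (kind_edges N w (input_kind (input_read r) (input_move r))) \<longleftrightarrow>
    input_read r = input_symbol w p \<and> y = shift (input_move r) p"
proof -
  \<comment> \<open>This excludes the two critical moves: left from position 0, where
    \<open>shift\<close> would truncate, and right from \<open>length w + 1\<close>, where the
    target might not be a vertex.\<close>
  have "input_read r = Left_End \<longrightarrow> input_move r \<noteq> Go_Left" "input_read r = Right_End \<longrightarrow> input_move r \<noteq> Go_Right"
    using wf assms(1) by (auto simp: wf_tm_def)
  then show ?thesis using assms(2) N
    by (cases "input_move r"; cases p) (auto simp: lin_edges_iff input_symbol_def split: if_splits)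
qed

lemma rule_moves:
  "(\<exists>ks \<in> set (rule_kinds c B r). moves N w ks (config_vertex cf) U) \<longleftrightarrow>
    (\<exists>y u. U = to_state r # y # u \<and> from_state r = state cf \<and>
       (input_pos cf, y) \<in> set (kind_edges N w (input_kind (input_read r) (input_move r))) \<and>
       tapes_move (work_read r) (work_action r) (concat (map vertex (work cf))) u)"
  (is "?L \<longleftrightarrow> ?R")
proof -
  have "?L \<longleftrightarrow> (\<exists>kss. list_all2 (\<lambda>x ys. x \<in> set ys) kss (map2 (tape_kinds c B) (work_read r) (work_action r)) \<and>
      moves N w ([Edge (from_state r) (to_state r), input_kind (input_read r) (input_move r)] @ concat kss) (config_vertex cf) U)"
    by (auto simp: rule_kinds_def product_lists_set)
  also have "\<dots> \<longleftrightarrow> ?R"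
    unfolding tapes_move_def config_vertex_def append_Cons append_Nil moves_Cons by auto
  finally show ?thesis .
qed

definition reached :: "config \<Rightarrow> bool" where
  "reached cf \<longleftrightarrow> (step M w)\<^sup>*\<^sup>* (init M) cf"

text \<open>The space bound speaks of reachable configurations only; this is why steps and edges are
  compared for these alone. The digits are below \<open>B\<close> because a cell holds a blank or a
  symbol written by some rule.\<close>

lemma reached_inv:
  assumes "reached cf"
  shows "length (work cf) = tapes M" "input_pos cf \<le> length w + 1" "state cf < N" "\<forall>T \<in> set (work cf). valid_tape T"
proof -
  have "length (work cf) = tapes M \<and> input_pos cf \<le> length w + 1 \<and> state cf < N \<and>
    (\<forall>T \<in> set (work cf). \<forall>i. code (snd T i) < B)"
    using assms unfolding reached_def
  proof (induction rule: rtranclp_induct)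
    case base
    then show ?case using states B0 by (auto simp: init_def)
  next
    case (step cf cf')
    then obtain r where r: "r \<in> rules M" "state cf' = to_state r" "work cf' = map2 act (work_action r) (work cf)"
      unfolding step_def by auto
    have "length (work_action r) = tapes M" using wf r(1) by (simp add: wf_tm_def)
    moreover have "code (snd T i) < B" if T: "T \<in> set (work cf')" for T i
    proof -
      obtain z where z: "z \<in> set (zip (work_action r) (work cf))" "T = act (fst z) (snd z)"
        using T unfolding r(3) by (auto simp del: act.simps simp: case_prod_beta)
      then have "fst z \<in> set (work_action r)" "snd z \<in> set (work cf)"
        by (metis prod.collapse set_zip_leftD, metis z(1) prod.collapse set_zip_rightD)
      with z(2) show ?thesis using codes(1)[OF r(1)] step.IH by (auto simp: act_eq)
    qed
    ultimately show ?case
      using r states(1) step.IH input_pos_step[OF wf step.hyps(2)] by auto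
  qed
  moreover have "\<forall>T \<in> set (work cf). fst T < S"
    using space assms unfolding space_within_def reached_def by fastforce
  ultimately show "length (work cf) = tapes M" "input_pos cf \<le> length w + 1" "state cf < N" "\<forall>T \<in> set (work cf). valid_tape T"
    by (auto simp: valid_tape_def)
qed

lemma reached_step: "reached cf \<Longrightarrow> step M w cf cf' \<Longrightarrow> reached cf'"
  unfolding reached_def by simp

lemma machine_moves:
  assumes "reached cf" "r \<in> rules M"
  shows "(\<exists>ks \<in> set (rule_kinds c B r). moves N w ks (config_vertex cf) U) \<longleftrightarrow>
    from_state r = state cf \<and> input_read r = input_symbol w (input_pos cf) \<and>
    work_read r = map (\<lambda>(p, t). t p) (work cf) \<and>
    U = config_vertex \<lparr>state = to_state r, input_pos = shift (input_move r) (input_pos cf),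
              work = map2 act (work_action r) (work cf)\<rparr>"
  (is "?L \<longleftrightarrow> ?A \<and> ?B \<and> ?C \<and> U = config_vertex ?cf'")
proof -
  note inv = reached_inv[OF assms(1)]
  have len: "length (work_read r) = length (work_action r)" "length (work_action r) = length (work cf)"
    using wf assms(2) inv(1) by (auto simp: wf_tm_def)
  show ?thesis
  proof (cases "?A \<and> ?B \<and> ?C")
    case True
    \<comment> \<open>The successor is reachable too, so its tapes are valid and the pushed stacks
      remain below \<open>N\<close>.\<close>
    then have "step M w cf ?cf'" using assms(2) unfolding step_def by blast
    then have "\<forall>T \<in> set (map2 act (work_action r) (work cf)). valid_tape T"
      using reached_inv(4)[OF reached_step[OF assms(1)]] by simp
    then have "tapes_move (work_read r) (work_action r) (concat (map vertex (work cf))) u \<longleftrightarrow>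
        u = concat (map vertex (map2 act (work_action r) (work cf)))" for u
      using tapes_step[OF len] True inv(4) by blast
    then show ?thesis
      using True unfolding rule_moves input_kind_moves[OF assms(2) inv(2)] by (auto simp: config_vertex_def)
  next
    case False
    then show ?thesis
      unfolding rule_moves input_kind_moves[OF assms(2) inv(2)] using tapes_read[OF len] by blast
  qed
qed

lemma config_vertex_in:
  assumes "reached cf"
  shows "length (config_vertex cf) = vertex_dim c M" "set (config_vertex cf) \<subseteq> {..<N}"
proof -
  note inv = reached_inv[OF assms]
  have "length (concat (map vertex ts)) = length ts * (3 + 2 * c)" for ts
    by (induction ts) (auto simp: length_tape_vertex)
  then show "length (config_vertex cf) = vertex_dim c M"
    using inv(1) by (simp add: config_vertex_def vertex_dim_def)
  show "set (config_vertex cf) \<subseteq> {..<N}"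
    using inv N tape_vertex_bound by (auto simp: config_vertex_def)
qed

lemma config_vertex_init: "config_vertex (init M) = source"
proof -
  have l: "left_stack c B (\<lambda>_. Blank) j p = 0" for j p by (induction p) auto
  have r: "right_stack c B (\<lambda>_. Blank) j p d = 0" for j p d by (induction d arbitrary: p) auto
  have "map (\<lambda>_. 0 :: nat) [0..<c] = replicate c 0" by (simp add: map_replicate_trivial)
  then have "vertex (0, \<lambda>_. Blank) = replicate (3 + 2 * c) 0"
    unfolding tape_vertex_def using l r
    by (simp add: replicate_add[symmetric] mult_2 numeral_3_eq_3)
  moreover have "concat (replicate m (replicate n (0 :: nat))) = replicate (m * n) 0" for m n
    by (induction m) (auto simp: replicate_add)
  ultimately show ?thesis by (simp add: config_vertex_def init_def source_vertex_def vertex_dim_def)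
qed

definition arc :: "nat list \<Rightarrow> nat list \<Rightarrow> bool" where
  "arc v u \<longleftrightarrow> (\<exists>ks \<in> set (machine_kinds c B M rs). moves N w ks v u)"

lemma arc_iff:
  "arc v u \<longleftrightarrow> (\<exists>r \<in> rules M. \<exists>ks \<in> set (rule_kinds c B r). moves N w ks v u) \<or>
    (\<exists>ks \<in> set (cleanup_kinds c M). moves N w ks v u)"
  unfolding arc_def machine_kinds_def rs[symmetric] by auto

lemma cleanup_moves:
  assumes "ks \<in> set (cleanup_kinds c M)" "moves N w ks v u"
  shows "hd v = accept_state M \<and> hd u = accept_state M"
proof -
  obtain i where "i \<ge> 1" "ks = (Edge (accept_state M) (accept_state M) # replicate (vertex_dim c M - 1) Keep)[i := Decr]"
    using assms(1) by (auto simp: cleanup_kinds_def)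
  then obtain i' where "ks = Edge (accept_state M) (accept_state M) # (replicate (vertex_dim c M - 1) Keep)[i' := Decr]"
    by (cases i) auto
  then show ?thesis using assms(2) by (cases v; cases u) auto
qed

text \<open>As long as rules are used, the path follows a computation. A clean-up edge requires the
  accepting state and preserves it, and since no rule leaves this state, the path cannot return from
  a cleaned-up tuple to the simulation.\<close>

lemma arcs_sound:
  assumes "arc\<^sup>*\<^sup>* source v"
  shows "(\<exists>cf. reached cf \<and> v = config_vertex cf) \<or> (hd v = accept_state M \<and> accepts M w)"
  using assms
proof (induction rule: rtranclp_induct)
  case base
  have "reached (init M)" by (simp add: reached_def)
  then show ?case using config_vertex_init by metis
next
  case (step v u)
  from step.hyps(2)[unfolded arc_iff] show ?case
  proof
    assume "\<exists>r \<in> rules M. \<exists>ks \<in> set (rule_kinds c B r). moves N w ks v u"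
    then obtain r ks where r: "r \<in> rules M" and ks: "ks \<in> set (rule_kinds c B r)" "moves N w ks v u" by blast
    from step.IH show ?thesis
    proof
      assume "\<exists>cf. reached cf \<and> v = config_vertex cf"
      then obtain cf where cf: "reached cf" "v = config_vertex cf" by blast
      with machine_moves[OF cf(1) r, of u] ks obtain cf' where "step M w cf cf'" "u = config_vertex cf'"
        unfolding step_def using r by blast
      then show ?thesis using reached_step[OF cf(1)] by blast
    next
      assume hd: "hd v = accept_state M \<and> accepts M w"
      obtain ks' where "ks = Edge (from_state r) (to_state r) # ks'" using ks(1) by (auto simp: rule_kinds_def)
      then have "hd v = from_state r" using ks(2) by (cases v; cases u) auto
      moreover have "from_state r \<noteq> accept_state M" using wf r unfolding wf_tm_def by blast
      ultimately show ?thesis using hd by simp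
    qed
  next
    assume "\<exists>ks \<in> set (cleanup_kinds c M). moves N w ks v u"
    then have hd: "hd v = accept_state M" "hd u = accept_state M" using cleanup_moves by blast+
    from step.IH have "accepts M w"
    proof
      assume "\<exists>cf. reached cf \<and> v = config_vertex cf"
      then show ?thesis using hd(1) unfolding accepts_def reached_def by (auto simp: config_vertex_def)
    qed simp
    then show ?thesis using hd by simp
  qed
qed

text \<open>Each edge lowers one coordinate by one, so the sum of the coordinates after the state
  decreases. The length of the path is immaterial.\<close>

lemma cleanup_reaches:
  assumes "length v = vertex_dim c M" "set v \<subseteq> {..<N}" "hd v = accept_state M"
  shows "arc\<^sup>*\<^sup>* v target"
  using assms
proof (induction "sum_list (tl v)" arbitrary: v rule: less_induct)
  case less
  have m: "0 < vertex_dim c M" by (simp add: vertex_dim_def)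
  then obtain x where v: "v = accept_state M # x" "length x = vertex_dim c M - 1"
    using less.prems by (cases v) auto
  show ?case
  proof (cases "\<exists>i < length x. x ! i \<noteq> 0")
    case False
    then have "x = replicate (vertex_dim c M - 1) 0"
      using v(2) by (intro nth_equalityI) auto
    then show ?thesis using v by (simp add: target_vertex_def)
  next
    case True
    then obtain i where i: "i < length x" "x ! i \<noteq> 0" by blast
    let ?x = "x[i := x ! i - 1]"
    let ?ks = "(replicate (vertex_dim c M - 1) Keep)[i := Decr]"
    have x: "set x \<subseteq> {..<N}" using less.prems v by auto
    have xi: "x ! i < N" using x i by (meson lessThan_iff nth_mem subsetD)
    have "(Edge (accept_state M) (accept_state M) # replicate (vertex_dim c M - 1) Keep)[Suc i := Decr] \<in> set (cleanup_kinds c M)"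
      unfolding cleanup_kinds_def set_map using i v(2) m by (intro image_eqI[OF refl]) auto
    moreover have "moves N w ?ks x ?x"
    proof -
      have "(x ! i, x ! i - 1) \<in> set (kind_edges N w Decr)" using i xi by (auto simp: lin_edges_iff)
      then show ?thesis
        using replicate_moves[of i "vertex_dim c M - 1" x N w Decr ?x] i(1) v(2) x by auto
    qed
    ultimately have "arc v (accept_state M # ?x)" unfolding arc_iff v(1)
      by (intro disjI2 bexI[of _ "Edge (accept_state M) (accept_state M) # ?ks"]) auto
    moreover have "arc\<^sup>*\<^sup>* (accept_state M # ?x) target"
    proof (rule less.hyps)
      have "sum_list ?x < sum_list x"
        using i by (simp add: sum_list_update elem_le_sum_list)
          (metis Suc_le_eq diff_Suc_1 diff_less elem_le_sum_list gr0_conv_Suc less_le_trans ordered_cancel_comm_monoid_diff_class.diff_add add_diff_cancel_right' zero_less_one)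
      then show "sum_list (tl (accept_state M # ?x)) < sum_list (tl v)" using v by simp
      show "set (accept_state M # ?x) \<subseteq> {..<N}"
        using x xi states(3) set_update_subset_insert[of x i "x ! i - 1"] by auto
    qed (use v m in auto)
    ultimately show ?thesis by (rule converse_rtranclp_into_rtranclp)
  qed
qed

lemma arcs_complete:
  assumes "accepts M w"
  shows "arc\<^sup>*\<^sup>* source target"
proof -
  obtain cf where cf: "(step M w)\<^sup>*\<^sup>* (init M) cf" "state cf = accept_state M"
    using assms unfolding accepts_def by blast
  have "arc\<^sup>*\<^sup>* source (config_vertex cf)"
    using cf(1)
  proof (induction rule: rtranclp_induct)
    case base
    then show ?case by (simp add: config_vertex_init)
  next
    case (step cf cf')
    then have r: "reached cf" by (simp add: reached_def)
    from step.hyps(2) have "arc (config_vertex cf) (config_vertex cf')"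
      unfolding step_def arc_iff using machine_moves[OF r] by blast
    then show ?case using step.IH by simp
  qed
  moreover have "arc\<^sup>*\<^sup>* (config_vertex cf) target"
    using config_vertex_in[of cf] cf by (intro cleanup_reaches) (auto simp: reached_def config_vertex_def)
  ultimately show ?thesis by simp
qed

lemma arcs_iff_accepts: "arc\<^sup>*\<^sup>* source target \<longleftrightarrow> accepts M w"
proof
  assume "arc\<^sup>*\<^sup>* source target"
  from arcs_sound[OF this] show "accepts M w"
    unfolding accepts_def reached_def by (auto simp: config_vertex_def target_vertex_def)
qed (rule arcs_complete)

lemma wf_machine_kinds:
  assumes "ks \<in> set (machine_kinds c B M rs)" "k \<in> set ks"
  shows "wf_kind N k"
proof -
  have input: "wf_kind N (input_kind a d)" for a d by (cases d) auto
  have tape: "wf_kind N k" if "r \<in> rules M" "x \<in> set (zip (work_read r) (work_action r))"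
    "ks \<in> set (tape_kinds c B (fst x) (snd x))" "k \<in> set ks" for r x ks
  proof -
    have "fst x \<in> set (work_read r)" "snd x \<in> set (work_action r)"
      using that(2) by (metis prod.collapse set_zip_leftD, metis prod.collapse set_zip_rightD)
    then show ?thesis
      using wf_tape_kinds[OF that(3,4)] codes that(1) c B B0 by (meson less_le_trans)
  qed
  consider r where "r \<in> rules M" "ks \<in> set (rule_kinds c B r)" | "ks \<in> set (cleanup_kinds c M)"
    using assms(1) rs by (auto simp: machine_kinds_def)
  then show ?thesis
  proof cases
    case 1
    then obtain kss where kss: "list_all2 (\<lambda>x ys. x \<in> set ys) kss (map2 (tape_kinds c B) (work_read r) (work_action r))"
      and ks: "ks = [Edge (from_state r) (to_state r), input_kind (input_read r) (input_move r)] @ concat kss"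
      by (auto simp: rule_kinds_def product_lists_set)
    have "wf_kind N k" if k: "k \<in> set (concat kss)"
    proof -
      obtain ks' where ks': "ks' \<in> set kss" "k \<in> set ks'" using k by auto
      then obtain i where i: "i < length kss" "ks' = kss ! i" by (metis in_set_conv_nth)
      then have "ks' \<in> set (map2 (tape_kinds c B) (work_read r) (work_action r) ! i)"
        "i < length (zip (work_read r) (work_action r))"
        using kss by (auto simp: list_all2_conv_all_nth)
      then show ?thesis
        using tape[OF 1(1), of "zip (work_read r) (work_action r) ! i" ks'] ks'(2)
        by (metis (mono_tags, lifting) nth_map nth_mem case_prod_beta)
    qed
    then show ?thesis using assms(2) ks input states(1)[OF 1(1)] by auto
  next
    case 2
    then obtain i where "ks = (Edge (accept_state M) (accept_state M) # replicate (vertex_dim c M - 1) Keep)[i := Decr]"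
      by (auto simp: cleanup_kinds_def)
    then have "k \<in> insert Decr (set (Edge (accept_state M) (accept_state M) # replicate (vertex_dim c M - 1) Keep))"
      using assms(2) set_update_subset_insert by fastforce
    then show ?thesis using states(3) by (auto split: if_splits)
  qed
qed

abbreviation inst_graph :: factored_graph where
  "inst_graph \<equiv> unions N w (machine_kinds c B M rs)"

lemma machine_kinds_no_Nil: "[] \<notin> set (machine_kinds c B M rs)"
  using length_machine_kinds[OF wf rs, of "[]" c B] by (auto simp: vertex_dim_def)

lemma graph_of_instance:
  "pverts (graph_of inst_graph) = {v. length v = vertex_dim c M \<and> set v \<subseteq> {..<N}}"
  "parcs (graph_of inst_graph) = {(v, u). arc v u}"
  using graph_of_unions[OF machine_kinds_nonempty length_machine_kinds[OF wf rs], where N = N and w = w]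
  by (auto simp: vertex_dim_def arc_def)

lemma endpoints: "source \<in> pverts (graph_of inst_graph)" "target \<in> pverts (graph_of inst_graph)"
  using states N by (auto simp: graph_of_instance source_vertex_def target_vertex_def vertex_dim_def)

lemma arc_in:
  assumes "arc v u"
  shows "u \<in> pverts (graph_of inst_graph)"
proof -
  obtain ks where ks: "ks \<in> set (machine_kinds c B M rs)" "moves N w ks v u"
    using assms arc_def by blast
  then have len: "length u = length ks" and e: "\<And>i. i < length ks \<Longrightarrow> (v ! i, u ! i) \<in> set (kind_edges N w (ks ! i))"
    by (auto simp: moves_nth)
  have "u ! i < N" if "i < length ks" for i
    using wf_kind_edges[OF wf_machine_kinds[OF ks(1)] e[OF that]] that by simp
  then have "set u \<subseteq> {..<N}" using len by (auto simp: in_set_conv_nth)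
  then show ?thesis using len length_machine_kinds[OF wf rs ks(1)] by (simp add: graph_of_instance)
qed

text \<open>\<open>reachable\<close> asks for paths inside the vertex set. Both endpoints lie in it
  and no arc leads out of it, so this is the plain reflexive transitive closure.\<close>

lemma reachable_iff_accepts:
  "source \<rightarrow>\<^sup>*\<^bsub>with_proj (graph_of inst_graph)\<^esub> target \<longleftrightarrow> accepts M w"
proof -
  let ?V = "pverts (graph_of inst_graph)"
  have "(source, target) \<in> rtrancl_on ?V {(v, u). arc v u} \<longleftrightarrow> (source, target) \<in> {(v, u). arc v u}\<^sup>*"
    using rtrancl_consistent_rtrancl_on[of source target "{(v, u). arc v u}" ?V] endpoints arc_in
      rtrancl_on_rtranclI[of source target ?V "{(v, u). arc v u}"] by blast
  also have "\<dots> \<longleftrightarrow> arc\<^sup>*\<^sup>* source target" by (simp add: rtranclp_rtrancl_eq)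
  finally show ?thesis by (simp add: reachable_def graph_of_instance(2) arcs_iff_accepts)
qed

lemma wf_instance:
  "wf_factored inst_graph"
  "has_complexity inst_graph N (num_operations (machine_kinds c B M rs) + 1)"
  by (rule wf_unions[OF machine_kinds_nonempty machine_kinds_no_Nil], erule (1) wf_machine_kinds)+

end


section \<open>Choice of the constants and the time bound\<close>

text \<open>For large \<open>n\<close> the full rounds of cells contribute at most
  \<open>sqrt n\<close> to the size of a stack, and the one additional digit contributes a factor
  \<open>B \<le> sqrt n\<close>. The finitely many small \<open>n\<close> are absorbed by
  \<open>K\<close>.\<close>

lemma stack_parameters:
  fixes S :: "nat \<Rightarrow> nat" and B m :: nat
  assumes S: "(\<lambda>n. real (S n)) \<in> O(\<lambda>n. ln (real n))" and B: "0 < B"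
  obtains c K where "1 \<le> c" "c \<le> K" "B \<le> K" "m \<le> K" "1 \<le> K"
    "\<And>n. S n \<le> n + K" "\<And>n. B ^ (S n div c + 1) \<le> n + K"
proof -
  obtain a where a: "a > 0" "eventually (\<lambda>n. norm (real (S n)) \<le> a * norm (ln (real n))) at_top"
    using S by (elim landau_o.bigE)
  \<comment> \<open>From \<open>S n \<le> a * ln n\<close> follows
    \<open>B ^ (S n div c) \<le> exp (a * ln B / c * ln n)\<close>, and this choice makes
    \<open>a * ln B / c\<close> at most 1/2. The summand 1 keeps \<open>c\<close> positive when
    \<open>B = 1\<close>.\<close>
  define c where "c = nat \<lceil>2 * a * ln (real B)\<rceil> + 1"
  have lnB: "0 \<le> ln (real B)" using B by simp
  have c1: "1 \<le> c" by (simp add: c_def)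
  then have c0: "0 < real c" by simp
  have c: "2 * a * ln (real B) \<le> real c" unfolding c_def by linarith
  have "eventually (\<lambda>n. S n \<le> n \<and> B ^ (S n div c + 1) \<le> n) at_top"
  proof -
    have "(\<lambda>n. ln (real n)) \<in> o(\<lambda>n. real n)"
      by (rule smalloI_tendsto[OF filterlim_compose[OF ln_x_over_x_tendsto_0 filterlim_real_sequentially]])
        (use eventually_gt_at_top[of "0 :: nat"] in \<open>auto elim: eventually_mono\<close>)
    then have "(\<lambda>n. real (S n)) \<in> o(\<lambda>n. real n)"
      by (rule landau_o.big_small_trans[OF S])
    then have "eventually (\<lambda>n. norm (real (S n)) \<le> 1 * norm (real n)) at_top"
      by (rule landau_o.smallD) simp
    \<comment> \<open>\<open>n \<ge> B ^ 2\<close> gives \<open>B \<le> sqrt n\<close>, and the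
      summand 1 ensures \<open>n \<ge> 1\<close>, so that \<open>ln n\<close> is
      nonnegative.\<close>
    then show ?thesis using a(2) eventually_ge_at_top[of "B ^ 2 + 1"]
    proof eventually_elim
      case (elim n)
      then have n: "real (B ^ 2) \<le> real n" "1 \<le> real n" by linarith+
      have Sn: "real (S n) \<le> a * ln (real n)" using elim(2) n by simp
      have "ln (real B) * real (S n div c) \<le> ln (real B) * (real (S n) / real c)"
        using lnB by (intro mult_left_mono of_nat_div_le_of_nat)
      also have "\<dots> \<le> ln (real B) * (a * ln (real n) / real c)"
        using lnB Sn by (intro mult_left_mono divide_right_mono) auto
      also have "\<dots> = (2 * a * ln (real B)) * (ln (real n) / (2 * real c))" by simp
      also have "\<dots> \<le> real c * (ln (real n) / (2 * real c))"
        using c n by (intro mult_right_mono) auto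
      also have "\<dots> = ln (real n) / 2" using c0 by simp
      finally have le: "ln (real B) * real (S n div c) \<le> ln (real n) / 2" .
      have "real B ^ (S n div c) = exp (ln (real B) * real (S n div c))"
        using B by (simp add: exp_of_nat2_mult)
      also have "\<dots> \<le> exp (ln (real n) / 2)" using le by simp
      also have "\<dots> = sqrt (real n)" using n by (simp add: ln_sqrt[symmetric])
      finally have "real B ^ (S n div c) \<le> sqrt (real n)" .
      moreover have "real B \<le> sqrt (real n)" using n by (intro real_le_rsqrt) simp
      ultimately have "real B ^ (S n div c) * real B \<le> sqrt (real n) * sqrt (real n)"
        by (intro mult_mono) auto
      then have "real (B ^ (S n div c + 1)) \<le> real n" by (simp add: mult.commute)
      then show ?case using elim(1) by (simp only: of_nat_le_iff) simp
    qed
  qed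
  then obtain n0 where n0: "\<And>n. n \<ge> n0 \<Longrightarrow> S n \<le> n \<and> B ^ (S n div c + 1) \<le> n"
    unfolding eventually_at_top_linorder by blast
  \<comment> \<open>One constant above all finite requirements; the sum covers the exceptional
    lengths \<open>n < n0\<close>.\<close>
  define K where "K = c + B + m + (\<Sum>n<n0. S n + B ^ (S n div c + 1))"
  have small: "S n + B ^ (S n div c + 1) \<le> K" if "n < n0" for n
    using member_le_sum[of n "{..<n0}" "\<lambda>n. S n + B ^ (S n div c + 1)"] that unfolding K_def by simp
  show thesis
  proof (rule that[of c K])
    fix n
    show "S n \<le> n + K" "B ^ (S n div c + 1) \<le> n + K"
      using n0[of n] small[of n] by (cases "n < n0"; simp)+
  qed (use c1 in \<open>simp_all add: K_def\<close>)
qed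

lemma wf_kind_mono: "wf_kind N k \<Longrightarrow> N \<le> N' \<Longrightarrow> wf_kind N' k"
  by (cases k) auto

text \<open>For \<open>n \<ge> 1\<close> an additive constant turns into a factor,
  \<open>n + K + 4 \<le> (K + 5) * n\<close>. Both powers of \<open>n\<close> are then at most
  \<open>n ^ (C + 2)\<close>.\<close>

lemma power_bound_bigo:
  fixes a b d C K :: nat
  shows "(\<lambda>n. real (a * (n + K + 4) ^ 2 + b * (d * (n + 1 + K) ^ C))) \<in> O(\<lambda>n. real n ^ (C + 2))"
proof (rule bigoI)
  show "eventually (\<lambda>n. norm (real (a * (n + K + 4) ^ 2 + b * (d * (n + 1 + K) ^ C)))
      \<le> real (a * (K + 5) ^ 2 + b * (d * (K + 5) ^ C)) * norm (real n ^ (C + 2))) at_top"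
    using eventually_ge_at_top[of 1]
  proof eventually_elim
    case (elim n)
    have "n + K + 4 = (K + 4) * 1 + n" by simp
    also have "\<dots> \<le> (K + 4) * n + n" using elim by (intro add_right_mono mult_le_mono2)
    also have "\<dots> = (K + 5) * n" by (simp add: algebra_simps)
    finally have n1: "n + K + 4 \<le> (K + 5) * n" .
    then have n2: "n + 1 + K \<le> (K + 5) * n" by linarith
    have "(n + K + 4) ^ 2 \<le> (K + 5) ^ 2 * n ^ 2"
      unfolding power_mult_distrib[symmetric] by (rule power_mono[OF n1]) simp
    also have "\<dots> \<le> (K + 5) ^ 2 * n ^ (C + 2)" using elim by (intro mult_le_mono2 power_increasing) auto
    finally have 1: "a * (n + K + 4) ^ 2 \<le> a * ((K + 5) ^ 2 * n ^ (C + 2))" by (rule mult_le_mono2)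
    have "(n + 1 + K) ^ C \<le> (K + 5) ^ C * n ^ C"
      unfolding power_mult_distrib[symmetric] by (rule power_mono[OF n2]) simp
    also have "\<dots> \<le> (K + 5) ^ C * n ^ (C + 2)" using elim by (intro mult_le_mono2 power_increasing) auto
    finally have 2: "b * (d * (n + 1 + K) ^ C) \<le> b * (d * ((K + 5) ^ C * n ^ (C + 2)))"
      by (intro mult_le_mono2)
    have "a * (n + K + 4) ^ 2 + b * (d * (n + 1 + K) ^ C) \<le>
        (a * (K + 5) ^ 2 + b * (d * (K + 5) ^ C)) * n ^ (C + 2)"
      using add_mono[OF 1 2] by (simp add: algebra_simps)
    then have "real (a * (n + K + 4) ^ 2 + b * (d * (n + 1 + K) ^ C)) \<le>
        real ((a * (K + 5) ^ 2 + b * (d * (K + 5) ^ C)) * n ^ (C + 2))"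
      by (rule of_nat_mono)
    then show ?case by simp
  qed
qed

theorem theorem1p5:
  assumes "reachability_fpt"
  shows "\<exists>C :: nat. NL \<subseteq> DTIME (\<lambda>n. real n ^ C)"
proof -
  obtain M1 and g :: "nat \<Rightarrow> nat" and C c1 :: nat where M1: "wf_tm M1" "deterministic M1"
    and fpt: "\<And>F n k s t. \<lbrakk>wf_factored F; has_complexity F n k; s \<in> pverts (graph_of F); t \<in> pverts (graph_of F)\<rbrakk> \<Longrightarrow>
      halts_within M1 (encode_instance F s t) (c1 * (g k * n ^ C)) \<and>
      (accepts M1 (encode_instance F s t) \<longleftrightarrow> s \<rightarrow>\<^sup>*\<^bsub>with_proj (graph_of F)\<^esub> t)"
    using assms unfolding reachability_fpt_def by blast
  \<comment> \<open>\<open>C\<close> stems from the assumed algorithm alone, so the exponent is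
    fixed before \<open>L\<close> is given. The summand 2 covers the quadratic time for writing the
    instance.\<close>
  have "L \<in> DTIME (\<lambda>n. real n ^ (C + 2))" if "L \<in> NL" for L
  proof -
    from that[unfolded NL_def mem_Collect_eq] obtain \<Sigma> M S where
      \<Sigma>: "finite \<Sigma>" "L \<subseteq> lists \<Sigma>" and M: "wf_tm M" and S: "(\<lambda>n. real (S n)) \<in> O(\<lambda>n. ln (real n))"
      and decides: "\<forall>w \<in> lists \<Sigma>. (\<exists>T. halts_within M w T) \<and> space_within M w (S (length w)) \<and> (accepts M w \<longleftrightarrow> w \<in> L)"
      by (elim exE conjE)
    have L: "space_within M w (S (length w))" "accepts M w \<longleftrightarrow> w \<in> L" if "w \<in> lists \<Sigma>" for w
      using decides that by auto
    have fin: "finite (rules M)" using M by (simp add: wf_tm_def)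
    then obtain rs where rs: "set rs = rules M" using finite_list by blast
    let ?codes = "\<Union>r \<in> rules M. code ` set (work_read r) \<union> (code \<circ> fst) ` set (work_action r)"
    have "finite ?codes" using fin by auto
    then obtain B0 where B0: "\<forall>x \<in> ?codes. x < B0" unfolding finite_nat_set_iff_bounded by blast
    define B where "B = Suc B0"
    have B: "0 < B" "\<And>x. x \<in> ?codes \<Longrightarrow> x < B" using B0 by (auto simp: B_def less_Suc_eq)
    let ?states = "from_state ` rules M \<union> to_state ` rules M \<union> {start_state M, accept_state M}"
    have "finite ?states" using fin by simp
    then obtain m where m: "\<forall>x \<in> ?states. x < m" unfolding finite_nat_set_iff_bounded by blast
    obtain c K where cK: "1 \<le> c" "c \<le> K" "B \<le> K" "m \<le> K" "1 \<le> K"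
      "\<And>n. S n \<le> n + K" "\<And>n. B ^ (S n div c + 1) \<le> n + K"
      using stack_parameters[OF S B(1)] by metis
    let ?kss = "machine_kinds c B M rs"
    let ?F = "\<lambda>w. unions (size_of K w) w ?kss"
    let ?s = "source_vertex c M"
    let ?t = "target_vertex c M"
    let ?k = "num_operations ?kss + 1"
    have st: "x < size_of K w" if "x \<in> ?states" for x w
    proof -
      have "x < m" using m that by blast
      then show ?thesis using cK(4) by (simp add: size_of_def)
    qed
    have inst: "nl_instance c B (S (length w)) (size_of K w) w M rs" if "w \<in> lists \<Sigma>" for w
    proof unfold_locales
      show "S (length w) \<le> size_of K w" using cK(6)[of "length w"] by (simp add: size_of_def)
      show "B ^ (S (length w) div c + 1) \<le> size_of K w" using cK(7)[of "length w"] unfolding size_of_def by linarith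
      show "r \<in> rules M \<Longrightarrow> from_state r < size_of K w \<and> to_state r < size_of K w" for r
        using st[of "from_state r"] st[of "to_state r"] by simp
      show "start_state M < size_of K w" "accept_state M < size_of K w"
        using st by simp_all
      show "r \<in> rules M \<Longrightarrow> x \<in> set (work_action r) \<Longrightarrow> code (fst x) < B" for r x
        by (rule B(2)) force
      show "r \<in> rules M \<Longrightarrow> a \<in> set (work_read r) \<Longrightarrow> code a < B" for r a
        by (rule B(2)) force
    qed (use cK B M rs L(1)[OF that] in \<open>auto simp: size_of_def\<close>)
    have wf_kss: "wf_kind (size_of K w) k" if "ks \<in> set ?kss" "k \<in> set ks" for w ks k
    proof -
      \<comment> \<open>The kinds are the same for all words, and \<open>emits\<close> needs them
        well-formed for every \<open>w\<close>, even outside \<open>lists \<Sigma>\<close>. The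
        empty word always lies in \<open>lists \<Sigma>\<close> and has the least size, so
        well-formedness there carries over.\<close>
      interpret nl_instance c B "S (length ([] :: nat list))" "size_of K []" "[]" M rs by (rule inst) simp
      show ?thesis using wf_kind_mono[OF wf_machine_kinds[OF that]] by (simp add: size_of_def)
    qed
    have no_Nil: "[] \<notin> set ?kss"
    proof -
      interpret nl_instance c B "S (length ([] :: nat list))" "size_of K []" "[]" M rs by (rule inst) simp
      show ?thesis by (rule machine_kinds_no_Nil)
    qed
    let ?p = "Seq (emit_unions ?kss) (emit (encode_list ?s @ encode_list ?t))"
    let ?f = "\<lambda>w. encode_instance (?F w) ?s ?t"
    have p: "emits K ?p ?f"
      unfolding encode_instance_def
      by (intro emits_Seq emits_unions emits_emit machine_kinds_nonempty no_Nil wf_kss)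
    \<comment> \<open>The letters up to 7 are those of encoded instances; \<open>\<Sigma>\<close> is
      included because the programs also read the input.\<close>
    define \<Gamma> where "\<Gamma> = {Blank, Left_End, Right_End} \<union> Letter ` ({..7} \<union> \<Sigma>)"
    have \<Gamma>: "finite \<Gamma>" "{Left_End, Right_End} \<union> Letter ` {..7} \<subseteq> \<Gamma>" "Blank \<in> \<Gamma>"
      using \<Sigma>(1) by (auto simp: \<Gamma>_def)
    have "safe \<Gamma> ?p"
      using safe_unions[OF \<Gamma>(2)] safe_emit[OF \<Gamma>(2)] encode_list_bound by simp
    from generator[OF p \<Gamma>(2) this] obtain p' \<kappa> where p': "safe \<Gamma> p'"
      "\<And>w. \<exists>i t. runs w p' (\<kappa> * (size_of K w + 3) ^ 2) (0, \<lambda>_. (0, \<lambda>_. Blank)) (i, t) \<and>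
        fst (t Out) = 0 \<and> (\<forall>i \<le> length (?f w) + 1. snd (t Out) i = input_symbol (?f w) i)"
      by blast
    obtain M' where M': "wf_tm M'" "deterministic M'"
      "\<And>w v T U i t. \<lbrakk>\<And>i. input_symbol w i \<in> \<Gamma>; runs w p' T (0, \<lambda>_. (0, \<lambda>_. Blank)) (i, t);
         fst (t Out) = 0; \<And>i. i \<le> length v + 1 \<Longrightarrow> snd (t Out) i = input_symbol v i; halts_within M1 v U\<rbrakk> \<Longrightarrow>
         halts_within M' w (T + U) \<and> (accepts M' w \<longleftrightarrow> accepts M1 v)"
      using compose_machine[OF M1 \<Gamma>(1) p'(1) \<Gamma>(3)] by blast
    \<comment> \<open>\<open>?k\<close> is determined by \<open>c\<close>, \<open>B\<close>,
      \<open>M\<close> and \<open>rs\<close> and not by the word, so \<open>g ?k\<close> is a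
      constant factor. On a word of length \<open>n\<close>, \<open>size_of K w + 3\<close> is
      \<open>n + K + 4\<close>.\<close>
    define T where "T n = \<kappa> * (n + K + 4) ^ 2 + c1 * (g ?k * (n + 1 + K) ^ C)" for n
    have "halts_within M' w (T (length w)) \<and> (accepts M' w \<longleftrightarrow> w \<in> L)" if w: "w \<in> lists \<Sigma>" for w
    proof -
      interpret nl_instance c B "S (length w)" "size_of K w" w M rs by (rule inst[OF w])
      have M1w: "halts_within M1 (?f w) (c1 * (g ?k * size_of K w ^ C))"
        "accepts M1 (?f w) \<longleftrightarrow> accepts M w"
        using fpt[OF wf_instance endpoints] reachable_iff_accepts by blast+
      obtain i t where it: "runs w p' (\<kappa> * (size_of K w + 3) ^ 2) (0, \<lambda>_. (0, \<lambda>_. Blank)) (i, t)"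
        "fst (t Out) = 0" "\<And>i. i \<le> length (?f w) + 1 \<Longrightarrow> snd (t Out) i = input_symbol (?f w) i"
        using p'(2) by blast
      have "input_symbol w i \<in> \<Gamma>" for i
        using w by (auto simp: input_symbol_def \<Gamma>_def in_lists_conv_set)
      from M'(3)[OF this it M1w(1)] show ?thesis
        using M1w(2) L(2)[OF w] by (simp add: T_def size_of_def add.commute add.left_commute)
    qed
    moreover have "(\<lambda>n. real (T n)) \<in> O(\<lambda>n. real n ^ (C + 2))"
      unfolding T_def by (rule power_bound_bigo)
    ultimately show ?thesis
      unfolding DTIME_def using \<Sigma> M'(1,2) by blast
  qed
  then show ?thesis by blast
qed

end
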